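(* Suppose $SO(3)$ acts smoothly and freely on a manifold $Q$, and by cotangent lifts on $T^*Q$. Let $q_0\in Q$, choose a Riemannian metric near $q_0$, let $N\subset T_{q_0}Q$ be the orthogonal complement of $\mathfrak{so}(3)q_0$, and let $S\subset N$ be an open neighbourhood of $0$ such that $$\tau:SO(3)\times S\to Q,\qquad (R,s)\mapsto R\exp_{q_0}s,$$ is an ($SO(3)$-equivariant) diffeomorphism onto an open subset of $Q$, where $\exp_{q_0}$ is the Riemannian exponential. Let $0\ne\mu\in\mathfrak{so}(3)^*$ and let $\Phi:SO(3)\times U\to SO(3)\times\mathfrak{so}(3)^*$, with $U\subset\mathfrak{so}(3)_\mu^*\times T_\mu\mathcal O_\mu$, be the map $$\Phi(g,\nu,\operatorname{ad}^*_\eta\mu)=\Big(gF(\nu,\eta)^{-1},\operatorname{Ad}^*_{F(\nu,\eta)^{-1}}(\mu+\nu)\Big),\quad F(\nu,\eta)=\exp\left(2\arcsin\left(\tfrac12\|\eta\|\sqrt{\tfrac{\|\mu\|}{\|\mu+\nu\|}}\right)\tfrac{\eta}{\|\eta\|}\right),$$ with $F(\nu,0)=I$ and $U=\{(\nu,\operatorname{ad}^*_\eta\mu):\eta\in\mathfrak{so}(3)_\mu^\perp,\ \nu>-\|\mu\|,\ \|\eta\|<2\sqrt{\|\mu+\nu\|/\|\mu\|}\}$. Then the composition $$SO(3)\times U\times T^*S\ \xrightarrow{(\Phi,\mathrm{id})}\ SO(3)\times\mathfrak{so}(3)^*\times T^*S\ \cong\ T^*(SO(3)\times S)\ \xrightarrow{T^*\tau^{-1}}\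 T^*Q$$ (the middle isomorphism being left-trivialisation) is an $SO(3)$-equivariant symplectomorphism onto its image, with respect to the canonical symplectic form on $T^*Q$ and the symplectic form $\Omega_Y+\Omega_{T^*S}$ on $SO(3)\times U\times T^*S$, where $\Omega_{T^*S}$ is the canonical symplectic form of $T^*S$.
   Context: Write $G=SO(3)$, $\mathfrak g=\mathfrak{so}(3)$. Identify $\mathfrak{so}(3)\cong\mathbb R^3$ by the hat map $\hat{\mathbf v}\mathbf w=\mathbf v\times\mathbf w$ (bracket = cross product) and $\mathfrak{so}(3)^*\cong\mathbb R^3$ by the dot product; $\|\cdot\|$ is the Euclidean norm; $\exp$ (in $F$) is the matrix exponential. Conventions: $\langle\operatorname{ad}^*_\eta\mu,\xi\rangle=\langle\mu,[\eta,\xi]\rangle$; $\operatorname{Ad}^*_{g^{-1}}\nu$ is the coadjoint action of $g$ on $\nu$. $\mathfrak g_\mu=\{\xi:\operatorname{ad}^*_\xi\mu=0\}=\mathbb R\mu$ with orthogonal complement $\mathfrak g_\mu^\perp$; $\mathfrak g_\mu^*$ is identified with the elements of $\mathfrak g^*$ annihilating $\mathfrak g_\mu^\perp$, and with $\mathbb R$ via $\nu\leftrightarrow\nu\,\mu/\|\mu\|$. $\mathcal O_\mu$ is the coadjoint orbit and $T_\mu\mathcal O_\mu=\{\operatorname{ad}^*_\eta\mu:\eta\in\mathfrak g_\mu^\perp\}\cong\mathfrak g_\mu^\perp$. $\xi^\mu$ is the $\mathfrak g_\mu$-component of $\xi$. $\mathfrak{so}(3)q_0=\{\xi q_0:\xi\in\mathfrak{so}(3)\}$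 is the tangent space at $q_0$ to its orbit. Tangent vectors to $G$ are left-trivialised. The form $\Omega_Y$ on $G\times\mathfrak g_\mu^*\times T_\mu\mathcal O_\mu$ is, at $(g,\nu,\rho)$, $$\Omega_Y\big((\xi_1,\dot\nu_1,\operatorname{ad}^*_{\zeta_1}\mu),(\xi_2,\dot\nu_2,\operatorname{ad}^*_{\zeta_2}\mu)\big)=\langle\mu+\nu,[\xi_1,\xi_2]\rangle+\langle\dot\nu_2,\xi_1^\mu\rangle-\langle\dot\nu_1,\xi_2^\mu\rangle-\langle\mu,[\zeta_1,\zeta_2]\rangle .$$ Canonical symplectic forms on cotangent bundles are normalised as $\sum dq^i\wedge dp_i$ (minus the exterior derivative of the Liouville one-form), so that on $T^*G\cong G\times\mathfrak g^*$ the form at $(g,\nu)$ is $\langle\nu,[\xi_1,\xi_2]\rangle+\langle\rho_2,\xi_1\rangle-\langle\rho_1,\xi_2\rangle$, and on $T^*S$ it is $\langle\dot\sigma_2,\dot s_1\rangle-\langle\dot\sigma_1,\dot s_2\rangle$. $T^*\tau^{-1}$ is the cotangent lift of $\tau^{-1}$, i.e. the map covering $\tau$ given on fibres by the dual of $T\tau^{-1}$. $G$ acts on the source by left multiplication on the first factor. *)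

theory Defs
  imports "HOL-Analysis.Analysis"
begin

section \<open>Smooth manifolds\<close>

primrec Ck_on :: "nat \<Rightarrow> 'a set \<Rightarrow> ('a::real_normed_vector \<Rightarrow> 'b::real_normed_vector) \<Rightarrow> bool" where
  "Ck_on 0 T f \<longleftrightarrow> continuous_on T f"
| "Ck_on (Suc k) T f \<longleftrightarrow> (\<forall>x\<in>T. f differentiable (at x)) \<and>
     (\<forall>v. Ck_on k T (\<lambda>x. frechet_derivative f (at x) v))"

text \<open>Meaningful only for open \<open>T\<close>: the derivatives are two-sided.\<close>

definition smooth_on :: "'a set \<Rightarrow> ('a::real_normed_vector \<Rightarrow> 'b::real_normed_vector) \<Rightarrow> bool" where
  "smooth_on T f \<longleftrightarrow> (\<forall>k. Ck_on k T f)"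

text \<open>A chart is a pair of a domain and a coordinate map; a manifold is given by an atlas, which
  also determines its carrier and its topology. All charts take values in the same Euclidean space,
  so a manifold is of dimension \<open>DIM('e)\<close> throughout.\<close>

type_synonym ('q, 'e) chart = "'q set \<times> ('q \<Rightarrow> 'e)"

definition carrier_of :: "('q, 'e) chart set \<Rightarrow> 'q set" where
  "carrier_of A = \<Union> (fst ` A)"

definition manifold_topology :: "('q, 'e::euclidean_space) chart set \<Rightarrow> 'q topology" where
  "manifold_topology A =
     topology (\<lambda>W. W \<subseteq> carrier_of A \<and> (\<forall>(V, \<phi>)\<in>A. open (\<phi> ` (W \<inter> V))))"

definition smooth_manifold :: "('q, 'e::euclidean_space) chart set \<Rightarrow> bool" where
  "smooth_manifold A \<longleftrightarrow>
     (\<forall>(V, \<phi>)\<in>A. inj_on \<phi> V \<and> open (\<phi> ` V)) \<and>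
     (\<forall>(V, \<phi>)\<in>A. \<forall>(V', \<phi>')\<in>A.
        open (\<phi> ` (V \<inter> V')) \<and> smooth_on (\<phi> ` (V \<inter> V')) (\<phi>' \<circ> inv_into V \<phi>)) \<and>
     Hausdorff_space (manifold_topology A) \<and> second_countable (manifold_topology A)"

text \<open>Every point has a preferred chart, and the tangent space at the point is the model space
  \<open>'e\<close>, a vector being identified with its components in the preferred chart. Covectors are likewise
  elements of \<open>'e\<close>, by their components: \<open>p\<close> stands for the functional \<open>\<lambda>v. p \<bullet> v\<close>.\<close>

definition chart_at :: "('q, 'e) chart set \<Rightarrow> 'q \<Rightarrow> ('q, 'e) chart" where
  "chart_at A q = (SOME c. c \<in> A \<and> q \<in> fst c)"

definition coord_at :: "('q, 'e) chart set \<Rightarrow> 'q \<Rightarrow> 'q \<Rightarrow> 'e" where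
  "coord_at A q = snd (chart_at A q)"

definition param_at :: "('q, 'e) chart set \<Rightarrow> 'q \<Rightarrow> 'e \<Rightarrow> 'q" where
  "param_at A q = inv_into (fst (chart_at A q)) (snd (chart_at A q))"

definition velocity :: "('q, 'e::euclidean_space) chart set \<Rightarrow> (real \<Rightarrow> 'q) \<Rightarrow> 'e" where
  "velocity A \<gamma> = vector_derivative (coord_at A (\<gamma> 0) \<circ> \<gamma>) (at 0)"

definition self_tangent_map ::
    "('q, 'e::euclidean_space) chart set \<Rightarrow> ('q \<Rightarrow> 'q) \<Rightarrow> 'q \<Rightarrow> 'e \<Rightarrow> 'e" where
  "self_tangent_map A f q =
     frechet_derivative (coord_at A (f q) \<circ> f \<circ> param_at A q) (at (coord_at A q q))"

text \<open>The tangent map of \<open>\<phi>\<inverse>\<close> at \<open>\<phi> q\<close>: it takes components in the chart \<open>(V, \<phi>)\<close>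
  to a tangent vector at \<open>q\<close>.\<close>

definition from_chart ::
    "('q, 'e::euclidean_space) chart set \<Rightarrow> ('q, 'e) chart \<Rightarrow> 'q \<Rightarrow> 'e \<Rightarrow> 'e" where
  "from_chart A = (\<lambda>(V, \<phi>) q.
     frechet_derivative (coord_at A q \<circ> inv_into V \<phi>) (at (\<phi> q)))"

text \<open>Maps from a subset \<open>X\<close> of a Euclidean space (in the uses below, an embedded submanifold) to a
  manifold are smooth if they are locally restrictions of smooth maps; conversely, a map from an open
  subset of a manifold to \<open>X\<close> is smooth if it is so as a map to the ambient space.\<close>

definition smooth_into ::
    "'x::euclidean_space set \<Rightarrow> ('q, 'e::euclidean_space) chart set \<Rightarrow> ('x \<Rightarrow> 'q) \<Rightarrow> bool" where
  "smooth_into X A f \<longleftrightarrow> f ` X \<subseteq> carrier_of A \<and>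
     (\<forall>x\<in>X. \<forall>(V, \<phi>)\<in>A. f x \<in> V \<longrightarrow>
        (\<exists>Y k. open Y \<and> x \<in> Y \<and> smooth_on Y k \<and> (\<forall>y\<in>X \<inter> Y. f y \<in> V \<and> \<phi> (f y) = k y)))"

definition smooth_from ::
    "('q, 'e::euclidean_space) chart set \<Rightarrow> 'q set \<Rightarrow> ('q \<Rightarrow> 'x::euclidean_space) \<Rightarrow> bool" where
  "smooth_from A W f \<longleftrightarrow> (\<forall>(V, \<phi>)\<in>A. smooth_on (\<phi> ` (V \<inter> W)) (f \<circ> inv_into V \<phi>))"

definition diffeo_onto_open ::
    "'x::euclidean_space set \<Rightarrow> ('q, 'e::euclidean_space) chart set \<Rightarrow> ('x \<Rightarrow> 'q) \<Rightarrow> bool" where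
  "diffeo_onto_open X A f \<longleftrightarrow> inj_on f X \<and> openin (manifold_topology A) (f ` X) \<and>
     smooth_into X A f \<and> smooth_from A (f ` X) (inv_into X f)"

section \<open>Cotangent bundles\<close>

text \<open>The covector \<open>p\<close> at \<open>q\<close> has components \<open>p'\<close> in the chart \<open>(V, \<phi>)\<close>, where
  \<open>p' \<bullet> v = p \<bullet> from_chart A (V, \<phi>) q v\<close> for all \<open>v\<close>.\<close>

definition cotangent_chart ::
    "('q, 'e::euclidean_space) chart set \<Rightarrow> ('q, 'e) chart \<Rightarrow> ('q \<times> 'e, 'e \<times> 'e) chart" where
  "cotangent_chart A c =
     (fst c \<times> UNIV, \<lambda>(q, p). (snd c q, adjoint (from_chart A c q) p))"

definition cotangent_atlas ::
    "('q, 'e::euclidean_space) chart set \<Rightarrow> ('q \<times> 'e, 'e \<times> 'e) chart set" where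
  "cotangent_atlas A = cotangent_chart A ` A"

text \<open>The form \<open>\<Sum> dq\<^sup>i \<and> dp\<^sub>i\<close>. Tangent vectors to the cotangent bundle are given by components in
  some chart of \<open>cotangent_atlas\<close>, that is, in canonical coordinates \<open>(q\<^sup>i, p\<^sub>i)\<close>.\<close>

definition canonical_form :: "'e::euclidean_space \<times> 'e \<Rightarrow> 'e \<times> 'e \<Rightarrow> real" where
  "canonical_form = (\<lambda>(q1, p1) (q2, p2). p2 \<bullet> q1 - p1 \<bullet> q2)"

section \<open>The rotation group and its Lie algebra\<close>

definition SO3 :: "(real^3^3) set" where
  "SO3 = {R. rotation_matrix R}"

definition hat :: "real^3 \<Rightarrow> real^3^3" where
  "hat v = matrix (cross3 v)"

text \<open>The library's multiplication on \<open>real^3^3\<close> is componentwise, hence so are its powers and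
  exponentials.\<close>

primrec mat_power :: "real^3^3 \<Rightarrow> nat \<Rightarrow> real^3^3" where
  "mat_power X 0 = mat 1"
| "mat_power X (Suc k) = X ** mat_power X k"

definition mat_exp :: "real^3^3 \<Rightarrow> real^3^3" where
  "mat_exp X = (\<Sum>k. mat_power X k /\<^sub>R fact k)"

text \<open>The Lie algebra and its dual are both \<open>real^3\<close>, paired by the dot product. Here \<open>coadj R\<close> is
  the coadjoint action of \<open>R\<close>, i.e. the dual of \<open>Ad\<close> of the inverse of \<open>R\<close>.\<close>

definition Ad :: "real^3^3 \<Rightarrow> real^3 \<Rightarrow> real^3" where
  "Ad R \<xi> = inv hat (R ** hat \<xi> ** matrix_inv R)"

definition coadj :: "real^3^3 \<Rightarrow> real^3 \<Rightarrow> real^3" where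
  "coadj R = adjoint (Ad (matrix_inv R))"

definition adstar :: "real^3 \<Rightarrow> real^3 \<Rightarrow> real^3" where
  "adstar \<eta> = adjoint (cross3 \<eta>)"

definition isotropy :: "real^3 \<Rightarrow> (real^3) set" where
  "isotropy \<mu> = {\<xi>. adstar \<xi> \<mu> = 0}"

definition isotropy_compl :: "real^3 \<Rightarrow> (real^3) set" where
  "isotropy_compl \<mu> = orthogonal_comp (isotropy \<mu>)"

definition isotropy_dual :: "real^3 \<Rightarrow> (real^3) set" where
  "isotropy_dual \<mu> = {\<nu>. \<forall>\<xi>\<in>isotropy_compl \<mu>. \<nu> \<bullet> \<xi> = 0}"

definition isotropy_part :: "real^3 \<Rightarrow> real^3 \<Rightarrow> real^3" where
  "isotropy_part \<mu> \<xi> = (THE a. a \<in> isotropy \<mu> \<and> \<xi> - a \<in> isotropy_compl \<mu>)"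

definition orbit_tangent :: "real^3 \<Rightarrow> (real^3) set" where
  "orbit_tangent \<mu> = (\<lambda>\<eta>. adstar \<eta> \<mu>) ` isotropy_compl \<mu>"

definition orbit_gen :: "real^3 \<Rightarrow> real^3 \<Rightarrow> real^3" where
  "orbit_gen \<mu> \<rho> = (THE \<eta>. \<eta> \<in> isotropy_compl \<mu> \<and> adstar \<eta> \<mu> = \<rho>)"

section \<open>Products with the rotation group\<close>

text \<open>Tangent vectors at \<open>(g, x)\<close> to a product of \<open>SO3\<close> with a subset of a vector space are
  left-trivialised: \<open>(\<xi>, v)\<close> stands for the velocity at \<open>0\<close> of the following curve.\<close>

definition lt_curve ::
    "(real^3^3) \<times> 'x::euclidean_space \<Rightarrow> (real^3) \<times> 'x \<Rightarrow> real \<Rightarrow> (real^3^3) \<times> 'x" where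
  "lt_curve = (\<lambda>(g, x) (\<xi>, v) t. (g ** mat_exp (t *\<^sub>R hat \<xi>), x + t *\<^sub>R v))"

definition lt_tangent_map ::
    "('q, 'e::euclidean_space) chart set \<Rightarrow> ((real^3^3) \<times> 'x::euclidean_space \<Rightarrow> 'q) \<Rightarrow>
     (real^3^3) \<times> 'x \<Rightarrow> (real^3) \<times> 'x \<Rightarrow> 'e" where
  "lt_tangent_map A f z v = velocity A (f \<circ> lt_curve z v)"

section \<open>Actions of the rotation group\<close>

definition smooth_action ::
    "('q, 'e::euclidean_space) chart set \<Rightarrow> (real^3^3 \<Rightarrow> 'q \<Rightarrow> 'q) \<Rightarrow> bool" where
  "smooth_action A act \<longleftrightarrow>
     (\<forall>q\<in>carrier_of A. act (mat 1) q = q) \<and>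
     (\<forall>R\<in>SO3. \<forall>q\<in>carrier_of A. act R q \<in> carrier_of A) \<and>
     (\<forall>R\<in>SO3. \<forall>R'\<in>SO3. \<forall>q\<in>carrier_of A. act (R ** R') q = act R (act R' q)) \<and>
     (\<forall>(V, \<phi>)\<in>A. smooth_into (SO3 \<times> \<phi> ` V) A (\<lambda>(R, y). act R (inv_into V \<phi> y)))"

definition free_action ::
    "('q, 'e) chart set \<Rightarrow> (real^3^3 \<Rightarrow> 'q \<Rightarrow> 'q) \<Rightarrow> bool" where
  "free_action A act \<longleftrightarrow> (\<forall>R\<in>SO3. \<forall>q\<in>carrier_of A. act R q = q \<longrightarrow> R = mat 1)"

definition group_orbit_tangent ::
    "('q, 'e::euclidean_space) chart set \<Rightarrow> (real^3^3 \<Rightarrow> 'q \<Rightarrow> 'q) \<Rightarrow> 'q \<Rightarrow> 'e set" where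
  "group_orbit_tangent A act q = range (\<lambda>\<xi>. velocity A (\<lambda>t. act (mat_exp (t *\<^sub>R hat \<xi>)) q))"

text \<open>The cotangent lift of the action of \<open>R\<close> is the dual, on each fibre, of the tangent map of the
  action of the inverse of \<open>R\<close>.\<close>

definition cotangent_lift ::
    "('q, 'e::euclidean_space) chart set \<Rightarrow> (real^3^3 \<Rightarrow> 'q \<Rightarrow> 'q) \<Rightarrow> real^3^3 \<Rightarrow>
     'q \<times> 'e \<Rightarrow> 'q \<times> 'e" where
  "cotangent_lift A act R = (\<lambda>(q, p).
     (act R q, adjoint (self_tangent_map A (act (matrix_inv R)) (act R q)) p))"

section \<open>Riemannian metrics and the exponential map\<close>

definition metric_coord ::
    "('q, 'e::euclidean_space) chart set \<Rightarrow> ('q \<Rightarrow> 'e \<Rightarrow> 'e \<Rightarrow> real) \<Rightarrow> ('q, 'e) chart \<Rightarrow>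
     'e \<Rightarrow> 'e \<Rightarrow> 'e \<Rightarrow> real" where
  "metric_coord A h c y u v =
     (let q = inv_into (fst c) (snd c) y in h q (from_chart A c q u) (from_chart A c q v))"

definition riemannian_metric ::
    "('q, 'e::euclidean_space) chart set \<Rightarrow> 'q set \<Rightarrow> ('q \<Rightarrow> 'e \<Rightarrow> 'e \<Rightarrow> real) \<Rightarrow> bool" where
  "riemannian_metric A W h \<longleftrightarrow>
     (\<forall>q\<in>W. bilinear (h q) \<and> (\<forall>u v. h q u v = h q v u) \<and> (\<forall>v. v \<noteq> 0 \<longrightarrow> h q v v > 0)) \<and>
     (\<forall>c\<in>A. \<forall>u v. smooth_on (snd c ` (fst c \<inter> W)) (\<lambda>y. metric_coord A h c y u v))"

text \<open>The Christoffel symbols of the first kind, contracted with three vectors: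
  \<open>\<Gamma>(u, v, w) = 1/2 (D\<^sub>u h(v, w) + D\<^sub>v h(u, w) - D\<^sub>w h(u, v))\<close> for constant \<open>u\<close>, \<open>v\<close>, \<open>w\<close>.\<close>

definition christoffel ::
    "('q, 'e::euclidean_space) chart set \<Rightarrow> ('q \<Rightarrow> 'e \<Rightarrow> 'e \<Rightarrow> real) \<Rightarrow> ('q, 'e) chart \<Rightarrow>
     'e \<Rightarrow> 'e \<Rightarrow> 'e \<Rightarrow> 'e \<Rightarrow> real" where
  "christoffel A h c y u v w =
     (let D = (\<lambda>a b. frechet_derivative (\<lambda>z. metric_coord A h c z a b) (at y))
      in (D v w u + D u w v - D u v w) / 2)"

text \<open>The geodesic equation of the Levi-Civita connection, with the index lowered by the metric.\<close>

definition geodesic ::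
    "('q, 'e::euclidean_space) chart set \<Rightarrow> 'q set \<Rightarrow> ('q \<Rightarrow> 'e \<Rightarrow> 'e \<Rightarrow> real) \<Rightarrow> real set \<Rightarrow>
     (real \<Rightarrow> 'q) \<Rightarrow> bool" where
  "geodesic A W h J \<gamma> \<longleftrightarrow> smooth_into J A \<gamma> \<and> \<gamma> ` J \<subseteq> W \<and>
     (\<forall>t\<in>J. \<forall>c\<in>A. \<gamma> t \<in> fst c \<longrightarrow>
       (let x = snd c \<circ> \<gamma>; x' = (\<lambda>r. vector_derivative x (at r)); x'' = vector_derivative x' (at t)
        in \<forall>w. metric_coord A h c (x t) x'' w + christoffel A h c (x t) (x' t) (x' t) w = 0))"

definition geodesic_endpoint ::
    "('q, 'e::euclidean_space) chart set \<Rightarrow> 'q set \<Rightarrow> ('q \<Rightarrow> 'e \<Rightarrow> 'e \<Rightarrow> real) \<Rightarrow> 'q \<Rightarrow> 'e \<Rightarrow>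
     'q \<Rightarrow> bool" where
  "geodesic_endpoint A W h q0 s q \<longleftrightarrow> (\<exists>\<gamma>. \<exists>\<epsilon>>0.
     geodesic A W h {-\<epsilon><..<1 + \<epsilon>} \<gamma> \<and> \<gamma> 0 = q0 \<and> velocity A \<gamma> = s \<and> \<gamma> 1 = q)"

definition riem_exp_domain ::
    "('q, 'e::euclidean_space) chart set \<Rightarrow> 'q set \<Rightarrow> ('q \<Rightarrow> 'e \<Rightarrow> 'e \<Rightarrow> real) \<Rightarrow> 'q \<Rightarrow> 'e set" where
  "riem_exp_domain A W h q0 = {s. \<exists>q. geodesic_endpoint A W h q0 s q}"

definition riem_exp ::
    "('q, 'e::euclidean_space) chart set \<Rightarrow> 'q set \<Rightarrow> ('q \<Rightarrow> 'e \<Rightarrow> 'e \<Rightarrow> real) \<Rightarrow> 'q \<Rightarrow> 'e \<Rightarrow> 'q" where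
  "riem_exp A W h q0 s = (THE q. geodesic_endpoint A W h q0 s q)"

section \<open>The symplectic tube\<close>

text \<open>For a subspace \<open>N\<close> of \<open>'e\<close> and \<open>T\<close> open in \<open>N\<close>, the dual of \<open>N\<close> is identified with \<open>N\<close> by the
  dot product, and the cotangent bundle of \<open>T\<close> with \<open>T \<times> N\<close>.\<close>

definition tube_F :: "real^3 \<Rightarrow> real^3 \<Rightarrow> real^3 \<Rightarrow> real^3^3" where
  "tube_F \<mu> \<nu> \<eta> = (if \<eta> = 0 then mat 1 else
     mat_exp (hat ((2 * arcsin (1/2 * norm \<eta> * sqrt (norm \<mu> / norm (\<mu> + \<nu>))))
                    *\<^sub>R (\<eta> /\<^sub>R norm \<eta>))))"

definition tube_U :: "real^3 \<Rightarrow> ((real^3) \<times> (real^3)) set" where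
  "tube_U \<mu> = {(\<nu>, adstar \<eta> \<mu>) | \<nu> \<eta> x. \<eta> \<in> isotropy_compl \<mu> \<and>
     \<nu> = x *\<^sub>R (\<mu> /\<^sub>R norm \<mu>) \<and> x > - norm \<mu> \<and>
     norm \<eta> < 2 * sqrt (norm (\<mu> + \<nu>) / norm \<mu>)}"

definition tube_Phi ::
    "real^3 \<Rightarrow> (real^3^3) \<times> (real^3) \<times> (real^3) \<Rightarrow> (real^3^3) \<times> (real^3)" where
  "tube_Phi \<mu> = (\<lambda>(g, \<nu>, \<rho>). let F = tube_F \<mu> \<nu> (orbit_gen \<mu> \<rho>)
     in (g ** matrix_inv F, coadj F (\<mu> + \<nu>)))"

text \<open>The cotangent lift of \<open>\<tau>\<inverse>\<close>, precomposed with left-trivialisation: \<open>((R, s), (m, \<sigma>))\<close> stands for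
  the covector \<open>(\<xi>, v) \<mapsto> m \<bullet> \<xi> + \<sigma> \<bullet> v\<close> at \<open>(R, s)\<close>, on left-trivialised tangent vectors. It is
  composed with the tangent map of \<open>\<tau>\<inverse>\<close> at \<open>\<tau> (R, s)\<close>.\<close>

definition cotangent_lift_inverse ::
    "('q, 'e::euclidean_space) chart set \<Rightarrow> 'e set \<Rightarrow> ((real^3^3) \<times> 'e \<Rightarrow> 'q) \<Rightarrow>
     ((real^3^3) \<times> 'e) \<times> ((real^3) \<times> 'e) \<Rightarrow> 'q \<times> 'e" where
  "cotangent_lift_inverse A N \<tau> = (\<lambda>(z, \<alpha>).
     (\<tau> z, THE p. \<forall>w. p \<bullet> w = \<alpha> \<bullet> inv_into (UNIV \<times> N) (lt_tangent_map A \<tau> z) w))"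

definition tube ::
    "('q, 'e::euclidean_space) chart set \<Rightarrow> 'e set \<Rightarrow> ((real^3^3) \<times> 'e \<Rightarrow> 'q) \<Rightarrow> real^3 \<Rightarrow>
     (real^3^3) \<times> ((real^3) \<times> (real^3)) \<times> ('e \<times> 'e) \<Rightarrow> 'q \<times> 'e" where
  "tube A N \<tau> \<mu> = (\<lambda>(g, (\<nu>, \<rho>), (s, \<sigma>)).
     let (R, m) = tube_Phi \<mu> (g, \<nu>, \<rho>) in cotangent_lift_inverse A N \<tau> ((R, s), (m, \<sigma>)))"

definition Omega_Y :: "real^3 \<Rightarrow> (real^3^3) \<times> (real^3) \<times> (real^3) \<Rightarrow>
    (real^3) \<times> (real^3) \<times> (real^3) \<Rightarrow> (real^3) \<times> (real^3) \<times> (real^3) \<Rightarrow> real" where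
  "Omega_Y \<mu> = (\<lambda>(g, \<nu>, \<rho>) (\<xi>1, \<nu>1, \<rho>1) (\<xi>2, \<nu>2, \<rho>2).
     (\<mu> + \<nu>) \<bullet> cross3 \<xi>1 \<xi>2 + \<nu>2 \<bullet> isotropy_part \<mu> \<xi>1 - \<nu>1 \<bullet> isotropy_part \<mu> \<xi>2
     - \<mu> \<bullet> cross3 (orbit_gen \<mu> \<rho>1) (orbit_gen \<mu> \<rho>2))"

definition tube_source ::
    "real^3 \<Rightarrow> 'e::euclidean_space set \<Rightarrow> 'e set \<Rightarrow>
     ((real^3^3) \<times> ((real^3) \<times> (real^3)) \<times> ('e \<times> 'e)) set" where
  "tube_source \<mu> N T = SO3 \<times> tube_U \<mu> \<times> (T \<times> N)"

definition tube_source_tangent ::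
    "real^3 \<Rightarrow> 'e::euclidean_space set \<Rightarrow>
     ((real^3) \<times> ((real^3) \<times> (real^3)) \<times> ('e \<times> 'e)) set" where
  "tube_source_tangent \<mu> N = UNIV \<times> (isotropy_dual \<mu> \<times> orbit_tangent \<mu>) \<times> (N \<times> N)"

definition tube_source_form ::
    "real^3 \<Rightarrow> (real^3^3) \<times> ((real^3) \<times> (real^3)) \<times> ('e::euclidean_space \<times> 'e) \<Rightarrow>
     (real^3) \<times> ((real^3) \<times> (real^3)) \<times> ('e \<times> 'e) \<Rightarrow>
     (real^3) \<times> ((real^3) \<times> (real^3)) \<times> ('e \<times> 'e) \<Rightarrow> real" where
  "tube_source_form \<mu> = (\<lambda>(g, (\<nu>, \<rho>), z) (\<xi>1, (\<nu>1, \<rho>1), z1) (\<xi>2, (\<nu>2, \<rho>2), z2).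
     Omega_Y \<mu> (g, \<nu>, \<rho>) (\<xi>1, \<nu>1, \<rho>1) (\<xi>2, \<nu>2, \<rho>2) + canonical_form z1 z2)"

text \<open>A symplectomorphism from \<open>X\<close>, with tangent spaces \<open>TX\<close> (left-trivialised) and form \<open>\<omega>\<close>, onto
  its image in the cotangent bundle.\<close>

definition symplectomorphism_onto_image ::
    "((real^3^3) \<times> 'x::euclidean_space) set \<Rightarrow> ((real^3) \<times> 'x) set \<Rightarrow>
     ((real^3^3) \<times> 'x \<Rightarrow> (real^3) \<times> 'x \<Rightarrow> (real^3) \<times> 'x \<Rightarrow> real) \<Rightarrow>
     ('q, 'e::euclidean_space) chart set \<Rightarrow> ((real^3^3) \<times> 'x \<Rightarrow> 'q \<times> 'e) \<Rightarrow> bool" where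
  "symplectomorphism_onto_image X TX \<omega> A f \<longleftrightarrow>
     diffeo_onto_open X (cotangent_atlas A) f \<and>
     (\<forall>x\<in>X. \<forall>v\<in>TX. \<forall>w\<in>TX.
        canonical_form (lt_tangent_map (cotangent_atlas A) f x v)
                       (lt_tangent_map (cotangent_atlas A) f x w) = \<omega> x v w)"

end

theory Submission
  imports Defs
begin

text \<open>A chart \<open>\<phi>\<close> of \<open>Q\<close> turns \<open>T\<^sup>*\<tau>\<inverse>\<close> into
  \<open>(z, \<alpha>) \<mapsto> (\<phi> (\<tau> z), P)\<close>, where \<open>P\<close> is \<open>\<alpha>\<close> composed with the left-trivialised derivative of
  \<open>\<tau>\<inverse>\<close>. Differentiating \<open>P \<bullet> d(\<phi> \<circ> \<tau>) u = \<alpha> \<bullet> u\<close> along curves and antisymmetrising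
  gives the form of \<open>T\<^sup>*(SO(3) \<times> S)\<close>, so only \<open>\<Phi>\<close> remains. Since \<open>sin\<close> of half the angle of \<open>F\<close> is
  half the length of \<open>c \<eta>\<close>, \<open>c = sqrt (norm \<mu> / norm (\<mu> + \<nu>))\<close>, the rotation \<open>F\<close> is that of the unit
  quaternion \<open>w + v\<close> with \<open>v = c \<eta> / 2\<close>: it is a polynomial in \<open>w\<close> and \<open>v\<close>, hence smooth at
  \<open>\<eta> = 0\<close>, and \<open>\<Phi>\<close> has an explicit smooth inverse on
  \<open>{m. norm \<mu> * norm m + \<mu> \<bullet> m > 0}\<close>. With \<open>\<beta> = 2 (w v' - w' v - v \<times> v')\<close> its logarithmic
  derivative, \<open>\<Phi>\<close> changes the form by a term in \<open>\<beta>\<close> which the factor \<open>c\<close> makes equal to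
  \<open>- \<langle>\<mu>, [\<zeta>\<^sub>1, \<zeta>\<^sub>2]\<rangle>\<close>. Equivariance needs \<open>exp\<^sub>q\<^sub>0 s \<in> Q\<close>; as the exponential is a
  description, this rests on uniqueness of geodesics.\<close>

subsection \<open>Calculus of smooth maps\<close>

text \<open>Where the square root in \<open>tube_F\<close> comes from: write \<mu> + \<nu> = l \<mu>
  and v = a \<eta> with \<open>a\<close> a function of \<open>l\<close>. In the form pulled back by
  \<Phi>, the terms that mix the variation of \<nu> with that of \<eta> cancel exactly when da/dl =
  - a / (2 l), so \<open>a\<close> is a multiple of l^(-1/2). The coefficient of the remaining term
  is 4 l a^2, and making it 1 gives a = 1 / (2 sqrt l). Two obstacles shape the proof. The source is
  not open in its ambient vector space, so maps on it have no Frechet derivative of their own: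
  derivatives are taken along curves that stay in the source, or of local smooth extensions
  evaluated on tangent vectors. And inverses, generators and preferred charts are given by choice or
  description: each is replaced by an explicit total formula, or the computation is done in an
  arbitrary chart and transported by transition derivatives.\<close>

lemma Ck_on_cong:
  fixes f :: "'a::real_normed_vector \<Rightarrow> 'b::real_normed_vector"
  assumes "open T" "Ck_on k T f" "\<And>x. x \<in> T \<Longrightarrow> f x = g x"
  shows "Ck_on k T g"
  using assms(2,3)
proof (induction k arbitrary: f g)
  case 0
  then show ?case by (simp cong: continuous_on_cong)
next
  case (Suc k)
  have f: "(f has_derivative frechet_derivative f (at x)) (at x)" if "x \<in> T" for x
    using Suc.prems(1) that by (simp add: frechet_derivative_works)
  have g: "(g has_derivative frechet_derivative f (at x)) (at x)" if "x \<in> T" for x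
    by (rule has_derivative_transform_within_open[OF f[OF that] \<open>open T\<close> that Suc.prems(2)])
  have eq: "frechet_derivative f (at x) = frechet_derivative g (at x)" if "x \<in> T" for x
    by (rule frechet_derivative_at[OF g[OF that]])
  have "Ck_on k T (\<lambda>x. frechet_derivative g (at x) v)" for v
    by (rule Suc.IH[of "\<lambda>x. frechet_derivative f (at x) v"]) (use Suc.prems(1) eq in auto)
  then show ?case
    using g by (auto simp: differentiable_def)
qed

text \<open>Accepts any derivative in place of the description \<open>frechet_derivative\<close>.
  The closure rules exhibit a derivative whose values in fixed directions are again built from
  functions of class k, and induct.\<close>

lemma Ck_on_SucI:
  assumes "open T" "\<And>x. x \<in> T \<Longrightarrow> (f has_derivative f' x) (at x)"
    and "\<And>v. Ck_on k T (\<lambda>x. f' x v)"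
  shows "Ck_on (Suc k) T f"
proof -
  have "Ck_on k T (\<lambda>x. frechet_derivative f (at x) v)" for v
    by (rule Ck_on_cong[OF assms(1) assms(3)[of v]])
      (simp add: frechet_derivative_at[OF assms(2), symmetric])
  then show ?thesis
    using assms(2) by (auto simp: differentiable_def)
qed

lemma Ck_on_Suc_has_derivative:
  "Ck_on (Suc k) T f \<Longrightarrow> x \<in> T \<Longrightarrow> (f has_derivative frechet_derivative f (at x)) (at x)"
  by (simp add: frechet_derivative_works)

lemma Ck_on_Suc_imp: "Ck_on (Suc k) T f \<Longrightarrow> Ck_on k T f"
proof (induction k arbitrary: f)
  case 0
  then show ?case
    by (auto intro!: differentiable_imp_continuous_on
        simp: differentiable_on_def differentiable_at_withinI)
next
  case (Suc k)
  then show ?case by (metis Ck_on.simps(2))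
qed

lemma Ck_on_subset: "Ck_on k T f \<Longrightarrow> U \<subseteq> T \<Longrightarrow> Ck_on k U f"
  by (induction k arbitrary: f) (auto intro: continuous_on_subset)

lemma Ck_on_local:
  assumes "\<And>x. x \<in> T \<Longrightarrow> \<exists>U. open U \<and> x \<in> U \<and> Ck_on k U f"
  shows "Ck_on k T f"
  using assms
proof (induction k arbitrary: f)
  case 0
  have "continuous (at x within T) f" if "x \<in> T" for x
    using 0[OF that] by (metis Ck_on.simps(1) continuous_at_imp_continuous_within
        continuous_on_eq_continuous_at)
  then show ?case
    by (simp add: continuous_on_eq_continuous_within)
next
  case (Suc k)
  have "Ck_on k T (\<lambda>x. frechet_derivative f (at x) v)" for v
    by (rule Suc.IH) (metis Ck_on.simps(2) Suc.prems)
  moreover have "\<forall>x\<in>T. f differentiable (at x)"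
    by (metis Ck_on.simps(2) Suc.prems)
  ultimately show ?case by simp
qed

lemma Ck_on_const: "Ck_on k T (\<lambda>x. c)"
  by (induction k arbitrary: c) auto

lemma Ck_on_ident: "Ck_on k T (\<lambda>x. x)"
  by (cases k) (auto simp: Ck_on_const)

lemma Ck_on_linear:
  assumes "bounded_linear L" "open T" "Ck_on k T f"
  shows "Ck_on k T (\<lambda>x. L (f x))"
  using assms(3)
proof (induction k arbitrary: f)
  case 0
  then show ?case using assms(1) by (simp add: bounded_linear.continuous_on)
next
  case (Suc k)
  have "((\<lambda>x. L (f x)) has_derivative (\<lambda>v. L (frechet_derivative f (at x) v))) (at x)"
    if "x \<in> T" for x
    by (rule bounded_linear.has_derivative[OF assms(1) Ck_on_Suc_has_derivative[OF Suc.prems that]])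
  then show ?case
    using Suc.IH Suc.prems by (intro Ck_on_SucI[OF \<open>open T\<close>]) auto
qed

lemma Ck_on_add:
  assumes "open T" "Ck_on k T f" "Ck_on k T g"
  shows "Ck_on k T (\<lambda>x. f x + g x)"
  using assms(2,3)
proof (induction k arbitrary: f g)
  case 0
  then show ?case by (simp add: continuous_on_add)
next
  case (Suc k)
  have "((\<lambda>x. f x + g x) has_derivative
      (\<lambda>v. frechet_derivative f (at x) v + frechet_derivative g (at x) v)) (at x)"
    if "x \<in> T" for x
    by (rule has_derivative_add[OF Suc.prems[THEN Ck_on_Suc_has_derivative, OF that]])
  then show ?case
    using Suc.IH Suc.prems by (intro Ck_on_SucI[OF \<open>open T\<close>]) auto
qed

lemma Ck_on_sum:
  assumes "open T" "\<And>i. i \<in> I \<Longrightarrow> Ck_on k T (f i)"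
  shows "Ck_on k T (\<lambda>x. \<Sum>i\<in>I. f i x)"
  using assms by (induction I rule: infinite_finite_induct) (auto simp: Ck_on_const Ck_on_add)

text \<open>In the product rule both summands are values of the same \<open>B\<close>, with one
  factor differentiated and the other merely lowered in class, so the induction hypothesis applies
  to each.\<close>

lemma Ck_on_bilinear:
  assumes "bounded_bilinear B" "open T" "Ck_on k T f" "Ck_on k T g"
  shows "Ck_on k T (\<lambda>x. B (f x) (g x))"
  using assms(3,4)
proof (induction k arbitrary: f g)
  case 0
  then show ?case using assms(1) by (simp add: bounded_bilinear.continuous_on)
next
  case (Suc k)
  have "((\<lambda>x. B (f x) (g x)) has_derivative
      (\<lambda>v. B (f x) (frechet_derivative g (at x) v) + B (frechet_derivative f (at x) v) (g x))) (at x)"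
    if "x \<in> T" for x
    by (rule bounded_bilinear.FDERIV[OF assms(1) Suc.prems[THEN Ck_on_Suc_has_derivative, OF that]])
  moreover have "Ck_on k T f" "Ck_on k T g"
    using Suc.prems Ck_on_Suc_imp by blast+
  ultimately show ?case
    using Suc.IH Suc.prems by (intro Ck_on_SucI[OF \<open>open T\<close>]) (auto intro!: Ck_on_add \<open>open T\<close>)
qed

lemma linear_euclidean_expand:
  fixes L :: "'a::euclidean_space \<Rightarrow> 'b::real_vector"
  assumes "linear L"
  shows "L w = (\<Sum>b\<in>Basis. (w \<bullet> b) *\<^sub>R L b)"
proof -
  have "L w = L (\<Sum>b\<in>Basis. (w \<bullet> b) *\<^sub>R b)"
    by (simp only: euclidean_representation)
  also have "\<dots> = (\<Sum>b\<in>Basis. (w \<bullet> b) *\<^sub>R L b)"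
    by (simp only: linear_sum[OF assms] linear_scale[OF assms] o_def)
  finally show ?thesis .
qed

text \<open>\<open>Ck_on\<close> speaks of derivatives in fixed directions, but the chain rule
  differentiates \<open>g\<close> in a direction that moves with \<open>x\<close>. Expanding that
  direction in \<open>Basis\<close> leaves fixed directions with moving scalar coefficients, on
  which the induction works.\<close>

lemma Ck_on_compose:
  fixes f :: "'a::real_normed_vector \<Rightarrow> 'b::euclidean_space"
    and g :: "'b \<Rightarrow> 'c::real_normed_vector"
  assumes "open T" "open U" "Ck_on k U g" "Ck_on k T f" "f ` T \<subseteq> U"
  shows "Ck_on k T (\<lambda>x. g (f x))"
  using assms(3,4)
proof (induction k arbitrary: g)
  case 0
  then show ?case using assms(5) by (auto intro: continuous_on_compose2)
next
  case (Suc k)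
  have deriv: "((\<lambda>x. g (f x)) has_derivative (\<lambda>v. \<Sum>b\<in>Basis.
      (frechet_derivative f (at x) v \<bullet> b) *\<^sub>R frechet_derivative g (at (f x)) b)) (at x)"
    if "x \<in> T" for x
  proof -
    have g: "(g has_derivative frechet_derivative g (at (f x))) (at (f x))"
      using Ck_on_Suc_has_derivative[OF Suc.prems(1)] assms(5) that by blast
    then have "frechet_derivative g (at (f x)) w
        = (\<Sum>b\<in>Basis. (w \<bullet> b) *\<^sub>R frechet_derivative g (at (f x)) b)" for w
      by (intro linear_euclidean_expand has_derivative_linear)
    then show ?thesis
      by (intro has_derivative_eq_rhs[OF has_derivative_compose[OF
          Ck_on_Suc_has_derivative[OF Suc.prems(2) that] g]] ext)
  qed
  have "Ck_on k T (\<lambda>x. frechet_derivative g (at (f x)) b)" for b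
    by (rule Suc.IH[OF _ Ck_on_Suc_imp[OF Suc.prems(2)]]) (use Suc.prems(1) in simp)
  moreover have "Ck_on k T (\<lambda>x. frechet_derivative f (at x) v \<bullet> b)" for v b
    using Suc.prems(2) by (intro Ck_on_linear[OF bounded_linear_inner_left] \<open>open T\<close>) auto
  ultimately have D: "Ck_on k T (\<lambda>x. \<Sum>b\<in>Basis.
      (frechet_derivative f (at x) v \<bullet> b) *\<^sub>R frechet_derivative g (at (f x)) b)" for v
    by (intro Ck_on_sum[OF \<open>open T\<close>] Ck_on_bilinear[OF bounded_bilinear_scaleR \<open>open T\<close>])
  show ?case
    by (rule Ck_on_SucI[OF \<open>open T\<close> deriv]) (simp_all add: D)
qed

text \<open>The derivative is a polynomial in \<open>inverse\<close> itself, so the induction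
  closes. For \<open>sqrt\<close> the derivative is half the inverse of the function, and the same
  argument runs with the present result.\<close>

lemma Ck_on_inverse: "Ck_on k (- {0::real}) inverse"
proof (induction k)
  case 0
  then show ?case by (auto intro!: continuous_intros)
next
  case (Suc k)
  have "(inverse has_derivative (\<lambda>v. - (inverse x * v * inverse x))) (at x)"
    if "x \<in> - {0}" for x :: real
    using Deriv.has_derivative_inverse[OF _ has_derivative_ident, of x UNIV] that by simp
  moreover have "Ck_on k (- {0}) (\<lambda>x::real. - (inverse x * v * inverse x))" for v
    by (intro Ck_on_linear[OF bounded_linear_minus[OF bounded_linear_ident]]
        Ck_on_bilinear[OF bounded_bilinear_mult] Ck_on_const Suc) auto
  ultimately show ?case by (intro Ck_on_SucI) auto
qed

lemma Ck_on_sqrt: "Ck_on k {0<..} sqrt"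
proof (induction k)
  case 0
  then show ?case by (auto intro!: continuous_intros)
next
  case (Suc k)
  have "(sqrt has_derivative (\<lambda>v. v * (inverse (sqrt x) / 2))) (at x)" if "x \<in> {0<..}" for x
  proof -
    have "(\<lambda>v. v * (inverse (sqrt x) / 2)) = (*) (inverse (sqrt x) / 2)"
      by (simp add: fun_eq_iff)
    then show ?thesis
      using DERIV_real_sqrt[of x] that by (simp only: has_field_derivative_def greaterThan_iff)
  qed
  moreover have "Ck_on k {0<..} (\<lambda>x. v * (inverse (sqrt x) / 2))" for v
  proof -
    have "Ck_on k {0<..} (\<lambda>x. inverse (sqrt x))"
      by (rule Ck_on_compose[OF _ _ Ck_on_inverse Suc]) auto
    then show ?thesis
      by (intro Ck_on_linear[OF bounded_linear_mult_right]
          Ck_on_linear[OF bounded_linear_divide]) auto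
  qed
  ultimately show ?case by (intro Ck_on_SucI) auto
qed

section \<open>Smooth maps and their closure properties\<close>

lemma smooth_on_cong:
  "open T \<Longrightarrow> smooth_on T f \<Longrightarrow> (\<And>x. x \<in> T \<Longrightarrow> f x = g x) \<Longrightarrow> smooth_on T g"
  unfolding smooth_on_def using Ck_on_cong by blast

lemma smooth_on_subset: "smooth_on T f \<Longrightarrow> U \<subseteq> T \<Longrightarrow> smooth_on U f"
  unfolding smooth_on_def using Ck_on_subset by blast

lemma smooth_on_local:
  "(\<And>x. x \<in> T \<Longrightarrow> \<exists>U. open U \<and> x \<in> U \<and> smooth_on U f) \<Longrightarrow> smooth_on T f"
  unfolding smooth_on_def by (intro allI Ck_on_local) blast

lemma smooth_on_const: "smooth_on T (\<lambda>x. c)"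
  and smooth_on_ident: "smooth_on T (\<lambda>x. x)"
  by (auto simp: smooth_on_def Ck_on_const Ck_on_ident)

lemma smooth_on_linear:
  "bounded_linear L \<Longrightarrow> open T \<Longrightarrow> smooth_on T f \<Longrightarrow> smooth_on T (\<lambda>x. L (f x))"
  unfolding smooth_on_def using Ck_on_linear by blast

lemma smooth_on_bilinear:
  "bounded_bilinear B \<Longrightarrow> open T \<Longrightarrow> smooth_on T f \<Longrightarrow> smooth_on T g \<Longrightarrow>
   smooth_on T (\<lambda>x. B (f x) (g x))"
  unfolding smooth_on_def using Ck_on_bilinear by blast

lemma smooth_on_add:
  "open T \<Longrightarrow> smooth_on T f \<Longrightarrow> smooth_on T g \<Longrightarrow> smooth_on T (\<lambda>x. f x + g x)"
  unfolding smooth_on_def using Ck_on_add by blast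

lemma smooth_on_sum:
  "open T \<Longrightarrow> (\<And>i. i \<in> I \<Longrightarrow> smooth_on T (f i)) \<Longrightarrow> smooth_on T (\<lambda>x. \<Sum>i\<in>I. f i x)"
  unfolding smooth_on_def using Ck_on_sum[of T I _ f] by blast

lemma smooth_on_compose:
  fixes f :: "'a::real_normed_vector \<Rightarrow> 'b::euclidean_space"
    and g :: "'b \<Rightarrow> 'c::real_normed_vector"
  assumes "smooth_on U g" "open U" "open T" "smooth_on T f" "\<And>x. x \<in> T \<Longrightarrow> f x \<in> U"
  shows "smooth_on T (\<lambda>x. g (f x))"
  using assms Ck_on_compose[of T U _ g f] unfolding smooth_on_def by blast

lemma smooth_on_minus: "open T \<Longrightarrow> smooth_on T f \<Longrightarrow> smooth_on T (\<lambda>x. - f x)"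
  by (rule smooth_on_linear[OF bounded_linear_minus[OF bounded_linear_ident]])

lemma smooth_on_diff:
  "open T \<Longrightarrow> smooth_on T f \<Longrightarrow> smooth_on T g \<Longrightarrow> smooth_on T (\<lambda>x. f x - g x)"
  using smooth_on_add[OF _ _ smooth_on_minus, of T f g] by simp

lemma smooth_on_Pair:
  assumes "open T" "smooth_on T f" "smooth_on T g"
  shows "smooth_on T (\<lambda>x. (f x, g x))"
proof -
  have "smooth_on T (\<lambda>x. (f x, 0) + (0, g x))"
    by (intro smooth_on_add assms smooth_on_linear[of "\<lambda>y. (y, 0)"]
        smooth_on_linear[of "\<lambda>y. (0, y)"] bounded_linear_Pair bounded_linear_ident
        bounded_linear_zero)
  then show ?thesis by simp
qed

lemmas smooth_on_fst = smooth_on_linear[OF bounded_linear_fst]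
lemmas smooth_on_snd = smooth_on_linear[OF bounded_linear_snd]
lemmas smooth_on_inner = smooth_on_bilinear[OF bounded_bilinear_inner]
lemmas smooth_on_scaleR = smooth_on_bilinear[OF bounded_bilinear_scaleR]
lemmas smooth_on_mult = smooth_on_bilinear[OF bounded_bilinear_mult]

lemma smooth_on_inverse:
  fixes f :: "'a::real_normed_vector \<Rightarrow> real"
  assumes "open T" "smooth_on T f" "\<And>x. x \<in> T \<Longrightarrow> f x \<noteq> 0"
  shows "smooth_on T (\<lambda>x. inverse (f x))"
  by (rule smooth_on_compose[of "- {0}"]) (use assms in \<open>auto simp: smooth_on_def Ck_on_inverse\<close>)

lemma smooth_on_sqrt:
  assumes "open T" "smooth_on T f" "\<And>x. x \<in> T \<Longrightarrow> f x > 0"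
  shows "smooth_on T (\<lambda>x. sqrt (f x))"
  by (rule smooth_on_compose[of "{0<..}"]) (use assms in \<open>auto simp: smooth_on_def Ck_on_sqrt\<close>)

lemma smooth_on_divide:
  fixes f g :: "'a::real_normed_vector \<Rightarrow> real"
  assumes "open T" "smooth_on T f" "smooth_on T g" "\<And>x. x \<in> T \<Longrightarrow> g x \<noteq> 0"
  shows "smooth_on T (\<lambda>x. f x / g x)"
  unfolding divide_inverse by (intro smooth_on_mult smooth_on_inverse assms)

lemma smooth_on_norm:
  fixes f :: "'a::real_normed_vector \<Rightarrow> 'b::real_inner"
  assumes "open T" "smooth_on T f" "\<And>x. x \<in> T \<Longrightarrow> f x \<noteq> 0"
  shows "smooth_on T (\<lambda>x. norm (f x))"
  unfolding norm_eq_sqrt_inner by (intro smooth_on_sqrt smooth_on_inner assms) (use assms in auto)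

lemma smooth_on_imp_continuous_on: "smooth_on T f \<Longrightarrow> continuous_on T f"
  unfolding smooth_on_def by (metis Ck_on.simps(1))

lemma smooth_on_has_derivative:
  "smooth_on T f \<Longrightarrow> x \<in> T \<Longrightarrow> (f has_derivative frechet_derivative f (at x)) (at x)"
  unfolding smooth_on_def using Ck_on_Suc_has_derivative by blast

lemma smooth_on_frechet:
  "smooth_on T f \<Longrightarrow> smooth_on T (\<lambda>x. frechet_derivative f (at x) v)"
  unfolding smooth_on_def by (metis Ck_on.simps(2))

text \<open>The direction \<open>u x\<close> moves with the point and is expanded in
  \<open>Basis\<close>, as in the chain rule.\<close>

lemma smooth_on_frechet_compose:
  fixes f u :: "'a::real_normed_vector \<Rightarrow> 'b::euclidean_space"
    and g :: "'b \<Rightarrow> 'c::real_normed_vector"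
  assumes "smooth_on U g" "open U" "open T" "smooth_on T f" "\<And>x. x \<in> T \<Longrightarrow> f x \<in> U"
    and "smooth_on T u"
  shows "smooth_on T (\<lambda>x. frechet_derivative g (at (f x)) (u x))"
proof (rule smooth_on_cong[OF \<open>open T\<close>])
  show "smooth_on T (\<lambda>x. \<Sum>b\<in>Basis. (u x \<bullet> b) *\<^sub>R frechet_derivative g (at (f x)) b)"
    by (intro smooth_on_sum smooth_on_scaleR smooth_on_inner smooth_on_const \<open>open T\<close>
        \<open>smooth_on T u\<close> smooth_on_compose[OF smooth_on_frechet[OF assms(1)] assms(2-5)])
  show "(\<Sum>b\<in>Basis. (u x \<bullet> b) *\<^sub>R frechet_derivative g (at (f x)) b)
      = frechet_derivative g (at (f x)) (u x)" if "x \<in> T" for x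
    by (rule linear_euclidean_expand[symmetric])
      (use smooth_on_has_derivative[OF assms(1) assms(5)[OF that]] has_derivative_linear in blast)
qed

section \<open>Symmetry of second derivatives\<close>

lemma second_difference:
  fixes f :: "'a::real_normed_vector \<Rightarrow> real"
  assumes T: "open T" "smooth_on T f" and h: "h > 0"
    and box: "\<And>s t. \<lbrakk>0 \<le> s; s \<le> h; 0 \<le> t; t \<le> h\<rbrakk> \<Longrightarrow> x + s *\<^sub>R u + t *\<^sub>R v \<in> T"
  shows "\<exists>s t. 0 < s \<and> s < h \<and> 0 < t \<and> t < h \<and>
    f (x + h *\<^sub>R u + h *\<^sub>R v) - f (x + h *\<^sub>R u) - f (x + h *\<^sub>R v) + f x
    = h\<^sup>2 * frechet_derivative (\<lambda>y. frechet_derivative f (at y) u) (at (x + s *\<^sub>R u + t *\<^sub>R v)) v"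
proof -
  let ?D = "\<lambda>y. frechet_derivative f (at y) u"
  have D: "smooth_on T ?D"
    by (rule smooth_on_frechet[OF T(2)])
  have lin: "DERIV (\<lambda>s. g (a + s *\<^sub>R w)) s :> frechet_derivative g (at (a + s *\<^sub>R w)) w"
    if "smooth_on T g" "a + s *\<^sub>R w \<in> T" for g :: "'a \<Rightarrow> real" and a w s
  proof -
    have *: "(g has_derivative frechet_derivative g (at (a + s *\<^sub>R w))) (at (a + s *\<^sub>R w))"
      using smooth_on_has_derivative that by blast
    have "((\<lambda>s. a + s *\<^sub>R w) has_derivative (\<lambda>r. r *\<^sub>R w)) (at s)"
      by (auto intro!: derivative_eq_intros)
    from has_derivative_compose[OF this *] show ?thesis
      using has_derivative_linear[OF *]
      by (simp add: has_field_derivative_def linear_scale mult_commute_abs)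
  qed
  \<comment> \<open>The second difference is the increment over [0, h] of this difference of two
    parallel slices. The mean value theorem is applied to it in direction \<open>u\<close>, and then
    to the derivative along \<open>u\<close> in direction \<open>v\<close>.\<close>
  have "DERIV (\<lambda>s. f ((x + h *\<^sub>R v) + s *\<^sub>R u) - f (x + s *\<^sub>R u)) s
      :> ?D ((x + h *\<^sub>R v) + s *\<^sub>R u) - ?D (x + s *\<^sub>R u)" if "0 \<le> s" "s \<le> h" for s
    using box[of s h] box[of s 0] that h
    by (intro DERIV_diff lin T(2)) (auto simp: algebra_simps)
  from MVT2[OF h this] obtain s where s: "0 < s" "s < h" and
    1: "f ((x + h *\<^sub>R v) + h *\<^sub>R u) - f (x + h *\<^sub>R u) - (f (x + h *\<^sub>R v) - f x)
      = h * (?D ((x + h *\<^sub>R v) + s *\<^sub>R u) - ?D (x + s *\<^sub>R u))"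
    by auto
  have "DERIV (\<lambda>t. ?D ((x + s *\<^sub>R u) + t *\<^sub>R v)) t
      :> frechet_derivative ?D (at ((x + s *\<^sub>R u) + t *\<^sub>R v)) v" if "0 \<le> t" "t \<le> h" for t
    using box[of s t] that s by (intro lin D) auto
  from MVT2[OF h this] obtain t where t: "0 < t" "t < h" and
    2: "?D ((x + s *\<^sub>R u) + h *\<^sub>R v) - ?D (x + s *\<^sub>R u)
      = h * frechet_derivative ?D (at ((x + s *\<^sub>R u) + t *\<^sub>R v)) v"
    by auto
  have *: "(x + h *\<^sub>R v) + s *\<^sub>R u = (x + s *\<^sub>R u) + h *\<^sub>R v"
    "(x + h *\<^sub>R v) + h *\<^sub>R u = x + h *\<^sub>R u + h *\<^sub>R v"
    by (auto simp: algebra_simps)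
  show ?thesis
    using s t 1 2 unfolding * by (intro exI[of _ s] exI[of _ t]) (simp add: power2_eq_square)
qed

text \<open>The second difference over a small parallelogram is symmetric in \<open>u\<close> and
  \<open>v\<close>, so the two mixed derivatives agree at suitable points near \<open>x\<close>;
  their continuity excludes a gap at \<open>x\<close>.\<close>

lemma second_derivative_symmetric_real:
  fixes f :: "'a::real_normed_vector \<Rightarrow> real"
  assumes T: "open T" "smooth_on T f" and x: "x \<in> T"
  shows "frechet_derivative (\<lambda>y. frechet_derivative f (at y) u) (at x) v
       = frechet_derivative (\<lambda>y. frechet_derivative f (at y) v) (at x) u"
proof (rule ccontr)
  let ?D = "\<lambda>u v x. frechet_derivative (\<lambda>y. frechet_derivative f (at y) u) (at x) v"
  assume neq: "?D u v x \<noteq> ?D v u x"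
  define e where "e = \<bar>?D u v x - ?D v u x\<bar> / 2"
  have e: "e > 0" using neq by (simp add: e_def)
  have "isCont (?D u v) x" "isCont (?D v u) x"
    using smooth_on_imp_continuous_on[OF smooth_on_frechet[OF smooth_on_frechet[OF T(2)]]] T(1) x
    by (auto simp: continuous_on_eq_continuous_at)
  then obtain d1 d2 where d1: "d1 > 0" "\<And>y. dist y x < d1 \<Longrightarrow> dist (?D u v y) (?D u v x) < e"
    and d2: "d2 > 0" "\<And>y. dist y x < d2 \<Longrightarrow> dist (?D v u y) (?D v u x) < e"
    using e unfolding continuous_at_eps_delta by metis
  obtain d3 where d3: "d3 > 0" "\<And>y. dist y x < d3 \<Longrightarrow> y \<in> T"
    using T(1) x open_dist by blast
  define d where "d = min d1 (min d2 d3)"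
  \<comment> \<open>Small enough for the whole parallelogram to stay within \<open>d\<close> of
    \<open>x\<close>; the summand 1 keeps the denominator positive.\<close>
  define h where "h = d / (2 * (norm u + norm v + 1))"
  have d: "d > 0" using d1 d2 d3 by (simp add: d_def)
  have n: "norm u + norm v + 1 > 0" by (smt (verit) norm_ge_zero)
  have h: "h > 0" using d n by (simp add: h_def)
  have near: "dist (x + s *\<^sub>R u + t *\<^sub>R v) x < d" if "0 \<le> s" "s \<le> h" "0 \<le> t" "t \<le> h" for s t
  proof -
    have "dist (x + s *\<^sub>R u + t *\<^sub>R v) x \<le> s * norm u + t * norm v"
      using norm_triangle_ineq[of "s *\<^sub>R u" "t *\<^sub>R v"] that by (simp add: dist_norm)
    also have "\<dots> \<le> h * norm u + h * norm v"
      using that by (intro add_mono mult_right_mono) auto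
    also have "\<dots> < h * (2 * (norm u + norm v + 1))"
      using h by (simp add: algebra_simps) (smt (verit) mult_nonneg_nonneg norm_ge_zero)
    also have "\<dots> = d" using n by (simp add: h_def)
    finally show ?thesis .
  qed
  obtain s t where st: "0 < s" "s < h" "0 < t" "t < h" and
    1: "f (x + h *\<^sub>R u + h *\<^sub>R v) - f (x + h *\<^sub>R u) - f (x + h *\<^sub>R v) + f x
      = h\<^sup>2 * ?D u v (x + s *\<^sub>R u + t *\<^sub>R v)"
    using second_difference[OF T h, of x u v] near d3 d_def by auto
  have near': "dist (x + t *\<^sub>R v + s *\<^sub>R u) x < d" if "0 \<le> s" "s \<le> h" "0 \<le> t" "t \<le> h" for s t
    using near[OF that] by (simp add: algebra_simps)
  obtain s' t' where st': "0 < s'" "s' < h" "0 < t'" "t' < h" and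
    2: "f (x + h *\<^sub>R v + h *\<^sub>R u) - f (x + h *\<^sub>R v) - f (x + h *\<^sub>R u) + f x
      = h\<^sup>2 * ?D v u (x + s' *\<^sub>R v + t' *\<^sub>R u)"
    using second_difference[OF T h, of x v u] near' d3 d_def by auto
  have "?D u v (x + s *\<^sub>R u + t *\<^sub>R v) = ?D v u (x + s' *\<^sub>R v + t' *\<^sub>R u)"
    using 1 2 h by (simp add: algebra_simps)
  moreover have "dist (?D u v (x + s *\<^sub>R u + t *\<^sub>R v)) (?D u v x) < e"
    using d1(2) near[of s t] st by (auto simp: d_def)
  moreover have "dist (?D v u (x + s' *\<^sub>R v + t' *\<^sub>R u)) (?D v u x) < e"
    using d2(2) near'[of t' s'] st' by (auto simp: d_def)
  moreover have False if "a = b" "dist a c < e" "dist b d < e" "e = \<bar>c - d\<bar> / 2" for a b c d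
    using that by (auto simp: dist_real_def abs_if split: if_splits)
  ultimately show False
    using e_def by blast
qed

lemma second_derivative_symmetric:
  fixes f :: "'a::real_normed_vector \<Rightarrow> 'b::euclidean_space"
  assumes T: "open T" "smooth_on T f" and x: "x \<in> T"
  shows "frechet_derivative (\<lambda>y. frechet_derivative f (at y) u) (at x) v
       = frechet_derivative (\<lambda>y. frechet_derivative f (at y) v) (at x) u"
proof (rule euclidean_eqI)
  fix b :: 'b
  have inner: "frechet_derivative (\<lambda>y. g y \<bullet> b) (at y) w = frechet_derivative g (at y) w \<bullet> b"
    if "smooth_on T g" "y \<in> T" for g :: "'a \<Rightarrow> 'b" and y w
    by (rule fun_cong[OF frechet_derivative_at[symmetric]])
      (intro bounded_linear.has_derivative[OF bounded_linear_inner_left]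
        smooth_on_has_derivative[OF that])
  let ?g = "\<lambda>y. f y \<bullet> b"
  have g: "smooth_on T ?g"
    by (intro smooth_on_inner T smooth_on_const)
  have *: "frechet_derivative (\<lambda>y. frechet_derivative ?g (at y) u) (at x) v
      = frechet_derivative (\<lambda>y. frechet_derivative f (at y) u) (at x) v \<bullet> b" for u v
  proof -
    have "frechet_derivative (\<lambda>y. frechet_derivative ?g (at y) u) (at x)
        = frechet_derivative (\<lambda>y. frechet_derivative f (at y) u \<bullet> b) (at x)"
      using smooth_on_has_derivative[OF smooth_on_frechet[OF g] x]
      by (intro frechet_derivative_transform_within_open[OF _ T(1) x])
        (auto simp: inner[OF T(2)] differentiable_def)
    then show ?thesis
      using inner[OF smooth_on_frechet[OF T(2)] x] by simp
  qed
  show "frechet_derivative (\<lambda>y. frechet_derivative f (at y) u) (at x) v \<bullet> b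
      = frechet_derivative (\<lambda>y. frechet_derivative f (at y) v) (at x) u \<bullet> b"
    using second_derivative_symmetric_real[OF T(1) g x, of u v] unfolding * .
qed

subsection \<open>Rotations\<close>

notation cross3 (infixr \<open>\<times>\<^sub>v\<close> 80)

text \<open>Defined on all matrices by three entries, so that it is linear everywhere; it inverts
  \<open>hat\<close> on skew matrices.\<close>

definition vee :: "real^3^3 \<Rightarrow> real^3" where
  "vee M = vector [M$3$2, M$1$3, M$2$1]"

lemma hat_nth:
  "hat v $ 1 $ 1 = 0" "hat v $ 1 $ 2 = - v$3" "hat v $ 1 $ 3 = v$2"
  "hat v $ 2 $ 1 = v$3" "hat v $ 2 $ 2 = 0" "hat v $ 2 $ 3 = - v$1"
  "hat v $ 3 $ 1 = - v$2" "hat v $ 3 $ 2 = v$1" "hat v $ 3 $ 3 = 0"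
  by (simp_all add: hat_def matrix_def cross_components axis_def)

lemma hat_mult_vec: "hat v *v w = v \<times>\<^sub>v w"
  by (simp add: vec_eq_iff forall_3 matrix_vector_mult_def sum_3 hat_nth cross_components)

lemma linear_hat: "linear hat"
  by (rule linearI) (simp_all add: vec_eq_iff forall_3 hat_nth algebra_simps)

lemma linear_vee: "linear vee"
  by (rule linearI) (simp_all add: vee_def vec_eq_iff forall_3)

lemmas bounded_linear_hat = linear_conv_bounded_linear[THEN iffD1, OF linear_hat]
lemmas bounded_linear_vee = linear_conv_bounded_linear[THEN iffD1, OF linear_vee]

lemma vee_hat [simp]: "vee (hat v) = v"
  by (simp add: vee_def vec_eq_iff forall_3 hat_nth)

lemma inj_hat: "inj hat"
  by (metis injI vee_hat)

lemma hat_vee: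
  assumes "transpose M = - M"
  shows "hat (vee M) = M"
proof -
  have skew: "M $ j $ i = - M $ i $ j" for i j
    using arg_cong[OF assms, of "\<lambda>X. X $ i $ j"] by (simp add: transpose_def)
  have "M $ i $ i = 0" for i
    using skew[of i i] by linarith
  then show ?thesis
    using skew[of 2 1] skew[of 1 3] skew[of 3 2]
    by (simp add: vec_eq_iff forall_3 hat_nth vee_def)
qed

lemma transpose_hat: "transpose (hat v) = - hat v"
  by (simp add: vec_eq_iff forall_3 hat_nth transpose_def)

lemma hat_commutator: "hat a ** hat b - hat b ** hat a = hat (a \<times>\<^sub>v b)"
  by (simp add: vec_eq_iff forall_3 hat_nth matrix_matrix_mult_def sum_3 cross_components
      algebra_simps)

lemma hat_cube: "hat v ** (hat v ** hat v) = (- (v \<bullet> v)) *\<^sub>R hat v"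
  by (simp add: vec_eq_iff forall_3 hat_nth matrix_matrix_mult_def sum_3 inner_vec_def
      algebra_simps power2_eq_square)

lemma bounded_bilinear_matrix_mult:
  "bounded_bilinear ((**) :: real^'n^'m \<Rightarrow> real^'k^'n \<Rightarrow> real^'k^'m)"
  by (rule bilinear_conv_bounded_bilinear[THEN iffD1])
    (simp add: bilinear_def linear_iff matrix_matrix_mult_def vec_eq_iff sum.distrib
      sum_distrib_left algebra_simps)

lemma bounded_bilinear_matrix_vector_mult:
  "bounded_bilinear ((*v) :: real^'n^'m \<Rightarrow> real^'n \<Rightarrow> real^'m)"
  by (rule bilinear_conv_bounded_bilinear[THEN iffD1])
    (simp add: bilinear_def linear_iff matrix_vector_mult_add_rdistrib matrix_vector_right_distrib
      matrix_vector_mult_scaleR scaleR_matrix_vector_assoc)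

lemma bounded_linear_transpose: "bounded_linear (transpose :: real^'n^'m \<Rightarrow> real^'m^'n)"
  by (rule linear_conv_bounded_linear[THEN iffD1])
    (simp add: linear_iff transpose_def vec_eq_iff)

lemma bounded_bilinear_cross3: "bounded_bilinear cross3"
  by (rule bilinear_conv_bounded_bilinear[THEN iffD1, OF bilinear_cross])

section \<open>Rotation matrices and the coadjoint action\<close>

lemma SO3_transpose_mult:
  "R \<in> SO3 \<Longrightarrow> transpose R ** R = mat 1" "R \<in> SO3 \<Longrightarrow> R ** transpose R = mat 1"
  by (simp_all add: SO3_def rotation_matrix_def orthogonal_matrix_def)

lemma SO3_matrix_inv: "R \<in> SO3 \<Longrightarrow> matrix_inv R = transpose R"
proof -
  assume R: "R \<in> SO3"
  have "\<exists>B. R ** B = mat 1 \<and> B ** R = mat 1"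
    using SO3_transpose_mult[OF R] by blast
  then have "R ** matrix_inv R = mat 1 \<and> matrix_inv R ** R = mat 1"
    unfolding matrix_inv_def by (rule someI_ex)
  then show ?thesis
    by (metis R SO3_transpose_mult(1) matrix_mul_assoc matrix_mul_lid matrix_mul_rid)
qed

lemma SO3_mult: "R \<in> SO3 \<Longrightarrow> R' \<in> SO3 \<Longrightarrow> R ** R' \<in> SO3"
  by (simp add: SO3_def rotation_matrix_def orthogonal_matrix_mul det_mul)

lemma SO3_transpose: "R \<in> SO3 \<Longrightarrow> transpose R \<in> SO3"
  by (simp add: SO3_def rotation_matrix_def)

lemma SO3_cancel:
  assumes "R \<in> SO3"
  shows "transpose R ** (R ** M) = M" "R ** (transpose R ** M) = M"
    "M ** R ** transpose R = M" "M ** transpose R ** R = M"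
  using SO3_transpose_mult[OF assms]
  by (simp_all add: matrix_mul_assoc) (simp_all flip: matrix_mul_assoc)

lemma SO3_mult_vec_cancel:
  assumes "R \<in> SO3"
  shows "transpose R *v (R *v w) = w" "R *v (transpose R *v w) = w"
  using SO3_transpose_mult[OF assms] by (simp_all add: matrix_vector_mul_assoc del: transpose_matrix_vector)

lemma SO3_cross: "R \<in> SO3 \<Longrightarrow> (R *v a) \<times>\<^sub>v (R *v b) = R *v (a \<times>\<^sub>v b)"
  by (simp add: SO3_def cross_rotation_matrix)

lemma SO3_inner: "R \<in> SO3 \<Longrightarrow> (R *v a) \<bullet> (R *v b) = a \<bullet> b"
  by (metis SO3_mult_vec_cancel(1) dot_lmul_matrix inner_commute vector_transpose_matrix
      transpose_transpose)

lemma SO3_norm: "R \<in> SO3 \<Longrightarrow> norm (R *v a) = norm a"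
  by (simp add: norm_eq_sqrt_inner SO3_inner)

text \<open>Rotations preserve the cross product; written with \<open>hat\<close>, that is the
  formula for the adjoint action.\<close>

lemma hat_conjugate: "R \<in> SO3 \<Longrightarrow> R ** hat v ** transpose R = hat (R *v v)"
proof -
  assume R: "R \<in> SO3"
  have "(R ** hat v ** transpose R) *v w = hat (R *v v) *v w" for w
    using SO3_cross[OF R, of v "transpose R *v w"]
    by (simp add: hat_mult_vec SO3_mult_vec_cancel[OF R] del: transpose_matrix_vector
        flip: matrix_vector_mul_assoc)
  then show ?thesis
    by (simp add: matrix_eq)
qed

lemma Ad_eq: "R \<in> SO3 \<Longrightarrow> Ad R v = R *v v"
  by (simp add: Ad_def SO3_matrix_inv hat_conjugate inj_hat)

text \<open>Under the dot product the dual of \<open>transpose R\<close> is \<open>R\<close> again,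
  so adjoint and coadjoint action agree.\<close>

lemma coadj_eq: "R \<in> SO3 \<Longrightarrow> coadj R m = R *v m"
proof -
  assume R: "R \<in> SO3"
  have "Ad (matrix_inv R) = (\<lambda>v. transpose R *v v)"
    by (auto simp: SO3_matrix_inv R Ad_eq SO3_transpose simp del: transpose_matrix_vector)
  then show ?thesis
    by (simp add: coadj_def adjoint_matrix del: transpose_matrix_vector)
qed

section \<open>The exponential of so(3)\<close>

lemma mat_power_scaleR: "mat_power (t *\<^sub>R X) k = t ^ k *\<^sub>R mat_power X k"
  by (induction k)
    (simp_all add: bounded_bilinear.scaleR_left[OF bounded_bilinear_matrix_mult]
      bounded_bilinear.scaleR_right[OF bounded_bilinear_matrix_mult])

lemma mat_power_hat:
  assumes "norm n = 1"
  shows "mat_power (hat n) (2 * k + 1) = (- 1) ^ k *\<^sub>R hat n"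
    and "mat_power (hat n) (2 * k + 2) = (- 1) ^ k *\<^sub>R (hat n ** hat n)"
proof -
  have cube: "hat n ** (hat n ** hat n) = - hat n"
    using hat_cube[of n] assms by (simp add: norm_eq_1)
  have "mat_power (hat n) (2 * k + 1) = (- 1) ^ k *\<^sub>R hat n \<and>
      mat_power (hat n) (2 * k + 2) = (- 1) ^ k *\<^sub>R (hat n ** hat n)"
    by (induction k)
      (simp_all add: bounded_bilinear.scaleR_right[OF bounded_bilinear_matrix_mult]
        bounded_bilinear.minus_right[OF bounded_bilinear_matrix_mult] cube)
  then show "mat_power (hat n) (2 * k + 1) = (- 1) ^ k *\<^sub>R hat n"
    and "mat_power (hat n) (2 * k + 2) = (- 1) ^ k *\<^sub>R (hat n ** hat n)"
    by auto
qed

text \<open>The cube of \<open>hat n\<close> is \<open>- hat n\<close> for a unit vector, so odd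
  powers collect into the sine series and positive even powers into the cosine series.\<close>

lemma Rodrigues:
  assumes n: "norm n = 1"
  shows "mat_exp (t *\<^sub>R hat n) = mat 1 + sin t *\<^sub>R hat n + (1 - cos t) *\<^sub>R (hat n ** hat n)"
proof -
  let ?P = "hat n ** hat n"
  \<comment> \<open>The zeroth term carries an extra \<open>?P\<close>, because the cosine series
    starts with 1 and would otherwise leave \<open>- ?P\<close> at k = 0.\<close>
  have terms: "mat_power (t *\<^sub>R hat n) k /\<^sub>R fact k = (sin_coeff k * t ^ k) *\<^sub>R hat n
      + (if k = 0 then mat 1 + ?P else 0) - (cos_coeff k * t ^ k) *\<^sub>R ?P" for k
  proof (cases "k = 0")
    case True
    then show ?thesis by (simp add: sin_coeff_def cos_coeff_def)
  next
    case False
    show ?thesis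
    proof (cases "even k")
      case True
      then obtain j where j: "k = 2 * j" by (elim evenE)
      with False obtain i where "j = Suc i" by (cases j) auto
      with j have i: "k = 2 * i + 2" by simp
      have "k div 2 = Suc i" by (simp add: i)
      moreover have "mat_power (hat n) k = (- 1) ^ i *\<^sub>R ?P"
        unfolding i by (rule mat_power_hat(2)[OF n])
      ultimately show ?thesis
        using True False
        by (simp add: mat_power_scaleR sin_coeff_def cos_coeff_def divide_inverse mult_ac)
    next
      case odd: False
      then obtain i where i: "k = 2 * i + 1" by (metis oddE)
      have "mat_power (hat n) k = (- 1) ^ i *\<^sub>R hat n"
        unfolding i by (rule mat_power_hat(1)[OF n])
      moreover have "(k - Suc 0) div 2 = i" by (simp add: i)
      ultimately show ?thesis
        using odd False
        by (simp add: mat_power_scaleR sin_coeff_def cos_coeff_def divide_inverse mult_ac)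
    qed
  qed
  have "(\<lambda>k. (sin_coeff k * t ^ k) *\<^sub>R hat n + (if k = 0 then mat 1 + ?P else 0)
      - (cos_coeff k * t ^ k) *\<^sub>R ?P) sums (sin t *\<^sub>R hat n + (mat 1 + ?P) - cos t *\<^sub>R ?P)"
    using sin_converges[of t] cos_converges[of t] sums_single[of 0 "\<lambda>_. mat 1 + ?P"]
    by (intro sums_diff sums_add sums_scaleR_left) auto
  then have "mat_exp (t *\<^sub>R hat n) = sin t *\<^sub>R hat n + (mat 1 + ?P) - cos t *\<^sub>R ?P"
    unfolding mat_exp_def terms by (rule sums_unique[symmetric])
  then show ?thesis by (simp add: algebra_simps)
qed

text \<open>With \<open>sgn 0 = 0\<close> a single formula also covers \<xi> = 0, and its derivative
  in \<open>t\<close> can be taken without splitting cases.\<close>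

lemma mat_exp_hat:
  "mat_exp (t *\<^sub>R hat \<xi>) = mat 1 + sin (t * norm \<xi>) *\<^sub>R hat (sgn \<xi>)
    + (1 - cos (t * norm \<xi>)) *\<^sub>R (hat (sgn \<xi>) ** hat (sgn \<xi>))"
proof (cases "\<xi> = 0")
  case True
  \<comment> \<open>Any unit vector will do: at angle 0 the formula gives the identity.\<close>
  have "norm (axis 1 1 :: real^3) = 1" by (simp add: norm_axis_1)
  from Rodrigues[OF this, of 0] show ?thesis
    using True by (simp add: linear_0[OF linear_hat])
next
  case False
  then have "norm (sgn \<xi>) = 1" by (simp add: norm_sgn)
  moreover have "t *\<^sub>R hat \<xi> = (t * norm \<xi>) *\<^sub>R hat (sgn \<xi>)"
    using False by (simp add: sgn_div_norm linear_scale[OF linear_hat])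
  ultimately show ?thesis by (simp add: Rodrigues)
qed

lemma det_rodrigues:
  "det (mat 1 + a *\<^sub>R hat n + b *\<^sub>R (hat n ** hat n)) = (1 - b * (n \<bullet> n))\<^sup>2 + a\<^sup>2 * (n \<bullet> n)"
  by (simp add: det_3 hat_nth matrix_matrix_mult_def sum_3 inner_vec_def mat_def algebra_simps
      power2_eq_square)

lemma transpose_mult_rodrigues:
  "transpose (mat 1 + a *\<^sub>R hat n + b *\<^sub>R (hat n ** hat n)) ** (mat 1 + a *\<^sub>R hat n + b *\<^sub>R (hat n ** hat n))
   = mat 1 + (2 * b - a\<^sup>2 - b\<^sup>2 * (n \<bullet> n)) *\<^sub>R (hat n ** hat n)"
  by (simp add: vec_eq_iff forall_3 hat_nth matrix_matrix_mult_def sum_3 inner_vec_def mat_def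
      transpose_def algebra_simps power2_eq_square)

text \<open>Orthogonality and unit determinant reduce to the same relation. It serves twice: for the
  exponential, with \<open>a\<close> the sine, \<open>b\<close> one minus the cosine and
  \<open>n\<close> a unit vector, and for unit quaternions, with \<open>a = 2 * w\<close> and
  \<open>b = 2\<close>.\<close>

lemma rodrigues_SO3:
  assumes "a\<^sup>2 + b\<^sup>2 * (n \<bullet> n) = 2 * b"
  shows "mat 1 + a *\<^sub>R hat n + b *\<^sub>R (hat n ** hat n) \<in> SO3"
proof -
  have "(1 - b * (n \<bullet> n))\<^sup>2 + a\<^sup>2 * (n \<bullet> n) = 1 + (n \<bullet> n) * (a\<^sup>2 + b\<^sup>2 * (n \<bullet> n) - 2 * b)"
    by (simp add: algebra_simps power2_eq_square)
  moreover have "2 * b - a\<^sup>2 - b\<^sup>2 * (n \<bullet> n) = 0"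
    using assms by simp
  ultimately show ?thesis
    using assms
    by (simp add: SO3_def rotation_matrix_def det_rodrigues orthogonal_matrix
        transpose_mult_rodrigues)
qed

lemma mat_exp_SO3: "mat_exp (t *\<^sub>R hat \<xi>) \<in> SO3"
proof (cases "\<xi> = 0")
  case True
  then show ?thesis
    using rodrigues_SO3[of 0 0 0] by (simp add: mat_exp_hat)
next
  case False
  then have "sgn \<xi> \<bullet> sgn \<xi> = 1" by (metis norm_eq_1 norm_sgn)
  then show ?thesis
    unfolding mat_exp_hat by (intro rodrigues_SO3) (simp add: sin_squared_eq power2_eq_square algebra_simps)
qed

lemma mat_exp_0: "mat_exp (0 *\<^sub>R hat \<xi>) = mat 1"
  unfolding mat_exp_hat by simp

lemma mat_exp_has_vector_derivative:
  "((\<lambda>t. mat_exp (t *\<^sub>R hat \<xi>)) has_vector_derivative hat \<xi>) (at 0)"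
proof -
  have "norm \<xi> *\<^sub>R hat (sgn \<xi>) = hat \<xi>"
    by (cases "\<xi> = 0") (simp_all add: sgn_div_norm linear_scale[OF linear_hat] linear_0[OF linear_hat])
  then show ?thesis
    unfolding mat_exp_hat
    by (auto intro!: derivative_eq_intros)
qed

text \<open>Differentiating \<open>transpose R ** R = mat 1\<close> shows that
  \<open>transpose R ** R'\<close> is skew, hence in the range of \<open>hat\<close>.\<close>

lemma SO3_curve_derivative:
  assumes "(R has_vector_derivative R') (at t)" "\<forall>\<^sub>F s in at t. R s \<in> SO3" "R t \<in> SO3"
  shows "R' = R t ** hat (vee (transpose (R t) ** R'))"
proof -
  let ?f = "\<lambda>s. transpose (R s) ** R s"
  have "(?f has_vector_derivative (transpose (R t) ** R' + transpose R' ** R t)) (at t)"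
    by (rule bounded_bilinear.has_vector_derivative[OF bounded_bilinear_matrix_mult
          bounded_linear.has_vector_derivative[OF bounded_linear_transpose assms(1)] assms(1)])
  moreover have "(?f has_vector_derivative 0) (at t)"
    unfolding has_vector_derivative_def
    by (rule has_derivative_transform_eventually[of "\<lambda>_. mat 1"])
      (use assms(2,3) in \<open>auto simp: SO3_transpose_mult elim: eventually_mono\<close>)
  ultimately have "transpose (R t) ** R' + transpose R' ** R t = 0"
    by (rule vector_derivative_unique_at)
  then have "transpose (transpose (R t) ** R') = - (transpose (R t) ** R')"
    by (simp add: matrix_transpose_mul eq_neg_iff_add_eq_0 add.commute)
  from hat_vee[OF this] show ?thesis
    using assms(3) by (simp add: SO3_cancel)
qed

subsection \<open>The tube of the rotation group\<close>

text \<open>The sign follows from the convention for ad*, as \<mu> \<bullet> (\<eta> \<times> \<xi>)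
  = (\<mu> \<times> \<eta>) \<bullet> \<xi>.\<close>

lemma adstar_eq: "adstar \<eta> \<mu> = \<mu> \<times>\<^sub>v \<eta>"
proof -
  have "adjoint (cross3 \<eta>) = (\<lambda>m. m \<times>\<^sub>v \<eta>)"
    by (rule adjoint_unique) (metis cross_triple inner_commute)
  then show ?thesis by (simp add: adstar_def)
qed

lemma cross_eq_0_iff_parallel:
  assumes "\<mu> \<noteq> 0"
  shows "\<mu> \<times>\<^sub>v \<xi> = 0 \<longleftrightarrow> (\<exists>x. \<xi> = x *\<^sub>R \<mu>)"
proof
  assume "\<mu> \<times>\<^sub>v \<xi> = 0"
  then have "(\<mu> \<bullet> \<xi>) *\<^sub>R \<mu> = (\<mu> \<bullet> \<mu>) *\<^sub>R \<xi>"
    using Lagrange[of \<mu> \<mu> \<xi>] by simp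
  then have "\<xi> = ((\<mu> \<bullet> \<xi>) / (\<mu> \<bullet> \<mu>)) *\<^sub>R \<mu>"
    using assms by (metis divide_inverse_commute inner_eq_zero_iff left_inverse scaleR_one scaleR_scaleR)
  then show "\<exists>x. \<xi> = x *\<^sub>R \<mu>" by blast
qed (auto simp: cross_mult_right)

text \<open>The rotation of the unit quaternion \<open>w + v\<close>; its angle is \<open>2 * arcsin (norm v)\<close>.\<close>

definition quat_rot :: "real \<Rightarrow> real^3 \<Rightarrow> real^3^3" where
  "quat_rot w v = mat 1 + (2 * w) *\<^sub>R hat v + 2 *\<^sub>R (hat v ** hat v)"

lemma quat_rot_SO3: "w\<^sup>2 + v \<bullet> v = 1 \<Longrightarrow> quat_rot w v \<in> SO3"
  unfolding quat_rot_def by (rule rodrigues_SO3) (simp add: power_mult_distrib)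

context
  fixes \<mu> :: "real^3"
begin

text \<open>A linear map on the whole space which, for \<mu> \<noteq> 0, agrees with
  \<open>orbit_gen \<mu>\<close> on vectors orthogonal to \<mu>. The description itself says nothing
  in other directions and cannot be differentiated in the ambient space.\<close>

definition tube_gen :: "real^3 \<Rightarrow> real^3" where
  "tube_gen \<rho> = (1 / (\<mu> \<bullet> \<mu>)) *\<^sub>R (\<rho> \<times>\<^sub>v \<mu>)"

text \<open>Vector part of the quaternion of \<open>F\<close>: its length is the sine of half the
  rotation angle.\<close>

definition tube_v :: "real^3 \<Rightarrow> real^3 \<Rightarrow> real^3" where
  "tube_v \<nu> \<rho> = (sqrt (norm \<mu> / norm (\<mu> + \<nu>)) / 2) *\<^sub>R tube_gen \<rho>"

definition tube_rot :: "real^3 \<Rightarrow> real^3 \<Rightarrow> real^3^3" where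
  "tube_rot \<nu> \<rho> = quat_rot (sqrt (1 - tube_v \<nu> \<rho> \<bullet> tube_v \<nu> \<rho>)) (tube_v \<nu> \<rho>)"

definition tube_map :: "(real^3^3) \<times> (real^3) \<times> (real^3) \<Rightarrow> (real^3^3) \<times> (real^3)" where
  "tube_map = (\<lambda>(g, \<nu>, \<rho>). (g ** transpose (tube_rot \<nu> \<rho>), tube_rot \<nu> \<rho> *v (\<mu> + \<nu>)))"

text \<open>With \<theta> the angle from \<mu> to \<open>m\<close>, the sought rotation is that by
  \<theta> about the axis \<mu> \<times> m. Here \<open>w\<close> is cos(\<theta>/2) by the
  half-angle formula, and \<open>v\<close> is the unit axis times sin(\<theta>/2), obtained from sin
  \<theta> = 2 sin(\<theta>/2) cos(\<theta>/2). The length of \<open>m\<close> gives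
  \<open>l\<close>, and the factor \<open>2 * sqrt l\<close> undoes the scaling in
  \<open>tube_v\<close>.\<close>

definition tube_inv :: "(real^3^3) \<times> (real^3) \<Rightarrow> (real^3^3) \<times> (real^3) \<times> (real^3)" where
  "tube_inv = (\<lambda>(R, m).
     let l = norm m / norm \<mu>; w = sqrt ((1 + \<mu> \<bullet> m / (norm \<mu> * norm m)) / 2);
       v = (1 / (2 * w * (norm \<mu> * norm m))) *\<^sub>R (\<mu> \<times>\<^sub>v m)
     in (R ** quat_rot w v, (l - 1) *\<^sub>R \<mu>, \<mu> \<times>\<^sub>v ((2 * sqrt l) *\<^sub>R v)))"

text \<open>The second inequality is
  \<open>tube_v \<nu> \<rho> \<bullet> tube_v \<nu> \<rho> < 1\<close> cleared of denominators.
  Unlike \<open>tube_U\<close>, this set is open in the ambient space.\<close>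

definition tube_dom :: "((real^3) \<times> (real^3)) set" where
  "tube_dom = {(\<nu>, \<rho>). norm (\<mu> + \<nu>) > 0 \<and>
     norm \<mu> * (tube_gen \<rho> \<bullet> tube_gen \<rho>) < 4 * norm (\<mu> + \<nu>)}"

text \<open>For \<mu> \<noteq> 0, the complement of the closed ray opposite to \<mu>: the momenta
  which a rotation by less than a half turn brings to a positive multiple of \<mu>.\<close>

definition tube_ran :: "(real^3) set" where
  "tube_ran = {m. norm \<mu> * norm m + \<mu> \<bullet> m > 0}"

context
  assumes \<mu>: "\<mu> \<noteq> 0"
begin

section \<open>Isotropy algebra and orbit tangent space of \<mu>\<close>

lemma isotropy_iff: "\<xi> \<in> isotropy \<mu> \<longleftrightarrow> (\<exists>x. \<xi> = x *\<^sub>R \<mu>)"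
  unfolding isotropy_def by (simp add: adstar_eq cross_eq_0_iff_parallel \<mu>)

lemma isotropy_compl_iff: "\<eta> \<in> isotropy_compl \<mu> \<longleftrightarrow> \<eta> \<bullet> \<mu> = 0"
proof -
  have "\<mu> \<in> isotropy \<mu>"
    unfolding isotropy_iff by (rule exI[of _ 1]) simp
  then show ?thesis
    unfolding isotropy_compl_def orthogonal_comp_def orthogonal_def
    by (auto simp: isotropy_iff inner_commute)
qed

lemma orbit_tangent_iff: "\<rho> \<in> orbit_tangent \<mu> \<longleftrightarrow> \<rho> \<bullet> \<mu> = 0"
proof
  assume "\<rho> \<bullet> \<mu> = 0"
  then have "\<mu> \<times>\<^sub>v ((1 / (\<mu> \<bullet> \<mu>)) *\<^sub>R (\<rho> \<times>\<^sub>v \<mu>)) = \<rho>" "(\<rho> \<times>\<^sub>v \<mu>) \<bullet> \<mu> = 0"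
    using \<mu> by (simp_all add: cross_mult_right Lagrange inner_commute dot_cross_self)
  then show "\<rho> \<in> orbit_tangent \<mu>"
    unfolding orbit_tangent_def adstar_eq
    by (intro image_eqI[of _ _ "(1 / (\<mu> \<bullet> \<mu>)) *\<^sub>R (\<rho> \<times>\<^sub>v \<mu>)"]) (simp_all add: isotropy_compl_iff)
qed (auto simp: orbit_tangent_def adstar_eq dot_cross_self)

lemma orbit_gen_eq:
  assumes "\<rho> \<bullet> \<mu> = 0"
  shows "orbit_gen \<mu> \<rho> = (1 / (\<mu> \<bullet> \<mu>)) *\<^sub>R (\<rho> \<times>\<^sub>v \<mu>)"
  unfolding orbit_gen_def isotropy_compl_iff adstar_eq
proof (rule the_equality)
  show "((1 / (\<mu> \<bullet> \<mu>)) *\<^sub>R (\<rho> \<times>\<^sub>v \<mu>)) \<bullet> \<mu> = 0 \<and> \<mu> \<times>\<^sub>v ((1 / (\<mu> \<bullet> \<mu>)) *\<^sub>R (\<rho> \<times>\<^sub>v \<mu>)) = \<rho>"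
    using assms \<mu> by (simp add: cross_mult_right Lagrange inner_commute dot_cross_self)
  show "\<eta> = (1 / (\<mu> \<bullet> \<mu>)) *\<^sub>R (\<rho> \<times>\<^sub>v \<mu>)" if "\<eta> \<bullet> \<mu> = 0 \<and> \<mu> \<times>\<^sub>v \<eta> = \<rho>" for \<eta>
  proof -
    have "\<rho> \<times>\<^sub>v \<mu> = (\<mu> \<bullet> \<mu>) *\<^sub>R \<eta>"
      using that cross_skew[of \<rho> \<mu>] Lagrange[of \<mu> \<mu> \<eta>] by (auto simp: inner_commute)
    then show ?thesis using \<mu> by simp
  qed
qed

lemma isotropy_dual_iff: "\<nu> \<in> isotropy_dual \<mu> \<longleftrightarrow> (\<exists>x. \<nu> = x *\<^sub>R \<mu>)"
proof
  assume "\<nu> \<in> isotropy_dual \<mu>"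
  then have *: "\<xi> \<bullet> \<mu> = 0 \<Longrightarrow> \<nu> \<bullet> \<xi> = 0" for \<xi>
    by (auto simp: isotropy_dual_def isotropy_compl_iff)
  \<comment> \<open>This is the component of \<nu> orthogonal to \<mu>, scaled to avoid a division.
    Testing \<nu> against it gives the squared length of \<mu> \<times> \<nu>.\<close>
  have "((\<mu> \<bullet> \<mu>) *\<^sub>R \<nu> - (\<nu> \<bullet> \<mu>) *\<^sub>R \<mu>) \<bullet> \<mu> = 0"
    by (simp add: inner_diff_left)
  from *[OF this] have "\<nu> \<bullet> ((\<mu> \<bullet> \<mu>) *\<^sub>R \<nu> - (\<nu> \<bullet> \<mu>) *\<^sub>R \<mu>) = 0" .
  then have "(norm (\<mu> \<times>\<^sub>v \<nu>))\<^sup>2 = 0"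
    unfolding norm_cross unfolding power2_norm_eq_inner
    by (simp add: inner_diff_right inner_commute power2_eq_square mult.commute)
  then show "\<exists>x. \<nu> = x *\<^sub>R \<mu>"
    using cross_eq_0_iff_parallel[OF \<mu>] by simp
qed (auto simp: isotropy_dual_def isotropy_compl_iff inner_commute)

lemma isotropy_part_eq: "isotropy_part \<mu> \<xi> = ((\<xi> \<bullet> \<mu>) / (\<mu> \<bullet> \<mu>)) *\<^sub>R \<mu>"
  unfolding isotropy_part_def
proof (rule the_equality)
  show "((\<xi> \<bullet> \<mu>) / (\<mu> \<bullet> \<mu>)) *\<^sub>R \<mu> \<in> isotropy \<mu> \<and>
      \<xi> - ((\<xi> \<bullet> \<mu>) / (\<mu> \<bullet> \<mu>)) *\<^sub>R \<mu> \<in> isotropy_compl \<mu>"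
    using \<mu> by (auto simp: isotropy_iff isotropy_compl_iff inner_diff_left)
qed (use \<mu> in \<open>auto simp: isotropy_iff isotropy_compl_iff inner_diff_left\<close>)

text \<open>As \<open>v\<close> is orthogonal to \<mu>, v \<times> (v \<times> \<mu>) is
  \<open>- (v \<bullet> v)\<close> times \<mu>: the rotation moves \<mu> within the plane orthogonal
  to \<open>v\<close>.\<close>

lemma quat_rot_perp:
  assumes "v \<bullet> \<mu> = 0"
  shows "quat_rot w v *v \<mu> = (1 - 2 * (v \<bullet> v)) *\<^sub>R \<mu> + (2 * w) *\<^sub>R (v \<times>\<^sub>v \<mu>)"
proof -
  have "quat_rot w v *v \<mu> = \<mu> + (2 * w) *\<^sub>R (v \<times>\<^sub>v \<mu>) + 2 *\<^sub>R (v \<times>\<^sub>v (v \<times>\<^sub>v \<mu>))"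
    by (simp add: quat_rot_def matrix_vector_mult_add_rdistrib hat_mult_vec
        flip: scaleR_matrix_vector_assoc matrix_vector_mul_assoc)
  then show ?thesis
    using assms by (simp add: Lagrange algebra_simps)
qed

section \<open>Domain and range of \<Phi>\<close>

lemma open_tube_dom: "open tube_dom"
  unfolding tube_dom_def tube_gen_def split_def
  by (intro open_Collect_conj open_Collect_less continuous_intros continuous_on_cross)

lemma open_tube_ran: "open tube_ran"
  unfolding tube_ran_def by (intro open_Collect_less continuous_intros)

lemma tube_gen_perp: "tube_gen \<rho> \<bullet> \<mu> = 0"
  by (simp add: tube_gen_def dot_cross_self)

lemma tube_gen_cross: "\<rho> \<bullet> \<mu> = 0 \<Longrightarrow> \<mu> \<times>\<^sub>v tube_gen \<rho> = \<rho>"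
  using \<mu> by (simp add: tube_gen_def cross_mult_right Lagrange inner_commute)

lemma tube_gen_of_cross: "\<eta> \<bullet> \<mu> = 0 \<Longrightarrow> tube_gen (\<mu> \<times>\<^sub>v \<eta>) = \<eta>"
  using \<mu> cross_skew[of "\<mu> \<times>\<^sub>v \<eta>" \<mu>] Lagrange[of \<mu> \<mu> \<eta>]
  by (simp add: tube_gen_def inner_commute)

lemma tube_v_inner_less:
  assumes "(\<nu>, \<rho>) \<in> tube_dom"
  shows "tube_v \<nu> \<rho> \<bullet> tube_v \<nu> \<rho> < 1"
proof -
  have n: "norm (\<mu> + \<nu>) > 0" and *: "norm \<mu> * (tube_gen \<rho> \<bullet> tube_gen \<rho>) < 4 * norm (\<mu> + \<nu>)"
    using assms by (auto simp: tube_dom_def)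
  define c where "c = sqrt (norm \<mu> / norm (\<mu> + \<nu>))"
  have "tube_v \<nu> \<rho> \<bullet> tube_v \<nu> \<rho> = c\<^sup>2 / 4 * (tube_gen \<rho> \<bullet> tube_gen \<rho>)"
    by (simp add: tube_v_def power2_eq_square flip: c_def)
  also have "\<dots> = (norm \<mu> / norm (\<mu> + \<nu>)) / 4 * (tube_gen \<rho> \<bullet> tube_gen \<rho>)"
    by (simp add: c_def)
  also have "\<dots> < 1"
    using n * by (simp add: field_simps)
  finally show ?thesis .
qed

lemma tube_rot_SO3: "(\<nu>, \<rho>) \<in> tube_dom \<Longrightarrow> tube_rot \<nu> \<rho> \<in> SO3"
  unfolding tube_rot_def using tube_v_inner_less by (intro quat_rot_SO3) (simp add: less_imp_le)

text \<open>Squaring turns the bound on the length of \<eta> into the one of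
  \<open>tube_dom\<close>. Also \<nu> is now measured in units of \<mu> rather than of its unit
  vector, so that \<open>1 + x\<close> is the ratio \<open>l\<close> of the lengths of \<mu> + \<nu>
  and \<mu>.\<close>

lemma tube_U_iff:
  "(\<nu>, \<rho>) \<in> tube_U \<mu> \<longleftrightarrow>
    (\<nu>, \<rho>) \<in> tube_dom \<and> \<rho> \<bullet> \<mu> = 0 \<and> (\<exists>x>-1. \<nu> = x *\<^sub>R \<mu>)"
proof -
  have n: "norm \<mu> > 0" using \<mu> by simp
  have less_iff: "norm \<eta> < 2 * sqrt (norm (\<mu> + \<nu>) / norm \<mu>) \<longleftrightarrow>
      norm \<mu> * (\<eta> \<bullet> \<eta>) < 4 * norm (\<mu> + \<nu>)" for \<eta> \<nu> :: "real^3"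
  proof -
    have "norm \<eta> < 2 * sqrt (norm (\<mu> + \<nu>) / norm \<mu>) \<longleftrightarrow>
        (norm \<eta>)\<^sup>2 < (2 * sqrt (norm (\<mu> + \<nu>) / norm \<mu>))\<^sup>2"
      by (rule iffI, rule power_strict_mono) (auto intro: power2_less_imp_less)
    also have "\<dots> \<longleftrightarrow> norm \<mu> * (\<eta> \<bullet> \<eta>) < 4 * norm (\<mu> + \<nu>)"
      using n by (simp add: power_mult_distrib power2_norm_eq_inner field_simps)
    finally show ?thesis .
  qed
  have pos: "norm (\<mu> + x *\<^sub>R \<mu>) > 0" if "x > -1" for x
  proof -
    have "\<mu> + x *\<^sub>R \<mu> = (1 + x) *\<^sub>R \<mu>" by (simp add: algebra_simps)
    then show ?thesis using that \<mu> by simp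
  qed
  show ?thesis
  proof
    assume "(\<nu>, \<rho>) \<in> tube_U \<mu>"
    then obtain \<eta> x where *: "\<rho> = \<mu> \<times>\<^sub>v \<eta>" "\<eta> \<bullet> \<mu> = 0" "\<nu> = x *\<^sub>R (\<mu> /\<^sub>R norm \<mu>)"
      "x > - norm \<mu>" "norm \<eta> < 2 * sqrt (norm (\<mu> + \<nu>) / norm \<mu>)"
      unfolding tube_U_def adstar_eq isotropy_compl_iff by blast
    have x: "\<nu> = (x / norm \<mu>) *\<^sub>R \<mu>" "x / norm \<mu> > -1"
      unfolding *(3) pos_less_divide_eq[OF n] using *(4) by (simp_all add: divide_inverse)
    moreover have "(\<nu>, \<rho>) \<in> tube_dom"
      using *(5) pos[OF x(2)] unfolding less_iff tube_dom_def
      by (simp add: *(1) tube_gen_of_cross *(2) flip: x(1))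
    ultimately show "(\<nu>, \<rho>) \<in> tube_dom \<and> \<rho> \<bullet> \<mu> = 0 \<and> (\<exists>x>-1. \<nu> = x *\<^sub>R \<mu>)"
      using *(1) by (auto simp: dot_cross_self)
  next
    assume "(\<nu>, \<rho>) \<in> tube_dom \<and> \<rho> \<bullet> \<mu> = 0 \<and> (\<exists>x>-1. \<nu> = x *\<^sub>R \<mu>)"
    then obtain x where *: "(\<nu>, \<rho>) \<in> tube_dom" "\<rho> \<bullet> \<mu> = 0" "x > -1" "\<nu> = x *\<^sub>R \<mu>" by blast
    have 1: "\<nu> = (x * norm \<mu>) *\<^sub>R (\<mu> /\<^sub>R norm \<mu>)" and 2: "x * norm \<mu> > - norm \<mu>"
      using *(3,4) n mult_strict_right_mono[OF *(3) n] by simp_all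
    have 3: "norm (tube_gen \<rho>) < 2 * sqrt (norm (\<mu> + \<nu>) / norm \<mu>)"
      using *(1) unfolding less_iff tube_dom_def by simp
    have 4: "(\<nu>, \<rho>) = (\<nu>, \<mu> \<times>\<^sub>v tube_gen \<rho>)"
      by (simp add: tube_gen_cross[OF *(2)])
    show "(\<nu>, \<rho>) \<in> tube_U \<mu>"
      unfolding tube_U_def adstar_eq isotropy_compl_iff mem_Collect_eq
      by (rule exI[of _ \<nu>], rule exI[of _ "tube_gen \<rho>"], rule exI[of _ "x * norm \<mu>"])
        (intro conjI 1 2 3 4 tube_gen_perp)
  qed
qed

text \<open>The arcsine is half the angle and has sine \<open>norm v\<close>. By the double-angle
  formulas the coefficients of Rodrigues' formula become those of the quaternion, and the division
  by \<open>norm \<eta>\<close> disappears.\<close>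

lemma tube_Phi_eq:
  assumes "(\<nu>, \<rho>) \<in> tube_U \<mu>"
  shows "tube_Phi \<mu> (g, \<nu>, \<rho>) = tube_map (g, \<nu>, \<rho>)"
proof -
  have dom: "(\<nu>, \<rho>) \<in> tube_dom" and perp: "\<rho> \<bullet> \<mu> = 0"
    using assms tube_U_iff by auto
  define \<eta> where "\<eta> = tube_gen \<rho>"
  define v where "v = tube_v \<nu> \<rho>"
  define c where "c = sqrt (norm \<mu> / norm (\<mu> + \<nu>))"
  have c: "c \<ge> 0" by (simp add: c_def)
  have v: "v = (c / 2) *\<^sub>R \<eta>"
    by (simp add: v_def tube_v_def c_def \<eta>_def)
  have nv: "norm v = 1 / 2 * norm \<eta> * c"
    using c by (simp add: v)
  have "v \<bullet> v < 1"
    using tube_v_inner_less[OF dom] v_def by simp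
  then have nv1: "norm v < 1"
    by (simp add: norm_lt_square power2_eq_square)
  have "tube_F \<mu> \<nu> \<eta> = quat_rot (sqrt (1 - v \<bullet> v)) v"
  proof (cases "\<eta> = 0")
    case True
    then show ?thesis by (simp add: v tube_F_def quat_rot_def linear_0[OF linear_hat])
  next
    case False
    let ?n = "\<eta> /\<^sub>R norm \<eta>" and ?a = "arcsin (norm v)"
    have n: "norm ?n = 1" using False by simp
    have vn: "v = norm v *\<^sub>R ?n" using False unfolding nv by (simp add: v)
    have bounds: "- 1 \<le> norm v" "norm v \<le> 1"
      using nv1 norm_ge_zero[of v] by linarith+
    have sin: "sin ?a = norm v" and cos: "cos ?a = sqrt (1 - v \<bullet> v)"
      using sin_arcsin[OF bounds] cos_arcsin[OF bounds] by (simp_all only: power2_norm_eq_inner)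
    have "tube_F \<mu> \<nu> \<eta> = mat_exp ((2 * ?a) *\<^sub>R hat ?n)"
      using False unfolding tube_F_def nv c_def linear_scale[OF linear_hat] by simp
    also have "\<dots> = mat 1 + (2 * sin ?a * cos ?a) *\<^sub>R hat ?n + (2 * (sin ?a)\<^sup>2) *\<^sub>R (hat ?n ** hat ?n)"
      unfolding Rodrigues[OF n] by (simp add: sin_double cos_double_sin)
    also have "\<dots> = mat 1 + (2 * sqrt (1 - v \<bullet> v)) *\<^sub>R (norm v *\<^sub>R hat ?n)
        + 2 *\<^sub>R ((norm v *\<^sub>R hat ?n) ** (norm v *\<^sub>R hat ?n))"
      unfolding sin cos
      by (simp add: power2_eq_square mult_ac
          bounded_bilinear.scaleR_left[OF bounded_bilinear_matrix_mult]
          bounded_bilinear.scaleR_right[OF bounded_bilinear_matrix_mult])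
    also have "\<dots> = quat_rot (sqrt (1 - v \<bullet> v)) v"
      unfolding quat_rot_def by (subst (5 6 7) vn) (simp only: linear_scale[OF linear_hat])
    finally show ?thesis .
  qed
  then have "tube_F \<mu> \<nu> (orbit_gen \<mu> \<rho>) = tube_rot \<nu> \<rho>"
    by (simp add: \<eta>_def v_def tube_rot_def orbit_gen_eq[OF perp] tube_gen_def)
  then show ?thesis
    using tube_rot_SO3[OF dom]
    by (simp add: tube_Phi_def tube_map_def SO3_matrix_inv coadj_eq Let_def)
qed

lemma tube_map_in:
  assumes g: "g \<in> SO3" and U: "(\<nu>, \<rho>) \<in> tube_U \<mu>"
  shows "tube_map (g, \<nu>, \<rho>) \<in> SO3 \<times> tube_ran" "tube_inv (tube_map (g, \<nu>, \<rho>)) = (g, \<nu>, \<rho>)"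
proof -
  obtain x where dom: "(\<nu>, \<rho>) \<in> tube_dom" and perp: "\<rho> \<bullet> \<mu> = 0" and x: "x > -1" "\<nu> = x *\<^sub>R \<mu>"
    using U tube_U_iff by auto
  define v where "v = tube_v \<nu> \<rho>"
  define w where "w = sqrt (1 - v \<bullet> v)"
  define l where "l = 1 + x"
  define m where "m = quat_rot w v *v (\<mu> + \<nu>)"
  have l: "l > 0" using x by (simp add: l_def)
  have n: "norm \<mu> > 0" using \<mu> by simp
  have vv: "v \<bullet> v < 1" using tube_v_inner_less[OF dom] by (simp add: v_def)
  have w: "w > 0" "w\<^sup>2 = 1 - v \<bullet> v" using vv by (auto simp: w_def)
  have F: "tube_rot \<nu> \<rho> = quat_rot w v" by (simp add: tube_rot_def v_def w_def)
  have SO: "quat_rot w v \<in> SO3" using tube_rot_SO3[OF dom] F by simp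
  have sum: "\<mu> + \<nu> = l *\<^sub>R \<mu>" by (simp add: l_def x algebra_simps)
  have v\<mu>: "v \<bullet> \<mu> = 0" by (simp add: v_def tube_v_def tube_gen_perp)
  have m: "m = l *\<^sub>R ((1 - 2 * (v \<bullet> v)) *\<^sub>R \<mu> + (2 * w) *\<^sub>R (v \<times>\<^sub>v \<mu>))"
    by (simp add: m_def sum matrix_vector_mult_scaleR quat_rot_perp[OF v\<mu>])
  \<comment> \<open>Rotations preserve length, so \<open>l\<close>, and with it \<nu>, can be read
    off \<open>m\<close>.\<close>
  have nm: "norm m = l * norm \<mu>"
    using l SO3_norm[OF SO, of "l *\<^sub>R \<mu>"] by (simp add: m_def sum)
  have \<mu>m: "\<mu> \<bullet> m = l * (1 - 2 * (v \<bullet> v)) * (norm \<mu>)\<^sup>2"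
    by (simp add: m inner_add_right dot_cross_self power2_norm_eq_inner)
  have eq: "norm \<mu> * norm m + \<mu> \<bullet> m = l * (norm \<mu>)\<^sup>2 * (2 * (1 - v \<bullet> v))"
    by (simp add: nm \<mu>m power2_eq_square algebra_simps)
  have ran: "m \<in> tube_ran"
    using l n vv unfolding tube_ran_def by (simp add: eq)
  show "tube_map (g, \<nu>, \<rho>) \<in> SO3 \<times> tube_ran"
    using ran g SO by (simp add: tube_map_def F m_def SO3_mult SO3_transpose)
  \<comment> \<open>The cosine of the rotation angle, expressed by the squared sine of its
    half.\<close>
  have k: "\<mu> \<bullet> m / (norm \<mu> * norm m) = 1 - 2 * (v \<bullet> v)"
    using l n by (simp add: nm \<mu>m power2_eq_square)
  have w': "sqrt ((1 + \<mu> \<bullet> m / (norm \<mu> * norm m)) / 2) = w"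
    unfolding k by (simp add: w_def)
  \<comment> \<open>Only the component of \<open>m\<close> along v \<times> \<mu> survives, and
    \<mu> \<times> (v \<times> \<mu>) is a multiple of \<open>v\<close>.\<close>
  have "\<mu> \<times>\<^sub>v m = (l * (2 * w * (\<mu> \<bullet> \<mu>))) *\<^sub>R v"
    using v\<mu> by (simp add: m cross_mult_right cross_add_right Lagrange inner_commute[of \<mu> v])
  then have "\<mu> \<times>\<^sub>v m = (2 * w * (norm \<mu> * norm m)) *\<^sub>R v"
    unfolding nm power2_norm_eq_inner[symmetric] by (simp add: power2_eq_square mult_ac)
  then have v': "(1 / (2 * w * (norm \<mu> * norm m))) *\<^sub>R (\<mu> \<times>\<^sub>v m) = v"
    using w n nm l by simp
  have l': "norm m / norm \<mu> = l" using n by (simp add: nm)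
  have "norm \<mu> / norm (\<mu> + \<nu>) = 1 / l" using l n by (simp add: sum)
  then have "(2 * sqrt l) *\<^sub>R v = tube_gen \<rho>"
    using l by (simp add: v_def tube_v_def real_sqrt_divide)
  then have "\<mu> \<times>\<^sub>v ((2 * sqrt l) *\<^sub>R v) = \<rho>"
    by (simp add: tube_gen_cross[OF perp])
  moreover have "g ** transpose (quat_rot w v) ** quat_rot w v = g"
    by (rule SO3_cancel(4)[OF SO])
  ultimately show "tube_inv (tube_map (g, \<nu>, \<rho>)) = (g, \<nu>, \<rho>)"
    unfolding tube_map_def tube_inv_def F split Let_def m_def[symmetric] w' v' l'
    by (simp add: l_def x)
qed

lemma tube_inv_in:
  assumes R: "R \<in> SO3" and ran: "m \<in> tube_ran"
  shows "tube_inv (R, m) \<in> SO3 \<times> tube_U \<mu>" "tube_map (tube_inv (R, m)) = (R, m)"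
proof -
  define k where "k = \<mu> \<bullet> m / (norm \<mu> * norm m)"
  define w where "w = sqrt ((1 + k) / 2)"
  define v where "v = (1 / (2 * w * (norm \<mu> * norm m))) *\<^sub>R (\<mu> \<times>\<^sub>v m)"
  define l where "l = norm m / norm \<mu>"
  define \<eta> where "\<eta> = (2 * sqrt l) *\<^sub>R v"
  have pos: "norm \<mu> * norm m + \<mu> \<bullet> m > 0" using ran by (simp add: tube_ran_def)
  have n: "norm \<mu> > 0" using \<mu> by simp
  have m: "norm m > 0" using pos by auto
  have l: "l > 0" using m n by (simp add: l_def)
  have \<mu>m: "\<mu> \<bullet> m = k * (norm \<mu> * norm m)" using m n by (simp add: k_def)
  have "1 + k = (norm \<mu> * norm m + \<mu> \<bullet> m) / (norm \<mu> * norm m)"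
    using m n by (simp add: k_def add_divide_distrib)
  then have k: "1 + k > 0" using pos m n by simp
  have w: "w > 0" "w\<^sup>2 = (1 + k) / 2" using k by (auto simp: w_def)
  have v\<mu>: "v \<bullet> \<mu> = 0" by (simp add: v_def dot_cross_self)
  \<comment> \<open>The goal of this chain is the half-angle value \<open>(1 - k) / 2\<close>. The
    factor \<open>1 + k\<close> may be cancelled because \<open>m\<close> avoids the ray opposite to
    \<mu>.\<close>
  have "v \<bullet> v = (1 / (2 * w * (norm \<mu> * norm m)))\<^sup>2 * (norm (\<mu> \<times>\<^sub>v m))\<^sup>2"
    unfolding power2_norm_eq_inner by (simp add: v_def power2_eq_square)
  also have "\<dots> = (1 - k\<^sup>2) / (4 * w\<^sup>2)"
    using m n w(1) by (simp add: norm_cross \<mu>m power_divide power_mult_distrib field_simps)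
  also have "\<dots> = ((1 - k) * (1 + k)) / (2 * (1 + k))"
  proof -
    have "1 - k\<^sup>2 = (1 - k) * (1 + k)" "4 * ((1 + k) / 2) = 2 * (1 + k)"
      by (simp_all add: power2_eq_square algebra_simps)
    then show ?thesis by (simp only: w(2))
  qed
  also have "\<dots> = (1 - k) / 2"
    using k by (subst mult_divide_mult_cancel_right) auto
  finally have vv: "v \<bullet> v = (1 - k) / 2" .
  have SO: "quat_rot w v \<in> SO3" by (rule quat_rot_SO3) (simp add: w vv field_simps)
  have inv: "tube_inv (R, m) = (R ** quat_rot w v, (l - 1) *\<^sub>R \<mu>, \<mu> \<times>\<^sub>v \<eta>)"
    by (simp add: tube_inv_def Let_def k_def w_def v_def l_def \<eta>_def)
  have \<eta>\<mu>: "\<eta> \<bullet> \<mu> = 0" by (simp add: \<eta>_def v\<mu>)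
  have sum: "\<mu> + (l - 1) *\<^sub>R \<mu> = l *\<^sub>R \<mu>" by (simp add: algebra_simps)
  have "norm \<mu> * (\<eta> \<bullet> \<eta>) = norm \<mu> * (4 * l * (v \<bullet> v))"
    using l by (simp add: \<eta>_def)
  also have "\<dots> < 4 * (l * norm \<mu>)"
    using l n k by (simp add: vv)
  finally have dom: "((l - 1) *\<^sub>R \<mu>, \<mu> \<times>\<^sub>v \<eta>) \<in> tube_dom"
    using l n by (simp add: tube_dom_def sum tube_gen_of_cross \<eta>\<mu>)
  then have U: "((l - 1) *\<^sub>R \<mu>, \<mu> \<times>\<^sub>v \<eta>) \<in> tube_U \<mu>"
    using l by (auto simp: tube_U_iff dot_cross_self intro!: exI[of _ "l - 1"])
  show "tube_inv (R, m) \<in> SO3 \<times> tube_U \<mu>"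
    using U R SO by (simp add: inv SO3_mult)
  have "norm \<mu> / norm (l *\<^sub>R \<mu>) = 1 / l" using l n by simp
  then have v': "tube_v ((l - 1) *\<^sub>R \<mu>) (\<mu> \<times>\<^sub>v \<eta>) = v"
    using l unfolding tube_v_def sum tube_gen_of_cross[OF \<eta>\<mu>] by (simp add: \<eta>_def real_sqrt_divide)
  have "sqrt (1 - v \<bullet> v) = w"
    unfolding vv w_def by (simp add: field_simps)
  then have rot: "tube_rot ((l - 1) *\<^sub>R \<mu>) (\<mu> \<times>\<^sub>v \<eta>) = quat_rot w v"
    by (simp add: tube_rot_def v')
  \<comment> \<open>By Lagrange's identity v \<times> \<mu> is a multiple of the part of
    \<open>m\<close> orthogonal to \<mu>; hence \<open>quat_rot w v\<close> takes \<mu> to the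
    positive multiple of \<open>m\<close> of the same length.\<close>
  have "v \<times>\<^sub>v \<mu> = (1 / (2 * w * (norm \<mu> * norm m))) *\<^sub>R ((norm \<mu>)\<^sup>2 *\<^sub>R m - (\<mu> \<bullet> m) *\<^sub>R \<mu>)"
    using cross_skew[of "\<mu> \<times>\<^sub>v m" \<mu>]
    by (simp add: v_def cross_mult_left Lagrange power2_norm_eq_inner)
  then have "(2 * w) *\<^sub>R (v \<times>\<^sub>v \<mu>) = (norm \<mu> / norm m) *\<^sub>R m - k *\<^sub>R \<mu>"
    using w m n unfolding \<mu>m by (simp add: scaleR_diff_right power2_eq_square)
  then have "quat_rot w v *v \<mu> = (norm \<mu> / norm m) *\<^sub>R m"
    unfolding quat_rot_perp[OF v\<mu>] vv by (simp add: diff_divide_distrib)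
  then have "quat_rot w v *v (l *\<^sub>R \<mu>) = m"
    using m n by (simp add: matrix_vector_mult_scaleR l_def)
  then show "tube_map (tube_inv (R, m)) = (R, m)"
    unfolding inv by (simp add: tube_map_def rot sum SO3_cancel[OF SO])
qed

section \<open>Smoothness of \<Phi> and of its inverse\<close>

lemma smooth_on_quat_rot:
  "open T \<Longrightarrow> smooth_on T w \<Longrightarrow> smooth_on T v \<Longrightarrow> smooth_on T (\<lambda>x. quat_rot (w x) (v x))"
  unfolding quat_rot_def
  by (intro smooth_on_add smooth_on_const smooth_on_scaleR smooth_on_mult
      smooth_on_bilinear[OF bounded_bilinear_matrix_mult] smooth_on_linear[OF bounded_linear_hat])

lemma smooth_on_tube_map: "smooth_on (UNIV \<times> tube_dom) tube_map"
proof -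
  let ?T = "UNIV \<times> tube_dom :: ((real^3^3) \<times> (real^3) \<times> (real^3)) set"
  have T: "open ?T" by (intro open_Times open_UNIV open_tube_dom)
  have g: "smooth_on ?T fst" and \<nu>: "smooth_on ?T (\<lambda>x. fst (snd x))"
    and \<rho>: "smooth_on ?T (\<lambda>x. snd (snd x))"
    by (intro smooth_on_fst smooth_on_snd smooth_on_ident T)+
  have v: "smooth_on ?T (\<lambda>x. tube_v (fst (snd x)) (snd (snd x)))"
    unfolding tube_v_def tube_gen_def
    by (intro smooth_on_scaleR smooth_on_divide smooth_on_const smooth_on_sqrt smooth_on_norm T
        smooth_on_add \<nu> \<rho> smooth_on_bilinear[OF bounded_bilinear_cross3])
      (use \<mu> in \<open>auto simp: tube_dom_def\<close>)
  have "tube_v (fst (snd x)) (snd (snd x)) \<bullet> tube_v (fst (snd x)) (snd (snd x)) < 1" if "x \<in> ?T" for x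
    using that by (intro tube_v_inner_less) auto
  then have "smooth_on ?T (\<lambda>x. tube_rot (fst (snd x)) (snd (snd x)))"
    unfolding tube_rot_def
    by (intro smooth_on_quat_rot smooth_on_sqrt smooth_on_diff smooth_on_const smooth_on_inner v T)
      auto
  then show ?thesis
    unfolding tube_map_def split_def
    by (intro smooth_on_Pair smooth_on_bilinear[OF bounded_bilinear_matrix_mult] T g
        smooth_on_bilinear[OF bounded_bilinear_matrix_vector_mult] smooth_on_add smooth_on_const \<nu>
        smooth_on_linear[OF bounded_linear_transpose])
qed

lemma smooth_on_tube_inv: "smooth_on (UNIV \<times> tube_ran) tube_inv"
proof -
  let ?T = "UNIV \<times> tube_ran :: ((real^3^3) \<times> (real^3)) set"
  have T: "open ?T" by (intro open_Times open_UNIV open_tube_ran)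
  have R: "smooth_on ?T fst" and m: "smooth_on ?T snd"
    by (intro smooth_on_fst smooth_on_snd smooth_on_ident T)+
  have pos: "norm \<mu> * norm (snd x) + \<mu> \<bullet> snd x > 0" if "x \<in> ?T" for x
    using that by (auto simp: tube_ran_def)
  then have m0: "snd x \<noteq> 0" if "x \<in> ?T" for x
    using that by fastforce
  let ?w = "\<lambda>x. sqrt ((1 + \<mu> \<bullet> snd x / (norm \<mu> * norm (snd x))) / 2)"
  have w0: "(1 + \<mu> \<bullet> snd x / (norm \<mu> * norm (snd x))) / 2 > 0" if "x \<in> ?T" for x
    using pos[OF that] m0[OF that] \<mu> by (simp add: field_simps)
  have w: "smooth_on ?T ?w"
    by (intro smooth_on_sqrt smooth_on_divide smooth_on_add smooth_on_const smooth_on_inner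
        smooth_on_mult smooth_on_norm T m m0 w0) (use \<mu> m0 in auto)
  have w_ne: "?w x \<noteq> 0" if "x \<in> ?T" for x
    using w0[OF that] by (simp only: real_sqrt_eq_0_iff)
  have den: "2 * ?w x * (norm \<mu> * norm (snd x)) \<noteq> 0" if "x \<in> ?T" for x
    using \<mu> m0[OF that] w_ne[OF that] by (intro no_zero_divisors) (simp_all only: norm_eq_zero, simp_all)
  have v: "smooth_on ?T (\<lambda>x. (1 / (2 * ?w x * (norm \<mu> * norm (snd x)))) *\<^sub>R (\<mu> \<times>\<^sub>v snd x))"
    by (intro smooth_on_scaleR smooth_on_bilinear[OF bounded_bilinear_cross3] T smooth_on_const m
        smooth_on_divide smooth_on_mult smooth_on_norm w m0 den)
  show ?thesis
    unfolding tube_inv_def split_def Let_def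
    by (intro smooth_on_Pair smooth_on_bilinear[OF bounded_bilinear_matrix_mult] T R
        smooth_on_quat_rot w v smooth_on_scaleR smooth_on_diff smooth_on_divide smooth_on_norm
        smooth_on_const m smooth_on_bilinear[OF bounded_bilinear_cross3] smooth_on_mult
        smooth_on_sqrt m0) (use \<mu> m0 in auto)
qed

end

end

text \<open>For the unit quaternion q = w + v, the conjugate of q times q' has real part w w' + v
  \<bullet> v' = 0 and vector part w v' - w' v - v \<times> v'. Twice the latter is the angular
  velocity in the body frame, since a quaternion acts by twice its angle.\<close>

lemma quat_rot_derivative_identity:
  assumes 1: "w\<^sup>2 + v \<bullet> v = 1" and 2: "w * w' + v \<bullet> v' = 0"
  shows "(2 * w') *\<^sub>R hat v + (2 * w) *\<^sub>R hat v' + 2 *\<^sub>R (hat v' ** hat v + hat v ** hat v')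
    = quat_rot w v ** hat (2 *\<^sub>R (w *\<^sub>R v' - w' *\<^sub>R v - v \<times>\<^sub>v v'))"
proof -
  have 1: "w * w + v$1 * v$1 + v$2 * v$2 + v$3 * v$3 = 1"
    using 1 by (simp add: power2_eq_square inner_vec_def sum_3 add.assoc)
  have 2: "w * w' + v$1 * v'$1 + v$2 * v'$2 + v$3 * v'$3 = 0"
    using 2 by (simp add: inner_vec_def sum_3 add.assoc)
  show ?thesis
    unfolding quat_rot_def vec_eq_iff forall_3
    \<comment> \<open>What is left entrywise are polynomial identities modulo the two
      constraints.\<close>
    apply (simp add: hat_nth matrix_matrix_mult_def sum_3 cross_components mat_def)
    apply (intro conjI; (insert 1 2, algebra)?)
    done
qed

lemma quat_rot_has_vector_derivative:
  assumes w: "(w has_vector_derivative w') (at t)" and v: "(v has_vector_derivative v') (at t)"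
    and 1: "(w t)\<^sup>2 + v t \<bullet> v t = 1" and 2: "w t * w' + v t \<bullet> v' = 0"
  shows "((\<lambda>t. quat_rot (w t) (v t)) has_vector_derivative
    quat_rot (w t) (v t) ** hat (2 *\<^sub>R (w t *\<^sub>R v' - w' *\<^sub>R v t - v t \<times>\<^sub>v v'))) (at t)"
proof -
  note h = bounded_linear.has_vector_derivative[OF bounded_linear_hat v]
  note d1 = bounded_bilinear.has_vector_derivative[OF bounded_bilinear_scaleR
      bounded_linear.has_vector_derivative[OF bounded_linear_mult_right[of 2] w] h]
  note d2 = bounded_linear.has_vector_derivative[OF bounded_linear_scaleR_right[of 2]
      bounded_bilinear.has_vector_derivative[OF bounded_bilinear_matrix_mult h h]]
  note has_vector_derivative_add[OF has_vector_derivative_add[OF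
      has_vector_derivative_const[of "mat 1"] d1] d2, folded quat_rot_def]
  then show ?thesis
    unfolding quat_rot_derivative_identity[OF 1 2, symmetric] by (simp add: add_ac)
qed

section \<open>The derivative of \<Phi> and its effect on the form\<close>

context
  fixes \<mu> :: "real^3"
begin

text \<open>The left-trivialised derivative of \<open>tube_rot\<close> along \<open>(\<nu>', \<rho>')\<close>; here \<open>a\<close> is the factor
  between \<open>\<eta>\<close> and the quaternion vector \<open>v\<close>.\<close>

definition tube_beta :: "(real^3) \<times> (real^3) \<Rightarrow> (real^3) \<times> (real^3) \<Rightarrow> real^3" where
  "tube_beta = (\<lambda>(\<nu>, \<rho>) (\<nu>', \<rho>').
    let l = norm (\<mu> + \<nu>) / norm \<mu>; l' = (\<nu>' \<bullet> \<mu>) / (\<mu> \<bullet> \<mu>);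
      a = 1 / (2 * sqrt l); a' = - l' / (4 * l * sqrt l);
      v = a *\<^sub>R tube_gen \<mu> \<rho>; v' = a *\<^sub>R tube_gen \<mu> \<rho>' + a' *\<^sub>R tube_gen \<mu> \<rho>;
      w = sqrt (1 - v \<bullet> v); w' = - (v \<bullet> v') / w
    in 2 *\<^sub>R (w *\<^sub>R v' - w' *\<^sub>R v - v \<times>\<^sub>v v'))"

context
  assumes \<mu>: "\<mu> \<noteq> 0"
begin

lemma bounded_linear_tube_gen: "bounded_linear (tube_gen \<mu>)"
proof -
  have "tube_gen \<mu> = (\<lambda>\<rho>. (1 / (\<mu> \<bullet> \<mu>)) *\<^sub>R (\<rho> \<times>\<^sub>v \<mu>))"
    by (simp add: fun_eq_iff tube_gen_def)
  then show ?thesis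
    by (simp only: bounded_linear_const_scaleR
        bounded_bilinear.bounded_linear_left[OF bounded_bilinear_cross3])
qed

text \<open>A line in \<nu> is a line in \<open>l\<close>, so only the scalar \<open>a\<close> and
  the linear \<open>tube_gen\<close> have to be differentiated; \<open>w'\<close> is then forced by
  w^2 + v \<bullet> v = 1.\<close>

lemma tube_rot_has_vector_derivative:
  assumes U: "(\<nu>, \<rho>) \<in> tube_U \<mu>" and \<nu>': "\<nu>' \<in> isotropy_dual \<mu>"
  shows "((\<lambda>t. tube_rot \<mu> (\<nu> + t *\<^sub>R \<nu>') (\<rho> + t *\<^sub>R \<rho>')) has_vector_derivative
    tube_rot \<mu> \<nu> \<rho> ** hat (tube_beta (\<nu>, \<rho>) (\<nu>', \<rho>'))) (at 0)"
proof -
  obtain x where dom: "(\<nu>, \<rho>) \<in> tube_dom \<mu>" and x: "x > -1" "\<nu> = x *\<^sub>R \<mu>"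
    using U tube_U_iff[OF \<mu>] by auto
  obtain l' where l': "\<nu>' = l' *\<^sub>R \<mu>"
    using \<nu>' isotropy_dual_iff[OF \<mu>] by auto
  define l where "l = 1 + x"
  define a where "a = 1 / (2 * sqrt l)"
  define a' where "a' = - l' / (4 * l * sqrt l)"
  define v where "v = a *\<^sub>R tube_gen \<mu> \<rho>"
  define v' where "v' = a *\<^sub>R tube_gen \<mu> \<rho>' + a' *\<^sub>R tube_gen \<mu> \<rho>"
  define w where "w = sqrt (1 - v \<bullet> v)"
  define w' where "w' = - (v \<bullet> v') / w"
  have l: "l > 0" using x by (simp add: l_def)
  have sum: "\<mu> + (\<nu> + t *\<^sub>R \<nu>') = (l + t * l') *\<^sub>R \<mu>" for t
    by (simp add: l_def l' x algebra_simps)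
  have sum0: "\<mu> + \<nu> = l *\<^sub>R \<mu>" using sum[of 0] by simp
  have vt: "tube_v \<mu> (\<nu> + t *\<^sub>R \<nu>') (\<rho> + t *\<^sub>R \<rho>') =
      (1 / (2 * sqrt (l + t * l'))) *\<^sub>R tube_gen \<mu> (\<rho> + t *\<^sub>R \<rho>')" if "l + t * l' > 0" for t
    using that \<mu> unfolding tube_v_def sum by (simp add: real_sqrt_divide)
  have v0: "tube_v \<mu> \<nu> \<rho> = v" using vt[of 0] l by (simp add: v_def a_def)
  have vv: "v \<bullet> v < 1" using tube_v_inner_less[OF \<mu> dom] by (simp add: v0)
  then have w: "w > 0" "w\<^sup>2 = 1 - v \<bullet> v" by (auto simp: w_def)
  have gen: "((\<lambda>t. tube_gen \<mu> (\<rho> + t *\<^sub>R \<rho>')) has_vector_derivative tube_gen \<mu> \<rho>') (at 0)"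
    by (rule bounded_linear.has_vector_derivative[OF bounded_linear_tube_gen])
      (auto intro!: derivative_eq_intros)
  have "((\<lambda>t. 1 / (2 * sqrt (l + t * l'))) has_field_derivative a') (at 0)"
    using l by (auto intro!: derivative_eq_intros simp: a'_def field_simps)
  then have "((\<lambda>t. 1 / (2 * sqrt (l + t * l'))) has_vector_derivative a') (at 0)"
    by (simp add: has_real_derivative_iff_has_vector_derivative)
  from bounded_bilinear.has_vector_derivative[OF bounded_bilinear_scaleR this gen]
  have V: "((\<lambda>t. (1 / (2 * sqrt (l + t * l'))) *\<^sub>R tube_gen \<mu> (\<rho> + t *\<^sub>R \<rho>')) has_vector_derivative v') (at 0)"
    by (simp add: v'_def a_def)
  let ?V = "\<lambda>t. (1 / (2 * sqrt (l + t * l'))) *\<^sub>R tube_gen \<mu> (\<rho> + t *\<^sub>R \<rho>')"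
  have V0: "?V 0 = v" by (simp add: v_def a_def)
  have w': "inverse (sqrt (1 - v \<bullet> v)) / 2 * (- 2 * (v \<bullet> v')) = w'"
    using w by (simp add: w'_def field_simps flip: w_def)
  have "((\<lambda>t. 1 - ?V t \<bullet> ?V t) has_vector_derivative (0 - (v \<bullet> v' + v' \<bullet> v))) (at 0)"
    using bounded_bilinear.has_vector_derivative[OF bounded_bilinear_inner V V] unfolding V0
    by (intro has_vector_derivative_diff has_vector_derivative_const)
  then have "((\<lambda>t. 1 - ?V t \<bullet> ?V t) has_field_derivative (- 2 * (v \<bullet> v'))) (at 0)"
    by (simp add: has_real_derivative_iff_has_vector_derivative inner_commute)
  moreover have "DERIV sqrt (1 - ?V 0 \<bullet> ?V 0) :> inverse (sqrt (1 - v \<bullet> v)) / 2"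
    unfolding V0 using vv by (intro DERIV_real_sqrt) simp
  ultimately have "((\<lambda>t. sqrt (1 - ?V t \<bullet> ?V t)) has_field_derivative
      (inverse (sqrt (1 - v \<bullet> v)) / 2 * (- 2 * (v \<bullet> v')))) (at 0)"
    by (rule DERIV_chain2[rotated])
  then have W: "((\<lambda>t. sqrt (1 - ?V t \<bullet> ?V t)) has_vector_derivative w') (at 0)"
    by (simp only: has_real_derivative_iff_has_vector_derivative w')
  have "((\<lambda>t. quat_rot (sqrt (1 - ?V t \<bullet> ?V t)) (?V t)) has_vector_derivative
      quat_rot w v ** hat (2 *\<^sub>R (w *\<^sub>R v' - w' *\<^sub>R v - v \<times>\<^sub>v v'))) (at 0)"
    using quat_rot_has_vector_derivative[OF W V] w unfolding V0 w_def[symmetric]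
    by (simp add: w'_def)
  moreover have "tube_rot \<mu> \<nu> \<rho> = quat_rot w v"
    by (simp add: tube_rot_def v0 w_def)
  moreover have "tube_beta (\<nu>, \<rho>) (\<nu>', \<rho>') = 2 *\<^sub>R (w *\<^sub>R v' - w' *\<^sub>R v - v \<times>\<^sub>v v')"
  proof -
    have "norm (\<mu> + \<nu>) / norm \<mu> = l" "(\<nu>' \<bullet> \<mu>) / (\<mu> \<bullet> \<mu>) = l'"
      using \<mu> l by (simp_all add: sum0 l')
    then show ?thesis
      unfolding tube_beta_def split Let_def
      by (simp only: a_def a'_def v_def v'_def w_def w'_def)
  qed
  ultimately have *: "((\<lambda>t. quat_rot (sqrt (1 - ?V t \<bullet> ?V t)) (?V t)) has_vector_derivative
      tube_rot \<mu> \<nu> \<rho> ** hat (tube_beta (\<nu>, \<rho>) (\<nu>', \<rho>'))) (at 0)"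
    by simp
  \<comment> \<open>The formula for \<open>tube_v\<close> along the curve reads
    \<open>norm (\<mu> + \<nu>)\<close> as a multiple of \<open>l + t * l'\<close>, which is right
    while that number is positive.\<close>
  have "open {t. l + t * l' > 0}" by (intro open_Collect_less continuous_intros)
  from has_vector_derivative_transform_within_open[OF * this]
  show ?thesis
    using l vt by (simp add: tube_rot_def)
qed

text \<open>The transpose of \<open>F\<close> has derivative
  \<open>- hat \<beta> ** transpose F\<close>, so the body velocity becomes \<xi> - \<beta>, and
  conjugation by \<open>F\<close> rotates it. The momentum picks up \<beta> \<times> (\<mu> + \<nu>)
  from the motion of \<open>F\<close>.\<close>

lemma tube_map_has_vector_derivative:
  fixes \<rho>' :: "real^3"
  assumes U: "(\<nu>, \<rho>) \<in> tube_U \<mu>" and \<nu>': "\<nu>' \<in> isotropy_dual \<mu>"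
  defines "F \<equiv> tube_rot \<mu> \<nu> \<rho>" and "\<beta> \<equiv> tube_beta (\<nu>, \<rho>) (\<nu>', \<rho>')"
  shows "((\<lambda>t. g ** mat_exp (t *\<^sub>R hat \<xi>) ** transpose (tube_rot \<mu> (\<nu> + t *\<^sub>R \<nu>') (\<rho> + t *\<^sub>R \<rho>')))
      has_vector_derivative (g ** transpose F) ** hat (F *v (\<xi> - \<beta>))) (at 0)"
    and "((\<lambda>t. tube_rot \<mu> (\<nu> + t *\<^sub>R \<nu>') (\<rho> + t *\<^sub>R \<rho>') *v (\<mu> + (\<nu> + t *\<^sub>R \<nu>')))
      has_vector_derivative F *v (\<nu>' + \<beta> \<times>\<^sub>v (\<mu> + \<nu>))) (at 0)"
proof -
  have F: "F \<in> SO3" using U tube_U_iff[OF \<mu>] tube_rot_SO3[OF \<mu>] by (auto simp: F_def)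
  note d = tube_rot_has_vector_derivative[OF U \<nu>', of \<rho>', folded F_def \<beta>_def]
  have "((\<lambda>t. g ** mat_exp (t *\<^sub>R hat \<xi>)) has_vector_derivative g ** hat \<xi>) (at 0)"
    by (rule bounded_linear.has_vector_derivative[OF
          bounded_bilinear.bounded_linear_right[OF bounded_bilinear_matrix_mult]
          mat_exp_has_vector_derivative])
  from bounded_bilinear.has_vector_derivative[OF bounded_bilinear_matrix_mult this
      bounded_linear.has_vector_derivative[OF bounded_linear_transpose d]]
  have "((\<lambda>t. g ** mat_exp (t *\<^sub>R hat \<xi>) ** transpose (tube_rot \<mu> (\<nu> + t *\<^sub>R \<nu>') (\<rho> + t *\<^sub>R \<rho>')))
      has_vector_derivative (g ** transpose (F ** hat \<beta>) + g ** hat \<xi> ** transpose F)) (at 0)"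
    by (simp add: mat_exp_0[simplified] F_def)
  moreover have "g ** transpose (F ** hat \<beta>) + g ** hat \<xi> ** transpose F
      = (g ** transpose F) ** hat (F *v (\<xi> - \<beta>))"
  proof -
    have "(g ** transpose F) ** hat (F *v (\<xi> - \<beta>)) = g ** (transpose F ** (F ** hat (\<xi> - \<beta>) ** transpose F))"
      by (simp add: hat_conjugate[OF F] matrix_mul_assoc)
    also have "\<dots> = g ** (hat (\<xi> - \<beta>) ** transpose F)"
      by (simp add: SO3_cancel[OF F] flip: matrix_mul_assoc)
    also have "\<dots> = g ** transpose (F ** hat \<beta>) + g ** hat \<xi> ** transpose F"
      by (simp add: matrix_transpose_mul transpose_hat linear_diff[OF linear_hat] matrix_mul_assoc
          bounded_bilinear.diff_left[OF bounded_bilinear_matrix_mult]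
          bounded_bilinear.diff_right[OF bounded_bilinear_matrix_mult]
          bounded_bilinear.minus_left[OF bounded_bilinear_matrix_mult]
          bounded_bilinear.minus_right[OF bounded_bilinear_matrix_mult])
    finally show ?thesis by simp
  qed
  ultimately show "((\<lambda>t. g ** mat_exp (t *\<^sub>R hat \<xi>) ** transpose (tube_rot \<mu> (\<nu> + t *\<^sub>R \<nu>') (\<rho> + t *\<^sub>R \<rho>')))
      has_vector_derivative (g ** transpose F) ** hat (F *v (\<xi> - \<beta>))) (at 0)"
    by simp
  have "((\<lambda>t. \<mu> + (\<nu> + t *\<^sub>R \<nu>')) has_vector_derivative \<nu>') (at 0)"
    by (auto intro!: derivative_eq_intros)
  from bounded_bilinear.has_vector_derivative[OF bounded_bilinear_matrix_vector_mult d this]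
  show "((\<lambda>t. tube_rot \<mu> (\<nu> + t *\<^sub>R \<nu>') (\<rho> + t *\<^sub>R \<rho>') *v (\<mu> + (\<nu> + t *\<^sub>R \<nu>')))
      has_vector_derivative F *v (\<nu>' + \<beta> \<times>\<^sub>v (\<mu> + \<nu>))) (at 0)"
    by (simp add: F_def matrix_vector_right_distrib cross_add_right hat_mult_vec flip: matrix_vector_mul_assoc)
qed

text \<open>Cramer's rule writes \<open>v\<close>, times the triple product of \<mu>,
  \<open>v1\<close>, \<open>v2\<close>, as a combination of \<mu>, \<open>v1\<close> and
  \<open>v2\<close>. The inner product of this with \<open>v\<close> is the identity, the \<mu>-term
  vanishing.\<close>

lemma triple_plane_identity:
  assumes "v \<bullet> \<mu> = 0"
  shows "(v \<bullet> v2) * (\<mu> \<bullet> (v1 \<times>\<^sub>v v)) + (v \<bullet> v1) * (\<mu> \<bullet> (v \<times>\<^sub>v v2)) = (v \<bullet> v) * (\<mu> \<bullet> (v1 \<times>\<^sub>v v2))"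
proof -
  have "(v \<bullet> v) * (\<mu> \<bullet> (v1 \<times>\<^sub>v v2)) - (v \<bullet> v2) * (\<mu> \<bullet> (v1 \<times>\<^sub>v v)) - (v \<bullet> v1) * (\<mu> \<bullet> (v \<times>\<^sub>v v2))
      = (v \<bullet> \<mu>) * (v \<bullet> (v1 \<times>\<^sub>v v2))"
    by (simp add: inner_vec_def sum_3 cross_components algebra_simps)
  then show ?thesis using assms by simp
qed

text \<open>All three vectors lie in the plane orthogonal to \<mu>, so v \<times> v1 and v \<times>
  v2 are multiples of \<mu> and drop out of a triple product with \<mu>. In the rest, the
  constraints on \<open>w1\<close> and \<open>w2\<close> and the plane identity add up to the factor
  w^2 + v \<bullet> v = 1.\<close>

lemma quat_beta_identity:
  assumes perp: "v \<bullet> \<mu> = 0" "v1 \<bullet> \<mu> = 0" "v2 \<bullet> \<mu> = 0"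
    and w: "w\<^sup>2 + v \<bullet> v = 1" "w * w1 + v \<bullet> v1 = 0" "w * w2 + v \<bullet> v2 = 0"
  defines "\<beta>1 \<equiv> 2 *\<^sub>R (w *\<^sub>R v1 - w1 *\<^sub>R v - v \<times>\<^sub>v v1)"
    and "\<beta>2 \<equiv> 2 *\<^sub>R (w *\<^sub>R v2 - w2 *\<^sub>R v - v \<times>\<^sub>v v2)"
  shows "\<mu> \<bullet> (\<beta>1 \<times>\<^sub>v \<beta>2) = 4 * (\<mu> \<bullet> (v1 \<times>\<^sub>v v2))"
    and "\<mu> \<bullet> \<beta>1 = - 2 * (\<mu> \<bullet> (v \<times>\<^sub>v v1))"
proof -
  show "\<mu> \<bullet> \<beta>1 = - 2 * (\<mu> \<bullet> (v \<times>\<^sub>v v1))"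
    using perp by (simp add: \<beta>1_def inner_diff_right inner_commute)
  define p1 where "p1 = w *\<^sub>R v1 - w1 *\<^sub>R v"
  define p2 where "p2 = w *\<^sub>R v2 - w2 *\<^sub>R v"
  have par: "\<exists>x. v \<times>\<^sub>v u = x *\<^sub>R \<mu>" if "u \<bullet> \<mu> = 0" for u
    unfolding cross_eq_0_iff_parallel[OF \<mu>, symmetric]
    using perp that by (simp add: Lagrange inner_commute)
  obtain x1 x2 where x: "v \<times>\<^sub>v v1 = x1 *\<^sub>R \<mu>" "v \<times>\<^sub>v v2 = x2 *\<^sub>R \<mu>"
    using par perp by blast
  have "\<mu> \<bullet> (\<beta>1 \<times>\<^sub>v \<beta>2) = 4 * (\<mu> \<bullet> ((p1 - x1 *\<^sub>R \<mu>) \<times>\<^sub>v (p2 - x2 *\<^sub>R \<mu>)))"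
    by (simp add: \<beta>1_def \<beta>2_def x p1_def p2_def cross_mult_left cross_mult_right)
  also have "\<mu> \<bullet> ((p1 - x1 *\<^sub>R \<mu>) \<times>\<^sub>v (p2 - x2 *\<^sub>R \<mu>)) = \<mu> \<bullet> (p1 \<times>\<^sub>v p2)"
    by (simp add: Cross3.left_diff_distrib Cross3.right_diff_distrib cross_mult_left cross_mult_right
        inner_diff_right dot_cross_self)
  also have "\<dots> = w\<^sup>2 * (\<mu> \<bullet> (v1 \<times>\<^sub>v v2)) - (w * w2) * (\<mu> \<bullet> (v1 \<times>\<^sub>v v)) - (w * w1) * (\<mu> \<bullet> (v \<times>\<^sub>v v2))"
    by (simp add: p1_def p2_def Cross3.left_diff_distrib Cross3.right_diff_distrib cross_mult_left
        cross_mult_right inner_diff_right power2_eq_square algebra_simps)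
  also have "\<dots> = w\<^sup>2 * (\<mu> \<bullet> (v1 \<times>\<^sub>v v2)) + (v \<bullet> v) * (\<mu> \<bullet> (v1 \<times>\<^sub>v v2))"
  proof -
    have "w * w1 = - (v \<bullet> v1)" "w * w2 = - (v \<bullet> v2)" using w by auto
    then show ?thesis
      using triple_plane_identity[OF perp(1), of v2 v1] by simp
  qed
  also have "\<dots> = \<mu> \<bullet> (v1 \<times>\<^sub>v v2)"
    using w(1) by (metis distrib_right mult_1)
  finally show "\<mu> \<bullet> (\<beta>1 \<times>\<^sub>v \<beta>2) = 4 * (\<mu> \<bullet> (v1 \<times>\<^sub>v v2))" .
qed

text \<open>The choice of scaling enters here. Differentiating \<open>a = 1 / (2 * sqrt l)\<close>
  along \<nu>1 and \<nu>2 contributes terms to the triple product that cancel the pairings of \<nu>2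
  with \<beta>1 and of \<nu>1 with \<beta>2, and \<open>4 * l * a\<^sup>2 = 1\<close> normalises
  what remains.\<close>

lemma tube_beta_identity:
  fixes \<rho>1 \<rho>2 :: "real^3"
  assumes U: "(\<nu>, \<rho>) \<in> tube_U \<mu>" and \<nu>: "\<nu>1 \<in> isotropy_dual \<mu>" "\<nu>2 \<in> isotropy_dual \<mu>"
  defines "\<beta>1 \<equiv> tube_beta (\<nu>, \<rho>) (\<nu>1, \<rho>1)" and "\<beta>2 \<equiv> tube_beta (\<nu>, \<rho>) (\<nu>2, \<rho>2)"
  shows "(\<mu> + \<nu>) \<bullet> (\<beta>1 \<times>\<^sub>v \<beta>2) + \<nu>2 \<bullet> \<beta>1 - \<nu>1 \<bullet> \<beta>2
      = \<mu> \<bullet> (tube_gen \<mu> \<rho>1 \<times>\<^sub>v tube_gen \<mu> \<rho>2)"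
proof -
  obtain x where dom: "(\<nu>, \<rho>) \<in> tube_dom \<mu>" and x: "x > -1" "\<nu> = x *\<^sub>R \<mu>"
    using U tube_U_iff[OF \<mu>] by auto
  obtain l1 l2 where l': "\<nu>1 = l1 *\<^sub>R \<mu>" "\<nu>2 = l2 *\<^sub>R \<mu>"
    using \<nu> isotropy_dual_iff[OF \<mu>] by auto
  define l where "l = 1 + x"
  define a where "a = 1 / (2 * sqrt l)"
  define a' where "a' l' = - l' / (4 * l * sqrt l)" for l'
  define \<eta> where "\<eta> = tube_gen \<mu> \<rho>"
  define \<eta>1 where "\<eta>1 = tube_gen \<mu> \<rho>1"
  define \<eta>2 where "\<eta>2 = tube_gen \<mu> \<rho>2"
  define v where "v = a *\<^sub>R \<eta>"
  define v1 where "v1 = a *\<^sub>R \<eta>1 + a' l1 *\<^sub>R \<eta>"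
  define v2 where "v2 = a *\<^sub>R \<eta>2 + a' l2 *\<^sub>R \<eta>"
  define w where "w = sqrt (1 - v \<bullet> v)"
  have l: "l > 0" using x by (simp add: l_def)
  have sum: "\<mu> + \<nu> = l *\<^sub>R \<mu>" by (simp add: l_def x algebra_simps)
  have nl: "norm (\<mu> + \<nu>) / norm \<mu> = l" "(\<nu>1 \<bullet> \<mu>) / (\<mu> \<bullet> \<mu>) = l1" "(\<nu>2 \<bullet> \<mu>) / (\<mu> \<bullet> \<mu>) = l2"
    using \<mu> l by (simp_all add: sum l')
  have "tube_v \<mu> \<nu> \<rho> = v"
    using \<mu> l unfolding tube_v_def sum by (simp add: v_def a_def \<eta>_def real_sqrt_divide)
  then have "v \<bullet> v < 1" using tube_v_inner_less[OF \<mu> dom] by simp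
  then have w: "w > 0" "w\<^sup>2 + v \<bullet> v = 1" by (auto simp: w_def)
  have \<beta>1: "\<beta>1 = 2 *\<^sub>R (w *\<^sub>R v1 - (- (v \<bullet> v1) / w) *\<^sub>R v - v \<times>\<^sub>v v1)"
    unfolding \<beta>1_def tube_beta_def split Let_def nl
    by (simp only: a_def a'_def \<eta>_def \<eta>1_def v_def v1_def w_def)
  have \<beta>2: "\<beta>2 = 2 *\<^sub>R (w *\<^sub>R v2 - (- (v \<bullet> v2) / w) *\<^sub>R v - v \<times>\<^sub>v v2)"
    unfolding \<beta>2_def tube_beta_def split Let_def nl
    by (simp only: a_def a'_def \<eta>_def \<eta>2_def v_def v2_def w_def)
  have perp: "v \<bullet> \<mu> = 0" "v1 \<bullet> \<mu> = 0" "v2 \<bullet> \<mu> = 0"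
    by (simp_all add: v_def v1_def v2_def \<eta>_def \<eta>1_def \<eta>2_def tube_gen_perp[OF \<mu>] inner_add_left)
  have W: "w * (- (v \<bullet> u) / w) + v \<bullet> u = 0" for u using w by simp
  have id: "\<mu> \<bullet> (\<beta>1 \<times>\<^sub>v \<beta>2) = 4 * (\<mu> \<bullet> (v1 \<times>\<^sub>v v2))" "\<mu> \<bullet> \<beta>1 = - 2 * (\<mu> \<bullet> (v \<times>\<^sub>v v1))"
    "\<mu> \<bullet> \<beta>2 = - 2 * (\<mu> \<bullet> (v \<times>\<^sub>v v2))"
    using quat_beta_identity[OF perp w(2) W W] quat_beta_identity(2)[OF perp(1,3,2) w(2) W W]
    unfolding \<beta>1 \<beta>2 by blast+
  have a: "4 * l * a\<^sup>2 = 1" "a' r = - (r * a / (2 * l))" for r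
    using l by (simp_all add: a_def a'_def power_divide power_mult_distrib field_simps)
  have v12: "\<mu> \<bullet> (v1 \<times>\<^sub>v v2) = a\<^sup>2 * (\<mu> \<bullet> (\<eta>1 \<times>\<^sub>v \<eta>2)) - a\<^sup>2 * l2 / (2 * l) * (\<mu> \<bullet> (\<eta>1 \<times>\<^sub>v \<eta>))
      + a\<^sup>2 * l1 / (2 * l) * (\<mu> \<bullet> (\<eta>2 \<times>\<^sub>v \<eta>))"
    using cross_skew[of \<eta> \<eta>2] unfolding v1_def v2_def a(2)
    by (simp add: cross_add_left cross_add_right cross_mult_left cross_mult_right inner_add_right
        Cross3.left_diff_distrib Cross3.right_diff_distrib inner_diff_right
        power2_eq_square algebra_simps)
  have vv1: "\<mu> \<bullet> (v \<times>\<^sub>v v1) = - (a\<^sup>2 * (\<mu> \<bullet> (\<eta>1 \<times>\<^sub>v \<eta>)))"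
    using cross_skew[of \<eta> \<eta>1] unfolding v1_def v_def
    by (simp add: cross_add_right cross_mult_left cross_mult_right power2_eq_square)
  have vv2: "\<mu> \<bullet> (v \<times>\<^sub>v v2) = - (a\<^sup>2 * (\<mu> \<bullet> (\<eta>2 \<times>\<^sub>v \<eta>)))"
    using cross_skew[of \<eta> \<eta>2] unfolding v2_def v_def
    by (simp add: cross_add_right cross_mult_left cross_mult_right power2_eq_square)
  have "(\<mu> + \<nu>) \<bullet> (\<beta>1 \<times>\<^sub>v \<beta>2) + \<nu>2 \<bullet> \<beta>1 - \<nu>1 \<bullet> \<beta>2
      = l * (\<mu> \<bullet> (\<beta>1 \<times>\<^sub>v \<beta>2)) + l2 * (\<mu> \<bullet> \<beta>1) - l1 * (\<mu> \<bullet> \<beta>2)"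
    by (simp add: sum l')
  also have "\<dots> = (4 * l * a\<^sup>2) * (\<mu> \<bullet> (\<eta>1 \<times>\<^sub>v \<eta>2))"
    unfolding id v12 vv1 vv2 using l by (simp add: field_simps)
  finally show ?thesis
    unfolding a by (simp add: \<eta>1_def \<eta>2_def)
qed

text \<open>\<open>F\<close> drops out by invariance. The terms mixing \<xi> and \<beta> cancel
  between the bracket and the momentum pairings, which leaves the \<beta>-part with the opposite
  sign, as evaluated by \<open>tube_beta_identity\<close>.\<close>

lemma tube_map_symplectic:
  assumes U: "(\<nu>, \<rho>) \<in> tube_U \<mu>" and \<nu>: "\<nu>1 \<in> isotropy_dual \<mu>" "\<nu>2 \<in> isotropy_dual \<mu>"
    and \<rho>: "\<rho>1 \<in> orbit_tangent \<mu>" "\<rho>2 \<in> orbit_tangent \<mu>"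
  defines "F \<equiv> tube_rot \<mu> \<nu> \<rho>"
    and "\<beta>1 \<equiv> tube_beta (\<nu>, \<rho>) (\<nu>1, \<rho>1)" and "\<beta>2 \<equiv> tube_beta (\<nu>, \<rho>) (\<nu>2, \<rho>2)"
  shows "(F *v (\<mu> + \<nu>)) \<bullet> ((F *v (\<xi>1 - \<beta>1)) \<times>\<^sub>v (F *v (\<xi>2 - \<beta>2)))
      + (F *v (\<nu>2 + \<beta>2 \<times>\<^sub>v (\<mu> + \<nu>))) \<bullet> (F *v (\<xi>1 - \<beta>1))
      - (F *v (\<nu>1 + \<beta>1 \<times>\<^sub>v (\<mu> + \<nu>))) \<bullet> (F *v (\<xi>2 - \<beta>2))
      = Omega_Y \<mu> (g, \<nu>, \<rho>) (\<xi>1, \<nu>1, \<rho>1) (\<xi>2, \<nu>2, \<rho>2)"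
proof -
  have F: "F \<in> SO3" using U tube_U_iff[OF \<mu>] tube_rot_SO3[OF \<mu>] by (auto simp: F_def)
  have gen: "orbit_gen \<mu> \<rho>1 = tube_gen \<mu> \<rho>1" "orbit_gen \<mu> \<rho>2 = tube_gen \<mu> \<rho>2"
    using \<rho> orbit_tangent_iff[OF \<mu>] orbit_gen_eq[OF \<mu>] by (auto simp: tube_gen_def)
  obtain l1 l2 where l': "\<nu>1 = l1 *\<^sub>R \<mu>" "\<nu>2 = l2 *\<^sub>R \<mu>"
    using \<nu> isotropy_dual_iff[OF \<mu>] by auto
  \<comment> \<open>\<nu>1 and \<nu>2 are multiples of \<mu> and see only the \<mu>-component of
    \<xi>.\<close>
  have part: "\<nu>2 \<bullet> isotropy_part \<mu> \<xi>1 = \<nu>2 \<bullet> \<xi>1" "\<nu>1 \<bullet> isotropy_part \<mu> \<xi>2 = \<nu>1 \<bullet> \<xi>2"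
    using \<mu> by (simp_all add: isotropy_part_eq l' inner_commute)
  let ?L = "\<mu> + \<nu>"
  have "?L \<bullet> ((\<xi>1 - \<beta>1) \<times>\<^sub>v (\<xi>2 - \<beta>2)) + (\<nu>2 + \<beta>2 \<times>\<^sub>v ?L) \<bullet> (\<xi>1 - \<beta>1) - (\<nu>1 + \<beta>1 \<times>\<^sub>v ?L) \<bullet> (\<xi>2 - \<beta>2)
      = ?L \<bullet> (\<xi>1 \<times>\<^sub>v \<xi>2) + \<nu>2 \<bullet> \<xi>1 - \<nu>1 \<bullet> \<xi>2 - (?L \<bullet> (\<beta>1 \<times>\<^sub>v \<beta>2) + \<nu>2 \<bullet> \<beta>1 - \<nu>1 \<bullet> \<beta>2)"
    by (simp add: inner_vec_def sum_3 cross_components algebra_simps)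
  also have "\<dots> = Omega_Y \<mu> (g, \<nu>, \<rho>) (\<xi>1, \<nu>1, \<rho>1) (\<xi>2, \<nu>2, \<rho>2)"
    unfolding \<beta>1_def \<beta>2_def tube_beta_identity[OF U \<nu>] by (simp add: Omega_Y_def gen part)
  finally show ?thesis
    by (simp add: SO3_cross[OF F] SO3_inner[OF F])
qed

end

end

subsection \<open>Charts and tangent vectors\<close>

text \<open>\<open>topology\<close> is specified only on predicates that satisfy
  \<open>istopology\<close>; injectivity of the charts makes images commute with
  intersections.\<close>

lemma openin_manifold_topology:
  assumes "\<And>c. c \<in> A \<Longrightarrow> inj_on (snd c) (fst c)"
  shows "openin (manifold_topology A) W \<longleftrightarrow>
    W \<subseteq> carrier_of A \<and> (\<forall>c\<in>A. open (snd c ` (W \<inter> fst c)))"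
proof -
  let ?L = "\<lambda>W. W \<subseteq> carrier_of A \<and> (\<forall>(V, \<phi>)\<in>A. open (\<phi> ` (W \<inter> V)))"
  have "istopology ?L"
    unfolding istopology_def
  proof (intro conjI allI impI)
    fix S T assume S: "?L S" and T: "?L T"
    have "open (\<phi> ` (S \<inter> T \<inter> V))" if "(V, \<phi>) \<in> A" for V \<phi>
    proof -
      have "inj_on \<phi> V" using assms[OF that] by simp
      then have "\<phi> ` (S \<inter> T \<inter> V) = \<phi> ` (S \<inter> V) \<inter> \<phi> ` (T \<inter> V)"
        by (auto simp: inj_on_def)
      then show ?thesis using S T that by (auto intro!: open_Int)
    qed
    then show "S \<inter> T \<subseteq> carrier_of A" "\<forall>(V, \<phi>)\<in>A. open (\<phi> ` (S \<inter> T \<inter> V))"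
      using S by auto
  next
    fix K assume K: "\<forall>S\<in>K. ?L S"
    have "open (\<phi> ` (\<Union>K \<inter> V))" if "(V, \<phi>) \<in> A" for V \<phi>
    proof -
      have "\<phi> ` (\<Union>K \<inter> V) = (\<Union>S\<in>K. \<phi> ` (S \<inter> V))" by blast
      then show ?thesis using K that by (auto intro!: open_UN)
    qed
    then show "\<Union>K \<subseteq> carrier_of A" "\<forall>(V, \<phi>)\<in>A. open (\<phi> ` (\<Union>K \<inter> V))"
      using K by auto
  qed
  then show ?thesis
    unfolding manifold_topology_def by (auto simp: topology_inverse')
qed

text \<open>Generalises \<open>from_chart\<close>, whose target is the preferred chart. With both
  charts free the maps obey a cocycle rule and involve no choice.\<close>

definition transition_deriv :: "('q, 'e::euclidean_space) chart \<Rightarrow> ('q, 'e) chart \<Rightarrow> 'q \<Rightarrow> 'e \<Rightarrow> 'e" where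
  "transition_deriv c c' q = frechet_derivative (snd c' \<circ> inv_into (fst c) (snd c)) (at (snd c q))"

lemma chart_at_in: "q \<in> carrier_of A \<Longrightarrow> chart_at A q \<in> A \<and> q \<in> fst (chart_at A q)"
  unfolding chart_at_def carrier_of_def by (rule someI_ex) auto

lemma from_chart_eq: "from_chart A c q = transition_deriv c (chart_at A q) q"
  by (simp add: from_chart_def transition_deriv_def coord_at_def split_def)

lemma smooth_intoD:
  assumes "smooth_into X A f" "x \<in> X" "c \<in> A" "f x \<in> fst c"
  obtains Y k where "open Y" "x \<in> Y" "smooth_on Y k"
    "\<And>y. y \<in> X \<Longrightarrow> y \<in> Y \<Longrightarrow> f y \<in> fst c" "\<And>y. y \<in> X \<Longrightarrow> y \<in> Y \<Longrightarrow> snd c (f y) = k y"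
proof -
  have "\<forall>(V, \<phi>)\<in>A. f x \<in> V \<longrightarrow> (\<exists>Y k. open Y \<and> x \<in> Y \<and> smooth_on Y k \<and>
      (\<forall>y\<in>X \<inter> Y. f y \<in> V \<and> \<phi> (f y) = k y))"
    using assms(1,2) unfolding smooth_into_def by blast
  from bspec[OF this assms(3)] assms(4)
  have "\<exists>Y k. open Y \<and> x \<in> Y \<and> smooth_on Y k \<and>
      (\<forall>y\<in>X \<inter> Y. f y \<in> fst c \<and> snd c (f y) = k y)"
    by (simp add: split_def)
  then show ?thesis
    using that by (elim exE conjE) simp
qed

lemma has_vector_derivative_compose:
  assumes "(g has_vector_derivative g') (at t)" "(f has_derivative f') (at (g t))"
  shows "((\<lambda>t. f (g t)) has_vector_derivative f' g') (at t)"
  using has_derivative_compose[OF assms(1)[unfolded has_vector_derivative_def] assms(2)]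
  by (simp add: has_vector_derivative_def linear_scale[OF has_derivative_linear[OF assms(2)]])

lemma has_vector_derivative_eventually:
  assumes "(f has_vector_derivative d) (at t)" "\<forall>\<^sub>F s in nhds t. f s = g s"
  shows "(g has_vector_derivative d) (at t)"
proof -
  have *: "\<forall>\<^sub>F s in at t. f s = g s" "f t = g t"
    using assms(2) eventually_nhds_x_imp_x[OF assms(2)]
    by (auto simp: eventually_at_filter elim: eventually_mono)
  show ?thesis
    using has_derivative_transform_eventually[OF assms(1)[unfolded has_vector_derivative_def] * UNIV_I]
    unfolding has_vector_derivative_def .
qed

lemma isCont_eventually_in:
  assumes "isCont f x" "open T" "f x \<in> T"
  shows "\<forall>\<^sub>F y in nhds x. f y \<in> T"
  using assms topological_tendstoD[of f "f x" "nhds x" T]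
  by (simp add: isCont_def tendsto_at_iff_tendsto_nhds)

lemma smooth_into_curve:
  assumes f: "smooth_into X A f" "c \<in> A" "f (\<Gamma> 0) \<in> fst c"
    and \<Gamma>: "\<forall>\<^sub>F t in nhds 0. \<Gamma> t \<in> X" "(\<Gamma> has_vector_derivative w) (at 0)"
  obtains v where "((\<lambda>t. snd c (f (\<Gamma> t))) has_vector_derivative v) (at 0)"
    "\<forall>\<^sub>F t in nhds 0. f (\<Gamma> t) \<in> fst c"
proof -
  have X: "\<Gamma> 0 \<in> X" using \<Gamma>(1) by (rule eventually_nhds_x_imp_x)
  obtain Y k where k: "open Y" "\<Gamma> 0 \<in> Y" "smooth_on Y k"
    "\<And>y. y \<in> X \<Longrightarrow> y \<in> Y \<Longrightarrow> f y \<in> fst c" "\<And>y. y \<in> X \<Longrightarrow> y \<in> Y \<Longrightarrow> snd c (f y) = k y"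
    using smooth_intoD[OF f(1) X f(2,3)] by blast
  have "isCont \<Gamma> 0" using \<Gamma>(2) by (rule has_vector_derivative_continuous)
  then have "\<forall>\<^sub>F t in nhds 0. \<Gamma> t \<in> Y"
    using k(1,2) by (rule isCont_eventually_in)
  with \<Gamma>(1) have ev: "\<forall>\<^sub>F t in nhds 0. \<Gamma> t \<in> X \<and> \<Gamma> t \<in> Y" by (rule eventually_conj)
  have "((\<lambda>t. k (\<Gamma> t)) has_vector_derivative frechet_derivative k (at (\<Gamma> 0)) w) (at 0)"
    by (rule has_vector_derivative_compose[OF \<Gamma>(2) smooth_on_has_derivative[OF k(3,2)]])
  then have "((\<lambda>t. snd c (f (\<Gamma> t))) has_vector_derivative frechet_derivative k (at (\<Gamma> 0)) w) (at 0)"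
    by (rule has_vector_derivative_eventually) (use ev k(5) in \<open>auto elim: eventually_mono\<close>)
  moreover have "\<forall>\<^sub>F t in nhds 0. f (\<Gamma> t) \<in> fst c"
    using ev by (rule eventually_mono) (use k(4) in auto)
  ultimately show ?thesis by (rule that)
qed

section \<open>Changes of chart\<close>

context
  fixes A :: "('q, 'e::euclidean_space) chart set"
  assumes A: "smooth_manifold A"
begin

lemma chart_inj: "c \<in> A \<Longrightarrow> inj_on (snd c) (fst c)"
  and chart_open: "c \<in> A \<Longrightarrow> open (snd c ` fst c)"
  and chart_overlap: "c \<in> A \<Longrightarrow> c' \<in> A \<Longrightarrow> open (snd c ` (fst c \<inter> fst c'))"
  and chart_transition: "c \<in> A \<Longrightarrow> c' \<in> A \<Longrightarrow>
    smooth_on (snd c ` (fst c \<inter> fst c')) (snd c' \<circ> inv_into (fst c) (snd c))"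
  using A unfolding smooth_manifold_def by (force simp: split_def)+

lemma chart_inv: "c \<in> A \<Longrightarrow> q \<in> fst c \<Longrightarrow> inv_into (fst c) (snd c) (snd c q) = q"
  by (simp add: chart_inj)

lemma transition_has_derivative:
  assumes "c \<in> A" "c' \<in> A" "q \<in> fst c" "q \<in> fst c'"
  shows "(snd c' \<circ> inv_into (fst c) (snd c) has_derivative transition_deriv c c' q) (at (snd c q))"
  unfolding transition_deriv_def
  by (rule smooth_on_has_derivative[OF chart_transition]) (use assms in auto)

lemma transition_curve:
  assumes c: "c \<in> A" "c' \<in> A" "\<gamma> t \<in> fst c" "\<gamma> t \<in> fst c'"
    and ev: "\<forall>\<^sub>F s in nhds t. \<gamma> s \<in> fst c"
    and d: "((\<lambda>s. snd c (\<gamma> s)) has_vector_derivative v) (at t)"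
  shows "((\<lambda>s. snd c' (\<gamma> s)) has_vector_derivative transition_deriv c c' (\<gamma> t) v) (at t)"
proof (rule has_vector_derivative_eventually)
  show "((\<lambda>s. (snd c' \<circ> inv_into (fst c) (snd c)) (snd c (\<gamma> s))) has_vector_derivative
      transition_deriv c c' (\<gamma> t) v) (at t)"
    by (rule has_vector_derivative_compose[OF d transition_has_derivative[OF c]])
  show "\<forall>\<^sub>F s in nhds t. (snd c' \<circ> inv_into (fst c) (snd c)) (snd c (\<gamma> s)) = snd c' (\<gamma> s)"
    using ev by (rule eventually_mono) (simp add: chart_inv c)
qed

text \<open>Both sides are the velocity in \<open>c''\<close> of one curve, the coordinate line of
  \<open>c\<close> in direction \<open>v\<close>, read directly or by way of
  \<open>c'\<close>.\<close>

lemma transition_deriv_cocycle: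
  assumes "c \<in> A" "c' \<in> A" "c'' \<in> A" "q \<in> fst c" "q \<in> fst c'" "q \<in> fst c''"
  shows "transition_deriv c' c'' q (transition_deriv c c' q v) = transition_deriv c c'' q v"
proof -
  let ?\<gamma> = "\<lambda>s. inv_into (fst c) (snd c) (snd c q + s *\<^sub>R v)"
  have 0: "?\<gamma> 0 = q" using assms by (simp add: chart_inv)
  have "isCont (\<lambda>s. snd c q + s *\<^sub>R v) 0" by (intro continuous_intros)
  moreover have "open (snd c ` (fst c \<inter> fst c'))" "snd c q + 0 *\<^sub>R v \<in> snd c ` (fst c \<inter> fst c')"
    using assms chart_overlap by auto
  ultimately have ev: "\<forall>\<^sub>F s in nhds 0. snd c q + s *\<^sub>R v \<in> snd c ` (fst c \<inter> fst c')"
    by (rule isCont_eventually_in)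
  have in_c: "\<forall>\<^sub>F s in nhds 0. ?\<gamma> s \<in> fst c" "\<forall>\<^sub>F s in nhds 0. ?\<gamma> s \<in> fst c'"
    using ev by (rule eventually_mono; auto simp: chart_inv assms)+
  have eq: "\<forall>\<^sub>F s in nhds 0. snd c q + s *\<^sub>R v = snd c (?\<gamma> s)"
    using ev by (rule eventually_mono) (auto simp: chart_inv assms)
  have "((\<lambda>s. snd c q + s *\<^sub>R v) has_vector_derivative v) (at 0)"
    by (auto intro!: derivative_eq_intros)
  from has_vector_derivative_eventually[OF this eq]
  have d: "((\<lambda>s. snd c (?\<gamma> s)) has_vector_derivative v) (at 0)" .
  have d': "((\<lambda>s. snd c' (?\<gamma> s)) has_vector_derivative transition_deriv c c' q v) (at 0)"
    using transition_curve[OF assms(1,2) _ _ in_c(1) d] assms by (simp add: chart_inv)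
  have "((\<lambda>s. snd c'' (?\<gamma> s)) has_vector_derivative transition_deriv c c'' q v) (at 0)"
    using transition_curve[OF assms(1,3) _ _ in_c(1) d] assms by (simp add: chart_inv)
  moreover have "((\<lambda>s. snd c'' (?\<gamma> s)) has_vector_derivative
      transition_deriv c' c'' q (transition_deriv c c' q v)) (at 0)"
    using transition_curve[OF assms(2,3) _ _ in_c(2) d'] assms by (simp add: chart_inv)
  ultimately show ?thesis by (rule vector_derivative_unique_at[rotated])
qed

lemma transition_deriv_refl:
  assumes "c \<in> A" "q \<in> fst c"
  shows "transition_deriv c c q v = v"
proof -
  have "transition_deriv c c q = (\<lambda>v. v)"
  proof (rule has_derivative_unique)
    show "(snd c \<circ> inv_into (fst c) (snd c) has_derivative transition_deriv c c q) (at (snd c q))"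
      using assms by (intro transition_has_derivative)
    show "(snd c \<circ> inv_into (fst c) (snd c) has_derivative (\<lambda>v. v)) (at (snd c q))"
      by (rule has_derivative_transform_within_open[OF has_derivative_ident chart_open[OF assms(1)]])
        (use assms in \<open>auto simp: chart_inv\<close>)
  qed
  then show ?thesis by simp
qed

lemma linear_transition_deriv:
  "c \<in> A \<Longrightarrow> c' \<in> A \<Longrightarrow> q \<in> fst c \<Longrightarrow> q \<in> fst c' \<Longrightarrow> linear (transition_deriv c c' q)"
  using transition_has_derivative has_derivative_linear by blast

lemma transition_deriv_inverse:
  assumes "c \<in> A" "c' \<in> A" "q \<in> fst c" "q \<in> fst c'"
  shows "transition_deriv c' c q (transition_deriv c c' q v) = v"
  using transition_deriv_cocycle[OF assms(1,2,1,3,4,3)] transition_deriv_refl[OF assms(1,3)] by simp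

lemma carrier_ofI: "c \<in> A \<Longrightarrow> q \<in> fst c \<Longrightarrow> q \<in> carrier_of A"
  by (auto simp: carrier_of_def)

lemma velocity_eq:
  assumes "c \<in> A" "\<forall>\<^sub>F t in nhds 0. \<gamma> t \<in> fst c"
    "((\<lambda>t. snd c (\<gamma> t)) has_vector_derivative v) (at 0)"
  shows "velocity A \<gamma> = from_chart A c (\<gamma> 0) v"
proof -
  have \<gamma>0: "\<gamma> 0 \<in> fst c" using assms(2) by (rule eventually_nhds_x_imp_x)
  have c': "chart_at A (\<gamma> 0) \<in> A" "\<gamma> 0 \<in> fst (chart_at A (\<gamma> 0))"
    using chart_at_in[OF carrier_ofI[OF assms(1) \<gamma>0]] by auto
  show ?thesis
    using transition_curve[OF assms(1) c'(1) \<gamma>0 c'(2) assms(2,3)]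
    by (simp add: velocity_def from_chart_eq coord_at_def o_def vector_derivative_at)
qed

lemma cotangent_chart_inj:
  assumes "c \<in> A"
  shows "inj_on (snd (cotangent_chart A c)) (fst (cotangent_chart A c))"
proof (rule inj_onI)
  fix x y assume x: "x \<in> fst (cotangent_chart A c)" and y: "y \<in> fst (cotangent_chart A c)"
    and eq: "snd (cotangent_chart A c) x = snd (cotangent_chart A c) y"
  obtain q p where qp: "x = (q, p)" "q \<in> fst c"
    using x by (auto simp: cotangent_chart_def)
  have "fst y = q"
    using eq y qp inj_onD[OF chart_inj[OF assms], of "fst y" q]
    by (auto simp: cotangent_chart_def)
  then obtain p' where p': "y = (q, p')" by (cases y) auto
  have c': "chart_at A q \<in> A" "q \<in> fst (chart_at A q)"
    using chart_at_in[OF carrier_ofI[OF assms qp(2)]] by auto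
  let ?B = "from_chart A c q"
  have lin: "linear ?B"
    unfolding from_chart_eq by (rule linear_transition_deriv[OF assms c'(1) qp(2) c'(2)])
  have "adjoint ?B p = adjoint ?B p'"
    using eq by (simp add: qp p' cotangent_chart_def)
  then have "p \<bullet> ?B w = p' \<bullet> ?B w" for w
    by (metis adjoint_works[OF lin] inner_commute)
  \<comment> \<open>Every \<open>w\<close> is in the range of \<open>?B\<close>, the opposite
    transition being a right inverse.\<close>
  from this[of "transition_deriv (chart_at A q) c q _"]
  have "p \<bullet> w = p' \<bullet> w" for w
    unfolding from_chart_eq using transition_deriv_inverse[OF c'(1) assms c'(2) qp(2)] by metis
  then have "p = p'" by (metis vector_eq_rdot)
  then show "x = y" by (simp add: qp p')
qed

end

subsection \<open>Slice charts and covectors\<close>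

lemma orthogonal_projection_exists:
  fixes N :: "'e::euclidean_space set"
  assumes "subspace N"
  shows "\<exists>\<pi>. linear \<pi> \<and> (\<forall>x. \<pi> x \<in> N) \<and> (\<forall>x\<in>N. \<pi> x = x) \<and> (\<forall>x y. \<pi> x \<bullet> y = x \<bullet> \<pi> y)"
proof -
  obtain B where B: "B \<subseteq> N" "pairwise orthogonal B" "\<And>x. x \<in> B \<Longrightarrow> norm x = 1"
    "independent B" "span B = N"
    using orthonormal_basis_subspace[OF assms] by metis
  define \<pi> where "\<pi> x = (\<Sum>b\<in>B. (x \<bullet> b) *\<^sub>R b)" for x
  have fin: "finite B" by (rule independent_imp_finite[OF B(4)])
  have lin: "linear \<pi>"
    by (rule linearI)
      (simp_all add: \<pi>_def inner_add_left scaleR_add_left sum.distrib scaleR_sum_right)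
  have "\<pi> b = b" if "b \<in> B" for b
  proof -
    have "(b \<bullet> b') *\<^sub>R b' = (if b' = b then b else 0)" if "b' \<in> B" for b'
      using B(2,3) \<open>b \<in> B\<close> that by (auto simp: pairwise_def orthogonal_def norm_eq_1)
    then show ?thesis
      unfolding \<pi>_def using fin that by (simp add: sum.delta)
  qed
  then have "\<pi> x = x" if "x \<in> N" for x
    using linear_eq_on_span[OF lin linear_id, of B x] that B(5) by simp
  moreover have "\<pi> x \<in> N" for x
    unfolding \<pi>_def using B(1) assms by (intro subspace_sum subspace_scale) auto
  moreover have "\<pi> x \<bullet> y = x \<bullet> \<pi> y" for x y
    by (simp add: \<pi>_def inner_sum_left inner_sum_right inner_commute mult.commute)
  ultimately show ?thesis using lin by blast
qed

text \<open>Base point and argument both move. Expanding \<open>U t\<close> in \<open>Basis\<close>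
  reduces the claim to derivatives in fixed directions.\<close>

lemma second_derivative_curve:
  fixes k :: "'a::euclidean_space \<Rightarrow> 'b::euclidean_space"
  assumes k: "open Y" "smooth_on Y k" "\<Gamma> 0 \<in> Y"
    and \<Gamma>: "(\<Gamma> has_vector_derivative w) (at 0)" and U: "(U has_vector_derivative U') (at 0)"
  shows "((\<lambda>t. frechet_derivative k (at (\<Gamma> t)) (U t)) has_vector_derivative
    frechet_derivative (\<lambda>y. frechet_derivative k (at y) (U 0)) (at (\<Gamma> 0)) w
    + frechet_derivative k (at (\<Gamma> 0)) U') (at 0)"
proof -
  let ?H = "\<lambda>b. frechet_derivative (\<lambda>y. frechet_derivative k (at y) b) (at (\<Gamma> 0))"
  have lin_k: "linear (frechet_derivative k (at y))" if "y \<in> Y" for y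
    using smooth_on_has_derivative[OF k(2) that] has_derivative_linear by blast
  have lin_H: "linear (?H b)" for b
    using smooth_on_has_derivative[OF smooth_on_frechet[OF k(2)] k(3)] has_derivative_linear by blast
  \<comment> \<open>Linearity of \<open>?H\<close> in its first argument is not visible from its
    form; symmetry of second derivatives moves that argument to the place where linearity is
    known.\<close>
  have expand_H: "?H v w = (\<Sum>b\<in>Basis. (v \<bullet> b) *\<^sub>R ?H b w)" for v
  proof -
    have "?H v w = ?H w v"
      by (rule second_derivative_symmetric[OF k])
    also have "\<dots> = (\<Sum>b\<in>Basis. (v \<bullet> b) *\<^sub>R ?H w b)"
      by (rule linear_euclidean_expand[OF lin_H])
    also have "\<dots> = (\<Sum>b\<in>Basis. (v \<bullet> b) *\<^sub>R ?H b w)"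
      by (intro sum.cong refl arg_cong[of _ _ "scaleR _"] second_derivative_symmetric[OF k])
    finally show ?thesis .
  qed
  have "((\<lambda>t. \<Sum>b\<in>Basis. (U t \<bullet> b) *\<^sub>R frechet_derivative k (at (\<Gamma> t)) b) has_vector_derivative
      (\<Sum>b\<in>Basis. (U 0 \<bullet> b) *\<^sub>R ?H b w + (U' \<bullet> b) *\<^sub>R frechet_derivative k (at (\<Gamma> 0)) b)) (at 0)"
    by (intro has_vector_derivative_sum
        bounded_bilinear.has_vector_derivative[OF bounded_bilinear_scaleR]
        bounded_linear.has_vector_derivative[OF bounded_linear_inner_left U]
        has_vector_derivative_compose[OF \<Gamma> smooth_on_has_derivative[OF smooth_on_frechet[OF k(2)] k(3)]])
  also have "(\<Sum>b\<in>Basis. (U 0 \<bullet> b) *\<^sub>R ?H b w + (U' \<bullet> b) *\<^sub>R frechet_derivative k (at (\<Gamma> 0)) b)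
      = ?H (U 0) w + frechet_derivative k (at (\<Gamma> 0)) U'"
    unfolding expand_H[of "U 0"] linear_euclidean_expand[OF lin_k[OF k(3)], of U'] sum.distrib ..
  finally show ?thesis
  proof (rule has_vector_derivative_eventually)
    have "\<forall>\<^sub>F t in nhds 0. \<Gamma> t \<in> Y"
      by (rule isCont_eventually_in[OF has_vector_derivative_continuous[OF \<Gamma>] k(1,3)])
    then show "\<forall>\<^sub>F t in nhds 0. (\<Sum>b\<in>Basis. (U t \<bullet> b) *\<^sub>R frechet_derivative k (at (\<Gamma> t)) b)
        = frechet_derivative k (at (\<Gamma> t)) (U t)"
      by (rule eventually_mono) (rule linear_euclidean_expand[OF lin_k, symmetric])
  qed
qed

lemma lt_curve_0 [simp]: "lt_curve z u 0 = z"
  using mat_exp_0[of "fst u"] by (simp add: lt_curve_def split_def)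

lemma lt_curve_has_vector_derivative:
  "(lt_curve z u has_vector_derivative (fst z ** hat (fst u), snd u)) (at 0)"
proof -
  have "((\<lambda>t. fst z ** mat_exp (t *\<^sub>R hat (fst u))) has_vector_derivative fst z ** hat (fst u)) (at 0)"
    by (rule bounded_linear.has_vector_derivative[OF
          bounded_bilinear.bounded_linear_right[OF bounded_bilinear_matrix_mult]
          mat_exp_has_vector_derivative])
  moreover have "((\<lambda>t. snd z + t *\<^sub>R snd u) has_vector_derivative snd u) (at 0)"
    by (auto intro!: derivative_eq_intros)
  ultimately have "((\<lambda>t. (fst z ** mat_exp (t *\<^sub>R hat (fst u)), snd z + t *\<^sub>R snd u))
      has_vector_derivative (fst z ** hat (fst u), snd u)) (at 0)"
    by (rule has_vector_derivative_Pair)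
  then show ?thesis
    by (simp add: lt_curve_def split_def)
qed

lemma openin_subspace_line:
  fixes N :: "'e::euclidean_space set"
  assumes "subspace N" "openin (top_of_set N) S" "s \<in> S" "v \<in> N"
  shows "\<forall>\<^sub>F t in nhds 0. s + t *\<^sub>R v \<in> S"
proof -
  obtain T where T: "open T" "S = N \<inter> T"
    using assms(2) by (auto simp: openin_open)
  have "isCont (\<lambda>t. s + t *\<^sub>R v) 0" by (intro continuous_intros)
  from isCont_eventually_in[OF this T(1)] have "\<forall>\<^sub>F t in nhds 0. s + t *\<^sub>R v \<in> T"
    using assms(3) T(2) by simp
  then show ?thesis
    using assms T(2) by (auto elim!: eventually_mono simp: subspace_add subspace_scale)
qed

text \<open>Isolates the properties of \<tau> on which smoothness and the symplectic form rest; the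
  action and the geodesics enter with equivariance.\<close>

locale slice_diffeo =
  fixes A :: "('q, 'e::euclidean_space) chart set" and N S :: "'e set"
    and \<tau> :: "(real^3^3) \<times> 'e \<Rightarrow> 'q"
  assumes A: "smooth_manifold A" and N: "subspace N" and S: "openin (top_of_set N) S"
    and diffeo: "diffeo_onto_open (SO3 \<times> S) A \<tau>"
begin

text \<open>\<open>S\<close> is known to be open in \<open>N\<close> only, whereas sums over
  \<open>Basis\<close> and smoothness refer to the ambient space. The projection brings ambient
  directions into \<open>N\<close> and, being self-adjoint, does the same for covectors.\<close>

definition proj :: "'e \<Rightarrow> 'e" where
  "proj = (SOME \<pi>. linear \<pi> \<and> (\<forall>x. \<pi> x \<in> N) \<and> (\<forall>x\<in>N. \<pi> x = x) \<and> (\<forall>x y. \<pi> x \<bullet> y = x \<bullet> \<pi> y))"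

lemma linear_proj: "linear proj" and proj_in: "proj x \<in> N" and proj_id: "x \<in> N \<Longrightarrow> proj x = x"
  and proj_adjoint: "proj x \<bullet> y = x \<bullet> proj y"
  using someI_ex[OF orthogonal_projection_exists[OF N]] unfolding proj_def by blast+

definition slice_coord :: "('q, 'e) chart \<Rightarrow> 'e \<Rightarrow> (real^3^3) \<times> 'e" where
  "slice_coord c = inv_into (SO3 \<times> S) \<tau> \<circ> inv_into (fst c) (snd c)"

definition slice_dom :: "('q, 'e) chart \<Rightarrow> 'e set" where
  "slice_dom c = snd c ` (\<tau> ` (SO3 \<times> S) \<inter> fst c)"

text \<open>The left-trivialised derivative of the inverse of \<tau>, read in the chart
  \<open>c\<close>; \<open>of_slice\<close> is that of \<tau> itself.\<close>

definition to_slice :: "('q, 'e) chart \<Rightarrow> 'e \<Rightarrow> 'e \<Rightarrow> (real^3) \<times> 'e" where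
  "to_slice c y w = (let d = frechet_derivative (slice_coord c) (at y) w
     in (vee (transpose (fst (slice_coord c y)) ** fst d), snd d))"

text \<open>Defined through a curve: the domain \<open>SO3 \<times> S\<close> of \<tau> is not open,
  so there is no Frechet derivative to use.\<close>

definition of_slice :: "('q, 'e) chart \<Rightarrow> (real^3^3) \<times> 'e \<Rightarrow> (real^3) \<times> 'e \<Rightarrow> 'e" where
  "of_slice c z u = vector_derivative (\<lambda>t. snd c (\<tau> (lt_curve z u t))) (at 0)"

lemma S_subset: "S \<subseteq> N"
  using S by (simp add: openin_imp_subset)

lemma inj_\<tau>: "inj_on \<tau> (SO3 \<times> S)" and smooth_\<tau>: "smooth_into (SO3 \<times> S) A \<tau>"
  using diffeo by (auto simp: diffeo_onto_open_def)

lemma open_slice_dom: "c \<in> A \<Longrightarrow> open (slice_dom c)"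
  using diffeo openin_manifold_topology[of A, OF chart_inj[OF A]]
  unfolding diffeo_onto_open_def slice_dom_def by blast

lemma smooth_slice_coord: "c \<in> A \<Longrightarrow> smooth_on (slice_dom c) (slice_coord c)"
  using diffeo unfolding diffeo_onto_open_def smooth_from_def slice_dom_def slice_coord_def
  by (auto simp: split_def Int_commute)

lemma slice_coord:
  assumes "c \<in> A" "y \<in> slice_dom c"
  shows "slice_coord c y \<in> SO3 \<times> S" "\<tau> (slice_coord c y) \<in> fst c" "snd c (\<tau> (slice_coord c y)) = y"
proof -
  obtain z where z: "z \<in> SO3 \<times> S" "\<tau> z \<in> fst c" "y = snd c (\<tau> z)"
    using assms(2) by (auto simp: slice_dom_def)
  have "slice_coord c y = z"
    using z inj_\<tau> by (simp add: slice_coord_def chart_inv[OF A assms(1)])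
  with z show "slice_coord c y \<in> SO3 \<times> S" "\<tau> (slice_coord c y) \<in> fst c"
    "snd c (\<tau> (slice_coord c y)) = y" by auto
qed

lemma slice_dom:
  assumes "c \<in> A" "z \<in> SO3 \<times> S" "\<tau> z \<in> fst c"
  shows "snd c (\<tau> z) \<in> slice_dom c" "slice_coord c (snd c (\<tau> z)) = z"
  using assms inj_\<tau> by (auto simp: slice_dom_def slice_coord_def chart_inv[OF A assms(1)])

lemma lt_curve_in:
  assumes "z \<in> SO3 \<times> S" "snd u \<in> N"
  shows "\<forall>\<^sub>F t in nhds 0. lt_curve z u t \<in> SO3 \<times> S"
  using openin_subspace_line[OF N S, of "snd z" "snd u"] assms
  by (auto simp: lt_curve_def split_def SO3_mult mat_exp_SO3 elim: eventually_mono)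

text \<open>The group part is an instance of \<open>SO3_curve_derivative\<close>. The vector part is
  fixed by \<open>proj\<close> along the curve, hence so is its derivative.\<close>

lemma curve_tangent:
  assumes \<Gamma>: "(\<Gamma> has_vector_derivative d) (at 0)" "\<forall>\<^sub>F t in nhds 0. \<Gamma> t \<in> SO3 \<times> S"
  shows "d = (fst (\<Gamma> 0) ** hat (vee (transpose (fst (\<Gamma> 0)) ** fst d)), snd d)" "snd d \<in> N"
proof -
  have R: "((\<lambda>t. fst (\<Gamma> t)) has_vector_derivative fst d) (at 0)"
    and s: "((\<lambda>t. snd (\<Gamma> t)) has_vector_derivative snd d) (at 0)"
    by (intro bounded_linear.has_vector_derivative[OF bounded_linear_fst]
        bounded_linear.has_vector_derivative[OF bounded_linear_snd] \<Gamma>)+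
  have ev: "\<forall>\<^sub>F t in nhds 0. fst (\<Gamma> t) \<in> SO3" "\<forall>\<^sub>F t in nhds 0. proj (snd (\<Gamma> t)) = snd (\<Gamma> t)"
    using \<Gamma>(2) S_subset proj_id by (auto elim!: eventually_mono)
  have "fst d = fst (\<Gamma> 0) ** hat (vee (transpose (fst (\<Gamma> 0)) ** fst d))"
    using ev(1) eventually_nhds_x_imp_x[OF ev(1)]
    by (intro SO3_curve_derivative[OF R]) (auto simp: eventually_at_filter elim: eventually_mono)
  then show "d = (fst (\<Gamma> 0) ** hat (vee (transpose (fst (\<Gamma> 0)) ** fst d)), snd d)"
    by (cases d) simp
  have "((\<lambda>t. proj (snd (\<Gamma> t))) has_vector_derivative proj (snd d)) (at 0)"
    by (intro bounded_linear.has_vector_derivative[OF _ s])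
      (simp add: linear_proj flip: linear_conv_bounded_linear)
  from has_vector_derivative_eventually[OF this ev(2)]
  have "proj (snd d) = snd d" using s by (rule vector_derivative_unique_at)
  then show "snd d \<in> N" by (metis proj_in)
qed

lemma chart_ext:
  assumes "c \<in> A" "z \<in> SO3 \<times> S" "\<tau> z \<in> fst c"
  obtains Y k where "open Y" "z \<in> Y" "smooth_on Y k"
    "\<And>y. y \<in> SO3 \<times> S \<Longrightarrow> y \<in> Y \<Longrightarrow> \<tau> y \<in> fst c \<and> snd c (\<tau> y) = k y"
  using smooth_intoD[OF smooth_\<tau> assms(2,1,3)] by metis

lemma chart_curve:
  assumes c: "c \<in> A" and ext: "open Y" "smooth_on Y k"
    "\<And>y. y \<in> SO3 \<times> S \<Longrightarrow> y \<in> Y \<Longrightarrow> \<tau> y \<in> fst c \<and> snd c (\<tau> y) = k y"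
    and \<Gamma>: "(\<Gamma> has_vector_derivative d) (at 0)" "\<forall>\<^sub>F t in nhds 0. \<Gamma> t \<in> SO3 \<times> S" "\<Gamma> 0 \<in> Y"
  shows "((\<lambda>t. snd c (\<tau> (\<Gamma> t))) has_vector_derivative frechet_derivative k (at (\<Gamma> 0)) d) (at 0)"
    and "\<forall>\<^sub>F t in nhds 0. \<Gamma> t \<in> SO3 \<times> S \<and> \<Gamma> t \<in> Y \<and> \<tau> (\<Gamma> t) \<in> fst c"
proof -
  have "\<forall>\<^sub>F t in nhds 0. \<Gamma> t \<in> Y"
    by (rule isCont_eventually_in[OF has_vector_derivative_continuous[OF \<Gamma>(1)] ext(1) \<Gamma>(3)])
  with \<Gamma>(2) have ev: "\<forall>\<^sub>F t in nhds 0. \<Gamma> t \<in> SO3 \<times> S \<and> \<Gamma> t \<in> Y" by (rule eventually_conj)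
  then show "\<forall>\<^sub>F t in nhds 0. \<Gamma> t \<in> SO3 \<times> S \<and> \<Gamma> t \<in> Y \<and> \<tau> (\<Gamma> t) \<in> fst c"
    by (rule eventually_mono) (simp add: ext(3))
  have "((\<lambda>t. k (\<Gamma> t)) has_vector_derivative frechet_derivative k (at (\<Gamma> 0)) d) (at 0)"
    by (rule has_vector_derivative_compose[OF \<Gamma>(1) smooth_on_has_derivative[OF ext(2) \<Gamma>(3)]])
  then show "((\<lambda>t. snd c (\<tau> (\<Gamma> t))) has_vector_derivative frechet_derivative k (at (\<Gamma> 0)) d) (at 0)"
    by (rule has_vector_derivative_eventually) (rule eventually_mono[OF ev], simp add: ext(3))
qed

text \<open>A local extension \<open>k\<close> of \<tau> in the chart is not unique, but on vectors
  tangent to \<open>SO3 \<times> S\<close> its derivative is, being the velocity of a curve that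
  stays there.\<close>

lemma of_slice_eq:
  assumes "c \<in> A" "z \<in> SO3 \<times> S" "snd u \<in> N" and ext: "open Y" "z \<in> Y" "smooth_on Y k"
    "\<And>y. y \<in> SO3 \<times> S \<Longrightarrow> y \<in> Y \<Longrightarrow> \<tau> y \<in> fst c \<and> snd c (\<tau> y) = k y"
  shows "of_slice c z u = frechet_derivative k (at z) (fst z ** hat (fst u), snd u)"
  unfolding of_slice_def
  by (rule vector_derivative_at)
    (use chart_curve(1)[OF assms(1) ext(1,3,4) lt_curve_has_vector_derivative
        lt_curve_in[OF assms(2,3)]] ext(2) in simp)

lemma of_slice_curve:
  assumes "c \<in> A" "z \<in> SO3 \<times> S" "\<tau> z \<in> fst c"
    and \<Gamma>: "(\<Gamma> has_vector_derivative (fst z ** hat (fst u), snd u)) (at 0)"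
      "\<forall>\<^sub>F t in nhds 0. \<Gamma> t \<in> SO3 \<times> S" "\<Gamma> 0 = z" "snd u \<in> N"
  shows "((\<lambda>t. snd c (\<tau> (\<Gamma> t))) has_vector_derivative of_slice c z u) (at 0)"
    "\<forall>\<^sub>F t in nhds 0. \<tau> (\<Gamma> t) \<in> fst c"
proof -
  obtain Y k where ext: "open Y" "z \<in> Y" "smooth_on Y k"
    "\<And>y. y \<in> SO3 \<times> S \<Longrightarrow> y \<in> Y \<Longrightarrow> \<tau> y \<in> fst c \<and> snd c (\<tau> y) = k y"
    using chart_ext[OF assms(1-3)] by blast
  note * = chart_curve[OF assms(1) ext(1,3,4) \<Gamma>(1,2)]
  show "((\<lambda>t. snd c (\<tau> (\<Gamma> t))) has_vector_derivative of_slice c z u) (at 0)"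
    using *(1) \<Gamma>(3) ext(2) by (simp only: of_slice_eq[OF assms(1,2) \<Gamma>(4) ext])
  show "\<forall>\<^sub>F t in nhds 0. \<tau> (\<Gamma> t) \<in> fst c"
    using *(2) \<Gamma>(3) ext(2) by (auto elim: eventually_mono)
qed

lemma slice_coord_deriv:
  assumes "c \<in> A" "y \<in> slice_dom c"
  shows "frechet_derivative (slice_coord c) (at y) w
      = (fst (slice_coord c y) ** hat (fst (to_slice c y w)), snd (to_slice c y w))"
    and "snd (to_slice c y w) \<in> N"
    and "((\<lambda>t. slice_coord c (y + t *\<^sub>R w)) has_vector_derivative
      frechet_derivative (slice_coord c) (at y) w) (at 0)"
    and "\<forall>\<^sub>F t in nhds 0. y + t *\<^sub>R w \<in> slice_dom c"
proof -
  have line: "((\<lambda>t. y + t *\<^sub>R w) has_vector_derivative w) (at 0)"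
    by (auto intro!: derivative_eq_intros)
  show d: "((\<lambda>t. slice_coord c (y + t *\<^sub>R w)) has_vector_derivative
      frechet_derivative (slice_coord c) (at y) w) (at 0)"
    using has_vector_derivative_compose[OF line] smooth_on_has_derivative[OF smooth_slice_coord[OF assms(1)] assms(2)]
    by simp
  show ev: "\<forall>\<^sub>F t in nhds 0. y + t *\<^sub>R w \<in> slice_dom c"
    by (rule isCont_eventually_in[OF has_vector_derivative_continuous[OF line] open_slice_dom[OF assms(1)]])
      (simp add: assms)
  then have "\<forall>\<^sub>F t in nhds 0. slice_coord c (y + t *\<^sub>R w) \<in> SO3 \<times> S"
    by (rule eventually_mono) (rule slice_coord[OF assms(1)])
  from curve_tangent[OF d this]
  show "frechet_derivative (slice_coord c) (at y) w
      = (fst (slice_coord c y) ** hat (fst (to_slice c y w)), snd (to_slice c y w))"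
    and "snd (to_slice c y w) \<in> N"
    by (simp_all add: to_slice_def Let_def)
qed

lemma linear_to_slice:
  assumes "c \<in> A" "y \<in> slice_dom c"
  shows "linear (to_slice c y)"
proof -
  have "linear (frechet_derivative (slice_coord c) (at y))"
    using smooth_on_has_derivative[OF smooth_slice_coord[OF assms(1)] assms(2)] has_derivative_linear by blast
  then show ?thesis
    by (auto intro!: linearI simp: to_slice_def Let_def linear_add linear_scale
        linear_add[OF linear_vee] linear_scale[OF linear_vee] matrix_add_ldistrib
        bounded_bilinear.scaleR_right[OF bounded_bilinear_matrix_mult])
qed

text \<open>\<open>slice_coord\<close> takes the image of \<open>lt_curve\<close> under \<tau> back
  to \<open>lt_curve\<close>; the two velocities at 0 are compared. The converse composition is
  treated in the same way with a coordinate line.\<close>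

lemma to_of_slice:
  assumes "c \<in> A" "z \<in> SO3 \<times> S" "\<tau> z \<in> fst c" "snd u \<in> N"
  shows "to_slice c (snd c (\<tau> z)) (of_slice c z u) = u"
proof -
  let ?y = "snd c (\<tau> z)"
  have y: "?y \<in> slice_dom c" "slice_coord c ?y = z" by (rule slice_dom[OF assms(1-3)])+
  have ev: "\<forall>\<^sub>F t in nhds 0. lt_curve z u t \<in> SO3 \<times> S" by (rule lt_curve_in[OF assms(2,4)])
  note d = of_slice_curve[OF assms(1-3) lt_curve_has_vector_derivative ev lt_curve_0 assms(4)]
  have "((\<lambda>t. slice_coord c (snd c (\<tau> (lt_curve z u t)))) has_vector_derivative
      frechet_derivative (slice_coord c) (at ?y) (of_slice c z u)) (at 0)"
    using has_vector_derivative_compose[OF d(1)]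
      smooth_on_has_derivative[OF smooth_slice_coord[OF assms(1)] y(1)] by simp
  moreover have "\<forall>\<^sub>F t in nhds 0. slice_coord c (snd c (\<tau> (lt_curve z u t))) = lt_curve z u t"
    using eventually_conj[OF ev d(2)] by (rule eventually_mono) (simp add: slice_dom[OF assms(1)])
  ultimately have "(lt_curve z u has_vector_derivative
      frechet_derivative (slice_coord c) (at ?y) (of_slice c z u)) (at 0)"
    by (rule has_vector_derivative_eventually)
  from vector_derivative_unique_at[OF this lt_curve_has_vector_derivative]
  show ?thesis
    using assms(2) by (auto simp: to_slice_def y SO3_cancel)
qed

lemma of_to_slice:
  assumes "c \<in> A" "y \<in> slice_dom c"
  shows "of_slice c (slice_coord c y) (to_slice c y w) = w"
proof -
  let ?\<Gamma> = "\<lambda>t. slice_coord c (y + t *\<^sub>R w)"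
  note z = slice_coord[OF assms] and d = slice_coord_deriv[OF assms, of w]
  have "\<forall>\<^sub>F t in nhds 0. ?\<Gamma> t \<in> SO3 \<times> S"
    using d(4) by (rule eventually_mono) (rule slice_coord[OF assms(1)])
  from of_slice_curve(1)[OF assms(1) z(1,2) d(3)[unfolded d(1)] this _ d(2)]
  have "((\<lambda>t. snd c (\<tau> (?\<Gamma> t))) has_vector_derivative of_slice c (slice_coord c y) (to_slice c y w)) (at 0)"
    by simp
  moreover have "\<forall>\<^sub>F t in nhds 0. snd c (\<tau> (?\<Gamma> t)) = y + t *\<^sub>R w"
    using d(4) by (rule eventually_mono) (rule slice_coord[OF assms(1)])
  ultimately have "((\<lambda>t. y + t *\<^sub>R w) has_vector_derivative
      of_slice c (slice_coord c y) (to_slice c y w)) (at 0)"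
    by (rule has_vector_derivative_eventually)
  moreover have "((\<lambda>t. y + t *\<^sub>R w) has_vector_derivative w) (at 0)"
    by (auto intro!: derivative_eq_intros)
  ultimately show ?thesis by (rule vector_derivative_unique_at)
qed

lemma lt_tangent_map_eq:
  assumes "c \<in> A" "z \<in> SO3 \<times> S" "\<tau> z \<in> fst c" "snd u \<in> N"
  shows "lt_tangent_map A \<tau> z u = from_chart A c (\<tau> z) (of_slice c z u)"
proof -
  note d = of_slice_curve[OF assms(1-3) lt_curve_has_vector_derivative
      lt_curve_in[OF assms(2,4)] lt_curve_0 assms(4)]
  have "velocity A (\<lambda>t. \<tau> (lt_curve z u t)) = from_chart A c (\<tau> (lt_curve z u 0)) (of_slice c z u)"
    by (rule velocity_eq[OF A assms(1) d(2,1)])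
  then show ?thesis
    by (simp add: lt_tangent_map_def o_def)
qed

section \<open>Covectors in slice coordinates\<close>

definition covector :: "('q, 'e) chart \<Rightarrow> 'e \<Rightarrow> (real^3) \<times> 'e \<Rightarrow> 'e" where
  "covector c y = adjoint (to_slice c y)"

lemma covector_inner: "c \<in> A \<Longrightarrow> y \<in> slice_dom c \<Longrightarrow> covector c y \<alpha> \<bullet> w = \<alpha> \<bullet> to_slice c y w"
  unfolding covector_def by (simp add: adjoint_clauses(2)[OF linear_to_slice])

text \<open>The tangent map of \<tau> is a bijection from \<open>UNIV \<times> N\<close>, with
  inverse \<open>to_slice\<close> after a change of chart. So the description in
  \<open>cotangent_lift_inverse\<close> has a unique solution, and over any chart \<open>c\<close>
  around the point its canonical coordinates are given by \<open>covector\<close>.\<close>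

lemma cotangent_lift_inverse_eq:
  assumes c: "c \<in> A" and z: "z \<in> SO3 \<times> S" "\<tau> z \<in> fst c"
  obtains p where "cotangent_lift_inverse A N \<tau> (z, \<alpha>) = (\<tau> z, p)"
    "\<And>w. p \<bullet> w = \<alpha> \<bullet> inv_into (UNIV \<times> N) (lt_tangent_map A \<tau> z) w"
    "\<And>u. snd u \<in> N \<Longrightarrow> inv_into (UNIV \<times> N) (lt_tangent_map A \<tau> z) (lt_tangent_map A \<tau> z u) = u"
    "\<And>w. \<exists>u\<in>UNIV \<times> N. lt_tangent_map A \<tau> z u = w"
    "snd (cotangent_chart A c) (\<tau> z, p) = (snd c (\<tau> z), covector c (snd c (\<tau> z)) \<alpha>)"
proof -
  let ?y = "snd c (\<tau> z)" and ?L = "lt_tangent_map A \<tau> z" and ?B = "from_chart A c (\<tau> z)"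
  let ?c' = "chart_at A (\<tau> z)"
  let ?B' = "transition_deriv ?c' c (\<tau> z)"
  have y: "?y \<in> slice_dom c" "slice_coord c ?y = z" by (rule slice_dom[OF c z])+
  have c': "?c' \<in> A" "\<tau> z \<in> fst ?c'"
    using chart_at_in[OF carrier_ofI[OF A c z(2)]] by auto
  have B': "?B (?B' w) = w" "?B' (?B w) = w" for w
    unfolding from_chart_eq
    by (rule transition_deriv_inverse[OF A c'(1) c c'(2) z(2)]
        transition_deriv_inverse[OF A c c'(1) z(2) c'(2)])+
  have linB: "linear ?B" and linB': "linear ?B'"
    unfolding from_chart_eq
    by (rule linear_transition_deriv[OF A c c'(1) z(2) c'(2)]
        linear_transition_deriv[OF A c'(1) c c'(2) z(2)])+
  have L: "?L u = ?B (of_slice c z u)" if "snd u \<in> N" for u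
    by (rule lt_tangent_map_eq[OF c z that])
  have left: "to_slice c ?y (?B' (?L u)) = u" if "snd u \<in> N" for u
    by (simp add: L[OF that] B' to_of_slice[OF c z that])
  have right: "?L (to_slice c ?y (?B' w)) = w" for w
    using of_to_slice[OF c y(1)] by (simp add: L slice_coord_deriv(2)[OF c y(1)] y(2) B')
  have inj: "inj_on ?L (UNIV \<times> N)"
    by (rule inj_on_inverseI[of _ "\<lambda>w. to_slice c ?y (?B' w)"]) (auto simp: left)
  have mem: "to_slice c ?y (?B' w) \<in> UNIV \<times> N" for w
    using slice_coord_deriv(2)[OF c y(1)] by (simp add: mem_Times_iff)
  have inv: "inv_into (UNIV \<times> N) ?L w = to_slice c ?y (?B' w)" for w
    using inv_into_f_f[OF inj mem[of w]] by (simp only: right)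
  \<comment> \<open>The covector in the chart \<open>c\<close>, carried to the preferred chart by
    the dual of the opposite transition.\<close>
  define p where "p = adjoint ?B' (covector c ?y \<alpha>)"
  have p: "p \<bullet> w = \<alpha> \<bullet> inv_into (UNIV \<times> N) ?L w" for w
    unfolding p_def inv by (simp add: adjoint_clauses(2)[OF linB'] covector_inner[OF c y(1)])
  have the: "(THE p. \<forall>w. p \<bullet> w = \<alpha> \<bullet> inv_into (UNIV \<times> N) ?L w) = p"
  proof (rule the_equality)
    show "\<forall>w. p \<bullet> w = \<alpha> \<bullet> inv_into (UNIV \<times> N) ?L w" using p by blast
    show "r = p" if "\<forall>w. r \<bullet> w = \<alpha> \<bullet> inv_into (UNIV \<times> N) ?L w" for r
      using that p by (metis vector_eq_rdot)
  qed
  have "adjoint ?B p \<bullet> w = covector c ?y \<alpha> \<bullet> w" for w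
    by (simp add: adjoint_clauses(2)[OF linB] p inv B' covector_inner[OF c y(1)])
  then have "adjoint ?B p = covector c ?y \<alpha>" by (metis vector_eq_rdot)
  then have chart: "snd (cotangent_chart A c) (\<tau> z, p) = (?y, covector c ?y \<alpha>)"
    by (simp add: cotangent_chart_def)
  show ?thesis
  proof (rule that[OF _ p _ _ chart])
    show "cotangent_lift_inverse A N \<tau> (z, \<alpha>) = (\<tau> z, p)"
      by (simp add: cotangent_lift_inverse_def the)
    show "inv_into (UNIV \<times> N) ?L (?L u) = u" if "snd u \<in> N" for u
      using that by (intro inv_into_f_f[OF inj]) (simp add: mem_Times_iff)
    show "\<exists>u\<in>UNIV \<times> N. ?L u = w" for w using mem right by blast
  qed
qed

lemma smooth_to_slice:
  assumes "c \<in> A"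
  shows "smooth_on (slice_dom c) (\<lambda>y. to_slice c y w)"
  unfolding to_slice_def Let_def
  by (intro smooth_on_Pair open_slice_dom[OF assms] smooth_on_linear[OF bounded_linear_vee]
      smooth_on_bilinear[OF bounded_bilinear_matrix_mult] smooth_on_linear[OF bounded_linear_transpose]
      smooth_on_fst smooth_on_snd smooth_on_frechet smooth_slice_coord[OF assms])

text \<open>The adjoint is expanded in \<open>Basis\<close>, so that smoothness of
  \<open>to_slice\<close> in fixed directions suffices.\<close>

lemma smooth_covector:
  assumes c: "c \<in> A" and T: "open T" "smooth_on T f" "smooth_on T a"
    and dom: "\<And>x. x \<in> T \<Longrightarrow> f x \<in> slice_dom c"
  shows "smooth_on T (\<lambda>x. covector c (f x) (a x))"
proof (rule smooth_on_cong[OF T(1)])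
  show "smooth_on T (\<lambda>x. \<Sum>e\<in>Basis. (a x \<bullet> to_slice c (f x) e) *\<^sub>R e)"
    by (intro smooth_on_sum smooth_on_scaleR smooth_on_inner smooth_on_const T
        smooth_on_compose[OF smooth_to_slice[OF c] open_slice_dom[OF c] T(1,2) dom])
  show "(\<Sum>e\<in>Basis. (a x \<bullet> to_slice c (f x) e) *\<^sub>R e) = covector c (f x) (a x)" if "x \<in> T" for x
    using euclidean_representation[of "covector c (f x) (a x)"]
    by (simp add: covector_inner[OF c dom[OF that]])
qed

text \<open>The inverse of \<open>covector\<close> on momenta whose second part lies in
  \<open>N\<close>; \<open>proj\<close> is what puts the result there.\<close>

definition slice_covector :: "('q, 'e) chart \<Rightarrow> 'e \<Rightarrow> 'e \<Rightarrow> (real^3) \<times> 'e" where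
  "slice_covector c y P = (\<Sum>b\<in>Basis. (P \<bullet> of_slice c (slice_coord c y) (fst b, proj (snd b))) *\<^sub>R b)"

lemma of_slice_linear:
  assumes "c \<in> A" "z \<in> SO3 \<times> S" "\<tau> z \<in> fst c"
  shows "linear (\<lambda>u. of_slice c z (fst u, proj (snd u)))"
proof -
  obtain Y k where ext: "open Y" "z \<in> Y" "smooth_on Y k"
    "\<And>y. y \<in> SO3 \<times> S \<Longrightarrow> y \<in> Y \<Longrightarrow> \<tau> y \<in> fst c \<and> snd c (\<tau> y) = k y"
    using chart_ext[OF assms] by blast
  have *: "of_slice c z (fst u, proj (snd u))
      = frechet_derivative k (at z) (fst z ** hat (fst u), proj (snd u))" for u
    using of_slice_eq[OF assms(1,2) _ ext] proj_in by simp
  have "linear (\<lambda>u. (fst z ** hat (fst u), proj (snd u)))"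
    by (rule linearI) (simp_all add: linear_add[OF linear_hat] linear_scale[OF linear_hat]
        linear_add[OF linear_proj] linear_scale[OF linear_proj] matrix_add_ldistrib
        bounded_bilinear.scaleR_right[OF bounded_bilinear_matrix_mult])
  from linear_compose[OF this] show ?thesis
    unfolding * using smooth_on_has_derivative[OF ext(3,2)] has_derivative_linear
    by (auto simp: o_def)
qed

lemma slice_covector_inner:
  assumes "c \<in> A" "y \<in> slice_dom c"
  shows "slice_covector c y P \<bullet> u = P \<bullet> of_slice c (slice_coord c y) (fst u, proj (snd u))"
proof -
  note lin = of_slice_linear[OF assms(1) slice_coord(1,2)[OF assms]]
  show ?thesis
    unfolding slice_covector_def linear_euclidean_expand[OF lin, of u]
    by (simp add: inner_sum_left inner_sum_right inner_commute mult.commute)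
qed

lemma slice_covector_in:
  assumes "c \<in> A" "y \<in> slice_dom c"
  shows "snd (slice_covector c y P) \<in> N"
proof -
  let ?a = "slice_covector c y P"
  have "proj (snd ?a) \<bullet> n = snd ?a \<bullet> n" for n
    using slice_covector_inner[OF assms, of P "(0, n)"] slice_covector_inner[OF assms, of P "(0, proj n)"]
    by (simp add: proj_id[OF proj_in] proj_adjoint inner_prod_def)
  then have "proj (snd ?a) = snd ?a" by (metis vector_eq_rdot)
  then show ?thesis by (metis proj_in)
qed

lemma covector_slice_covector:
  assumes "c \<in> A" "y \<in> slice_dom c"
  shows "covector c y (slice_covector c y P) = P"
proof -
  have "covector c y (slice_covector c y P) \<bullet> w = P \<bullet> w" for w
    using of_to_slice[OF assms, of w] slice_coord_deriv(2)[OF assms]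
    by (simp add: covector_inner[OF assms] slice_covector_inner[OF assms] proj_id)
  then show ?thesis by (metis vector_eq_rdot)
qed

lemma slice_covector_covector:
  assumes "c \<in> A" "y \<in> slice_dom c" "snd \<alpha> \<in> N"
  shows "slice_covector c y (covector c y \<alpha>) = \<alpha>"
proof -
  have "slice_covector c y (covector c y \<alpha>) \<bullet> u = \<alpha> \<bullet> u" for u
  proof -
    have "slice_covector c y (covector c y \<alpha>) \<bullet> u = \<alpha> \<bullet> (fst u, proj (snd u))"
      using to_of_slice[OF assms(1) slice_coord(1,2)[OF assms(1,2)], of "(fst u, proj (snd u))"]
      by (simp add: slice_covector_inner[OF assms(1,2)] covector_inner[OF assms(1,2)]
          slice_coord(3)[OF assms(1,2)] proj_in)
    also have "\<dots> = \<alpha> \<bullet> u"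
      by (simp add: inner_prod_def proj_id[OF assms(3)] flip: proj_adjoint)
    finally show ?thesis .
  qed
  then show ?thesis by (metis vector_eq_rdot)
qed

text \<open>\<open>of_slice\<close> is defined by curves, one base point at a time. Near a given
  point it is the derivative of a single extension \<open>k\<close>, and this depends smoothly on
  the point.\<close>

lemma smooth_slice_covector:
  assumes c: "c \<in> A"
  shows "smooth_on (slice_dom c \<times> UNIV) (\<lambda>x. slice_covector c (fst x) (snd x))"
proof (rule smooth_on_local)
  fix x :: "'e \<times> 'e" assume "x \<in> slice_dom c \<times> UNIV"
  then have y: "fst x \<in> slice_dom c" by auto
  obtain Y k where ext: "open Y" "slice_coord c (fst x) \<in> Y" "smooth_on Y k"
    "\<And>y. y \<in> SO3 \<times> S \<Longrightarrow> y \<in> Y \<Longrightarrow> \<tau> y \<in> fst c \<and> snd c (\<tau> y) = k y"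
    using chart_ext[OF c slice_coord(1,2)[OF c y]] by blast
  \<comment> \<open>Restricts to points at which the one extension \<open>k\<close> is
    valid.\<close>
  define D where "D = slice_dom c \<inter> slice_coord c -` Y"
  have D: "open D"
    unfolding D_def
    by (rule continuous_open_preimage[OF smooth_on_imp_continuous_on[OF smooth_slice_coord[OF c]]
          open_slice_dom[OF c] ext(1)])
  let ?T = "D \<times> UNIV :: ('e \<times> 'e) set"
  have T: "open ?T" by (intro open_Times D open_UNIV)
  have z: "smooth_on ?T (\<lambda>x. slice_coord c (fst x))"
    by (rule smooth_on_compose[OF smooth_slice_coord[OF c] open_slice_dom[OF c] T
          smooth_on_fst[OF T smooth_on_ident]]) (auto simp: D_def)
  have of_slice: "smooth_on ?T (\<lambda>x. frechet_derivative k (at (slice_coord c (fst x)))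
      (fst (slice_coord c (fst x)) ** hat a, b))" for a b
  proof (rule smooth_on_frechet_compose[OF ext(3,1) T z])
    show "slice_coord c (fst x) \<in> Y" if "x \<in> ?T" for x
      using that by (auto simp: D_def)
    show "smooth_on ?T (\<lambda>x. (fst (slice_coord c (fst x)) ** hat a, b))"
      by (intro smooth_on_Pair smooth_on_bilinear[OF bounded_bilinear_matrix_mult]
          smooth_on_fst smooth_on_const T z)
  qed
  have "smooth_on ?T (\<lambda>x. \<Sum>b\<in>Basis. (snd x \<bullet> frechet_derivative k (at (slice_coord c (fst x)))
      (fst (slice_coord c (fst x)) ** hat (fst b), proj (snd b))) *\<^sub>R b)"
    by (intro smooth_on_sum smooth_on_scaleR smooth_on_inner smooth_on_const T of_slice
        smooth_on_snd smooth_on_ident)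
  then have "smooth_on ?T (\<lambda>x. slice_covector c (fst x) (snd x))"
  proof (rule smooth_on_cong[OF T])
    fix x :: "'e \<times> 'e" assume "x \<in> ?T"
    then have x: "fst x \<in> slice_dom c" "slice_coord c (fst x) \<in> Y" by (auto simp: D_def)
    show "(\<Sum>b\<in>Basis. (snd x \<bullet> frechet_derivative k (at (slice_coord c (fst x)))
      (fst (slice_coord c (fst x)) ** hat (fst b), proj (snd b))) *\<^sub>R b) = slice_covector c (fst x) (snd x)"
      unfolding slice_covector_def
      using of_slice_eq[OF c slice_coord(1)[OF c x(1)] _ ext(1) x(2) ext(3,4)] by (simp add: proj_in)
  qed
  moreover have "x \<in> ?T" using y ext(2) by (cases x) (simp add: D_def)
  ultimately show "\<exists>U. open U \<and> x \<in> U \<and> smooth_on U (\<lambda>x. slice_covector c (fst x) (snd x))"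
    using T by blast
qed

end

subsection \<open>The symplectic form\<close>

context slice_diffeo
begin

text \<open>The moving covector is paired with the image of the left-invariant field through
  \<open>u\<close>. The pairing equals \<open>a t \<bullet> u\<close>, from which \<tau> has
  disappeared, and the product rule isolates \<open>P'\<close>.\<close>

lemma covector_pairing_derivative:
  assumes c: "c \<in> A" and z: "z \<in> SO3 \<times> S" "\<tau> z \<in> fst c"
    and ext: "open Y" "z \<in> Y" "smooth_on Y k"
      "\<And>y. y \<in> SO3 \<times> S \<Longrightarrow> y \<in> Y \<Longrightarrow> \<tau> y \<in> fst c \<and> snd c (\<tau> y) = k y"
    and \<Gamma>: "(\<Gamma> has_vector_derivative (fst z ** hat (fst v), snd v)) (at 0)"
      "\<forall>\<^sub>F t in nhds 0. \<Gamma> t \<in> SO3 \<times> S" "\<Gamma> 0 = z"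
    and a: "(a has_vector_derivative a') (at 0)"
    and P: "((\<lambda>t. covector c (snd c (\<tau> (\<Gamma> t))) (a t)) has_vector_derivative P') (at 0)"
    and u: "snd u \<in> N"
  shows "P' \<bullet> of_slice c z u = a' \<bullet> u - covector c (snd c (\<tau> z)) (a 0) \<bullet>
    (frechet_derivative (\<lambda>y. frechet_derivative k (at y) (fst z ** hat (fst u), snd u)) (at z)
        (fst z ** hat (fst v), snd v)
      + frechet_derivative k (at z) (fst z ** hat (fst v) ** hat (fst u), 0))"
    (is "_ = _ - ?P \<bullet> ?E")
proof -
  let ?U = "\<lambda>t. (fst (\<Gamma> t) ** hat (fst u), snd u)"
  let ?Q = "\<lambda>t. frechet_derivative k (at (\<Gamma> t)) (?U t)"
  have ev: "\<forall>\<^sub>F t in nhds 0. \<Gamma> t \<in> SO3 \<times> S \<and> \<Gamma> t \<in> Y \<and> \<tau> (\<Gamma> t) \<in> fst c"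
    using chart_curve(2)[OF c ext(1,3,4) \<Gamma>(1,2)] \<Gamma>(3) ext(2) by simp
  \<comment> \<open>A left-invariant field is not constant in ambient coordinates; its derivative
    along the curve is the source of the bracket.\<close>
  have "((\<lambda>t. fst (\<Gamma> t) ** hat (fst u)) has_vector_derivative fst z ** hat (fst v) ** hat (fst u)) (at 0)"
    using bounded_linear.has_vector_derivative[OF
        bounded_bilinear.bounded_linear_left[OF bounded_bilinear_matrix_mult]
        bounded_linear.has_vector_derivative[OF bounded_linear_fst \<Gamma>(1)]]
    by simp
  then have U: "(?U has_vector_derivative (fst z ** hat (fst v) ** hat (fst u), 0)) (at 0)"
    by (intro has_vector_derivative_Pair has_vector_derivative_const)
  have "\<Gamma> 0 \<in> Y" using \<Gamma>(3) ext(2) by simp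
  from second_derivative_curve[OF ext(1,3) this \<Gamma>(1) U]
  have Q: "(?Q has_vector_derivative ?E) (at 0)"
    by (simp add: \<Gamma>(3))
  have Q0: "?Q 0 = of_slice c z u"
    by (simp add: \<Gamma>(3) of_slice_eq[OF c z(1) u ext])
  have pair: "\<forall>\<^sub>F t in nhds 0. covector c (snd c (\<tau> (\<Gamma> t))) (a t) \<bullet> ?Q t = a t \<bullet> u"
    using ev
  proof (rule eventually_mono)
    fix t assume t: "\<Gamma> t \<in> SO3 \<times> S \<and> \<Gamma> t \<in> Y \<and> \<tau> (\<Gamma> t) \<in> fst c"
    have "?Q t = of_slice c (\<Gamma> t) u"
      using of_slice_eq[OF c _ u ext(1) _ ext(3,4)] t by simp
    then show "covector c (snd c (\<tau> (\<Gamma> t))) (a t) \<bullet> ?Q t = a t \<bullet> u"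
      using t slice_dom(1)[OF c] to_of_slice[OF c _ _ u] by (simp add: covector_inner[OF c])
  qed
  have "((\<lambda>t. covector c (snd c (\<tau> (\<Gamma> t))) (a t) \<bullet> ?Q t) has_vector_derivative
      (?P \<bullet> ?E + P' \<bullet> of_slice c z u)) (at 0)"
    using bounded_bilinear.has_vector_derivative[OF bounded_bilinear_inner P Q] Q0 by (simp add: \<Gamma>(3))
  from has_vector_derivative_eventually[OF this pair]
  have "((\<lambda>t. a t \<bullet> u) has_vector_derivative (?P \<bullet> ?E + P' \<bullet> of_slice c z u)) (at 0)" .
  moreover have "((\<lambda>t. a t \<bullet> u) has_vector_derivative a' \<bullet> u) (at 0)"
    by (rule bounded_linear.has_vector_derivative[OF bounded_linear_inner_left a])
  ultimately have "?P \<bullet> ?E + P' \<bullet> of_slice c z u = a' \<bullet> u"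
    by (rule vector_derivative_unique_at)
  then show ?thesis by simp
qed

text \<open>The second derivatives of \<open>\<tau>\<close> cancel by symmetry; the momentum term is what remains, from
  the non-commuting left-invariant fields.\<close>

lemma canonical_form_covector:
  assumes c: "c \<in> A" and z: "z \<in> SO3 \<times> S" "\<tau> z \<in> fst c"
    and 1: "(\<Gamma>1 has_vector_derivative (fst z ** hat (fst v1), snd v1)) (at 0)"
      "\<forall>\<^sub>F t in nhds 0. \<Gamma>1 t \<in> SO3 \<times> S" "\<Gamma>1 0 = z" "snd v1 \<in> N"
      "(a1 has_vector_derivative a1') (at 0)" "a1 0 = \<alpha>"
      "((\<lambda>t. covector c (snd c (\<tau> (\<Gamma>1 t))) (a1 t)) has_vector_derivative P1) (at 0)"
    and 2: "(\<Gamma>2 has_vector_derivative (fst z ** hat (fst v2), snd v2)) (at 0)"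
      "\<forall>\<^sub>F t in nhds 0. \<Gamma>2 t \<in> SO3 \<times> S" "\<Gamma>2 0 = z" "snd v2 \<in> N"
      "(a2 has_vector_derivative a2') (at 0)" "a2 0 = \<alpha>"
      "((\<lambda>t. covector c (snd c (\<tau> (\<Gamma>2 t))) (a2 t)) has_vector_derivative P2) (at 0)"
  shows "canonical_form (of_slice c z v1, P1) (of_slice c z v2, P2)
    = fst \<alpha> \<bullet> cross3 (fst v1) (fst v2) + a2' \<bullet> v1 - a1' \<bullet> v2"
proof -
  obtain Y k where ext: "open Y" "z \<in> Y" "smooth_on Y k"
    "\<And>y. y \<in> SO3 \<times> S \<Longrightarrow> y \<in> Y \<Longrightarrow> \<tau> y \<in> fst c \<and> snd c (\<tau> y) = k y"
    using chart_ext[OF c z] by blast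
  let ?M = "\<lambda>u. (fst z ** hat (fst u), snd u)"
  let ?H = "\<lambda>u v. frechet_derivative (\<lambda>y. frechet_derivative k (at y) u) (at z) v"
  let ?K = "frechet_derivative k (at z)"
  let ?P = "covector c (snd c (\<tau> z)) \<alpha>"
  have linK: "linear ?K"
    using smooth_on_has_derivative[OF ext(3,2)] has_derivative_linear by blast
  let ?w = "(cross3 (fst v1) (fst v2), 0 :: 'e)"
  have w: "snd ?w \<in> N" using N by (simp add: subspace_0)
  \<comment> \<open>Neither argument need be tangent to the group, but their difference is the
    left-invariant vector of the bracket, on which \<open>?K\<close> is determined by
    \<tau>.\<close>
  have "?K (fst z ** hat (fst v1) ** hat (fst v2), 0) - ?K (fst z ** hat (fst v2) ** hat (fst v1), 0)
      = ?K (fst z ** (hat (fst v1) ** hat (fst v2) - hat (fst v2) ** hat (fst v1)), 0)"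
    by (simp add: linear_diff[OF linK, symmetric] matrix_mul_assoc
        bounded_bilinear.diff_right[OF bounded_bilinear_matrix_mult])
  also have "\<dots> = of_slice c z ?w"
    using of_slice_eq[OF c z(1) w ext] by (simp add: hat_commutator)
  finally have bracket: "?K (fst z ** hat (fst v1) ** hat (fst v2), 0)
      - ?K (fst z ** hat (fst v2) ** hat (fst v1), 0) = of_slice c z ?w" .
  have "?P \<bullet> of_slice c z ?w = \<alpha> \<bullet> ?w"
    by (simp only: covector_inner[OF c slice_dom(1)[OF c z]] to_of_slice[OF c z w])
  also have "\<dots> = fst \<alpha> \<bullet> cross3 (fst v1) (fst v2)"
    by (simp add: inner_prod_def)
  finally have momentum: "?P \<bullet> of_slice c z ?w = fst \<alpha> \<bullet> cross3 (fst v1) (fst v2)" .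
  have sym: "?H (?M v1) (?M v2) = ?H (?M v2) (?M v1)"
    by (rule second_derivative_symmetric[OF ext(1,3,2)])
  have d1: "P1 \<bullet> of_slice c z v2 = a1' \<bullet> v2 - ?P \<bullet> (?H (?M v2) (?M v1)
      + ?K (fst z ** hat (fst v1) ** hat (fst v2), 0))"
    using covector_pairing_derivative[OF c z ext 1(1,2,3,5,7) 2(4)] unfolding 1(6) .
  have d2: "P2 \<bullet> of_slice c z v1 = a2' \<bullet> v1 - ?P \<bullet> (?H (?M v1) (?M v2)
      + ?K (fst z ** hat (fst v2) ** hat (fst v1), 0))"
    using covector_pairing_derivative[OF c z ext 2(1,2,3,5,7) 1(4)] unfolding 2(6) .
  have "canonical_form (of_slice c z v1, P1) (of_slice c z v2, P2)
      = P2 \<bullet> of_slice c z v1 - P1 \<bullet> of_slice c z v2"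
    by (simp add: canonical_form_def)
  also have "\<dots> = a2' \<bullet> v1 - a1' \<bullet> v2 + ?P \<bullet> (?K (fst z ** hat (fst v1) ** hat (fst v2), 0)
      - ?K (fst z ** hat (fst v2) ** hat (fst v1), 0))"
    unfolding d1 d2 sym by (simp add: inner_add_right inner_diff_right)
  finally show ?thesis
    unfolding bracket momentum by simp
qed

end

section \<open>The tube in canonical coordinates\<close>

lemma carrier_cotangent_atlas: "carrier_of (cotangent_atlas A) = carrier_of A \<times> UNIV"
  by (auto simp: carrier_of_def cotangent_atlas_def cotangent_chart_def)

lemma mem_cotangent_chart: "x \<in> fst (cotangent_chart A c) \<longleftrightarrow> fst x \<in> fst c"
  by (simp add: cotangent_chart_def mem_Times_iff)

definition tube_base :: "real^3 \<Rightarrow> (real^3^3) \<times> ((real^3) \<times> (real^3)) \<times> ('e \<times> 'e) \<Rightarrow> (real^3^3) \<times> 'e" where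
  "tube_base \<mu> = (\<lambda>(g, (\<nu>, \<rho>), (s, \<sigma>)). (fst (tube_map \<mu> (g, \<nu>, \<rho>)), s))"

definition tube_mom :: "real^3 \<Rightarrow> (real^3^3) \<times> ((real^3) \<times> (real^3)) \<times> ('e \<times> 'e) \<Rightarrow> (real^3) \<times> 'e" where
  "tube_mom \<mu> = (\<lambda>(g, (\<nu>, \<rho>), (s, \<sigma>)). (snd (tube_map \<mu> (g, \<nu>, \<rho>)), \<sigma>))"

text \<open>The inverse of \<Phi> with the slice factor carried along, its arguments grouped as a
  base point and a covector, the way \<open>cotangent_lift_inverse\<close> takes them.\<close>

definition tube_back :: "real^3 \<Rightarrow> (real^3^3) \<times> 'e \<Rightarrow> (real^3) \<times> 'e \<Rightarrow>
    (real^3^3) \<times> ((real^3) \<times> (real^3)) \<times> ('e \<times> 'e)" where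
  "tube_back \<mu> z a = (let t = tube_inv \<mu> (fst z, fst a)
     in (fst t, (fst (snd t), snd (snd t)), (snd z, snd a)))"

lemma (in slice_diffeo) cotangent_atlas_inj:
  "cc \<in> cotangent_atlas A \<Longrightarrow> inj_on (snd cc) (fst cc)"
  using cotangent_chart_inj[OF A] by (auto simp: cotangent_atlas_def)

locale slice_tube = slice_diffeo A N S \<tau>
  for A :: "('q, 'e::euclidean_space) chart set" and N S :: "'e set"
    and \<tau> :: "(real^3^3) \<times> 'e \<Rightarrow> 'q" +
  fixes \<mu> :: "real^3"
  assumes \<mu>: "\<mu> \<noteq> 0"
begin

lemma tube_eq:
  assumes "x \<in> tube_source \<mu> N S"
  shows "tube A N \<tau> \<mu> x = cotangent_lift_inverse A N \<tau> (tube_base \<mu> x, tube_mom \<mu> x)"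
  using assms
  by (auto simp: tube_source_def tube_def tube_base_def tube_mom_def tube_Phi_eq[OF \<mu>] split_def Let_def)

lemma tube_base_in:
  assumes "x \<in> tube_source \<mu> N S"
  shows "tube_base \<mu> x \<in> SO3 \<times> S" "snd (tube_mom \<mu> x) \<in> N" "fst (tube_mom \<mu> x) \<in> tube_ran \<mu>"
    "tube_back \<mu> (tube_base \<mu> x) (tube_mom \<mu> x) = x"
proof -
  obtain g \<nu> \<rho> s \<sigma> where x: "x = (g, (\<nu>, \<rho>), (s, \<sigma>))" "g \<in> SO3" "(\<nu>, \<rho>) \<in> tube_U \<mu>" "s \<in> S" "\<sigma> \<in> N"
    using assms by (auto simp: tube_source_def)
  show "tube_base \<mu> x \<in> SO3 \<times> S" "snd (tube_mom \<mu> x) \<in> N" "fst (tube_mom \<mu> x) \<in> tube_ran \<mu>"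
    "tube_back \<mu> (tube_base \<mu> x) (tube_mom \<mu> x) = x"
    using tube_map_in[OF \<mu> x(2,3)] x
    by (auto simp: tube_base_def tube_mom_def tube_back_def mem_Times_iff)
qed

lemma tube_back_in:
  assumes "z \<in> SO3 \<times> S" "snd a \<in> N" "fst a \<in> tube_ran \<mu>"
  shows "tube_back \<mu> z a \<in> tube_source \<mu> N S" "tube_base \<mu> (tube_back \<mu> z a) = z"
    "tube_mom \<mu> (tube_back \<mu> z a) = a"
proof -
  obtain g \<nu> \<rho> where t: "tube_inv \<mu> (fst z, fst a) = (g, \<nu>, \<rho>)" by (metis surj_pair)
  have R: "fst z \<in> SO3" using assms(1) by auto
  show "tube_back \<mu> z a \<in> tube_source \<mu> N S" "tube_base \<mu> (tube_back \<mu> z a) = z"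
    "tube_mom \<mu> (tube_back \<mu> z a) = a"
    using tube_inv_in[OF \<mu> R assms(3)] assms(1,2)
    by (auto simp: tube_back_def t tube_source_def tube_base_def tube_mom_def)
qed

lemma tube_fst: "x \<in> tube_source \<mu> N S \<Longrightarrow> fst (tube A N \<tau> \<mu> x) = \<tau> (tube_base \<mu> x)"
  by (simp add: tube_eq cotangent_lift_inverse_def)

lemma tube_chart:
  assumes "c \<in> A" "x \<in> tube_source \<mu> N S" "\<tau> (tube_base \<mu> x) \<in> fst c"
  shows "snd (cotangent_chart A c) (tube A N \<tau> \<mu> x)
    = (snd c (\<tau> (tube_base \<mu> x)), covector c (snd c (\<tau> (tube_base \<mu> x))) (tube_mom \<mu> x))"
  using cotangent_lift_inverse_eq[OF assms(1) tube_base_in(1)[OF assms(2)] assms(3)]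
  by (metis tube_eq[OF assms(2)])

text \<open>This is the image of the tube in the canonical coordinates over \<open>c\<close>;
  described by the inverse map, it is open by continuity.\<close>

definition tube_chart_ran :: "('q, 'e) chart \<Rightarrow> ('e \<times> 'e) set" where
  "tube_chart_ran c = {x \<in> slice_dom c \<times> UNIV. fst (slice_covector c (fst x) (snd x)) \<in> tube_ran \<mu>}"

definition tube_chart_inv :: "('q, 'e) chart \<Rightarrow> 'e \<times> 'e \<Rightarrow>
    (real^3^3) \<times> ((real^3) \<times> (real^3)) \<times> ('e \<times> 'e)" where
  "tube_chart_inv c = (\<lambda>x. tube_back \<mu> (slice_coord c (fst x)) (slice_covector c (fst x) (snd x)))"

lemma open_tube_chart_ran:
  assumes "c \<in> A"
  shows "open (tube_chart_ran c)"
proof -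
  have "tube_chart_ran c = (slice_dom c \<times> UNIV) \<inter>
      (\<lambda>x. fst (slice_covector c (fst x) (snd x))) -` tube_ran \<mu>"
    by (auto simp: tube_chart_ran_def)
  then show ?thesis
    using continuous_open_preimage[OF continuous_on_fst[OF
        smooth_on_imp_continuous_on[OF smooth_slice_covector[OF assms]]]
        open_Times[OF open_slice_dom[OF assms] open_UNIV] open_tube_ran[OF \<mu>]]
    by simp
qed

lemma tube_chart_inv:
  assumes c: "c \<in> A" and x: "x \<in> tube_chart_ran c"
  shows "tube_chart_inv c x \<in> tube_source \<mu> N S"
    and "fst (tube A N \<tau> \<mu> (tube_chart_inv c x)) \<in> fst c"
    and "snd (cotangent_chart A c) (tube A N \<tau> \<mu> (tube_chart_inv c x)) = x"
proof -
  have y: "fst x \<in> slice_dom c" and ran: "fst (slice_covector c (fst x) (snd x)) \<in> tube_ran \<mu>"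
    using x by (auto simp: tube_chart_ran_def)
  have b: "tube_chart_inv c x \<in> tube_source \<mu> N S" "tube_base \<mu> (tube_chart_inv c x) = slice_coord c (fst x)"
    "tube_mom \<mu> (tube_chart_inv c x) = slice_covector c (fst x) (snd x)"
    using tube_back_in[OF slice_coord(1)[OF c y] slice_covector_in[OF c y] ran]
    by (auto simp: tube_chart_inv_def)
  show "tube_chart_inv c x \<in> tube_source \<mu> N S" by (rule b(1))
  show "fst (tube A N \<tau> \<mu> (tube_chart_inv c x)) \<in> fst c"
    unfolding tube_fst[OF b(1)] b(2) by (rule slice_coord(2)[OF c y])
  show "snd (cotangent_chart A c) (tube A N \<tau> \<mu> (tube_chart_inv c x)) = x"
    using tube_chart[OF c b(1)] slice_coord(2,3)[OF c y]
    by (simp add: b covector_slice_covector[OF c y])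
qed

lemma tube_chart_inv_left:
  assumes c: "c \<in> A" and x: "x \<in> tube_source \<mu> N S" "\<tau> (tube_base \<mu> x) \<in> fst c"
  shows "snd (cotangent_chart A c) (tube A N \<tau> \<mu> x) \<in> tube_chart_ran c"
    and "tube_chart_inv c (snd (cotangent_chart A c) (tube A N \<tau> \<mu> x)) = x"
proof -
  note b = tube_base_in[OF x(1)]
  note y = slice_dom[OF c b(1) x(2)]
  note a = slice_covector_covector[OF c y(1) b(2)]
  show "snd (cotangent_chart A c) (tube A N \<tau> \<mu> x) \<in> tube_chart_ran c"
    using y(1) b(3) by (simp add: tube_chart[OF c x] tube_chart_ran_def a)
  show "tube_chart_inv c (snd (cotangent_chart A c) (tube A N \<tau> \<mu> x)) = x"
    using b(4) by (simp add: tube_chart[OF c x] tube_chart_inv_def a y(2))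
qed

lemma base_chart:
  assumes "x \<in> tube_source \<mu> N S"
  obtains c where "c \<in> A" "\<tau> (tube_base \<mu> x) \<in> fst c"
proof -
  have "\<tau> (tube_base \<mu> x) \<in> carrier_of A"
    using smooth_\<tau>[unfolded smooth_into_def, THEN conjunct1] tube_base_in(1)[OF assms] by auto
  then show ?thesis using that by (auto simp: carrier_of_def)
qed

text \<open>Equal images lie over the same chart domain, where \<open>tube_chart_inv\<close>
  recovers the argument.\<close>

lemma inj_tube: "inj_on (tube A N \<tau> \<mu>) (tube_source \<mu> N S)"
proof (rule inj_onI)
  fix x x' assume x: "x \<in> tube_source \<mu> N S" and x': "x' \<in> tube_source \<mu> N S"
    and eq: "tube A N \<tau> \<mu> x = tube A N \<tau> \<mu> x'"
  obtain c where c: "c \<in> A" "\<tau> (tube_base \<mu> x) \<in> fst c" using base_chart[OF x] .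
  have c': "\<tau> (tube_base \<mu> x') \<in> fst c"
    using c(2) tube_fst[OF x] tube_fst[OF x'] eq by simp
  have "x = tube_chart_inv c (snd (cotangent_chart A c) (tube A N \<tau> \<mu> x))"
    by (rule tube_chart_inv_left(2)[OF c(1) x c(2), symmetric])
  also have "\<dots> = tube_chart_inv c (snd (cotangent_chart A c) (tube A N \<tau> \<mu> x'))"
    by (simp only: eq)
  also have "\<dots> = x'"
    by (rule tube_chart_inv_left(2)[OF c(1) x' c'])
  finally show "x = x'" .
qed

lemma tube_chart_image:
  assumes c: "c \<in> A"
  shows "snd (cotangent_chart A c) ` (tube A N \<tau> \<mu> ` tube_source \<mu> N S \<inter> fst (cotangent_chart A c))
    = tube_chart_ran c" (is "?L = _")
proof
  show "?L \<subseteq> tube_chart_ran c"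
    using tube_chart_inv_left(1)[OF c] by (auto simp: mem_cotangent_chart tube_fst)
  show "tube_chart_ran c \<subseteq> ?L"
  proof
    fix x assume x: "x \<in> tube_chart_ran c"
    note i = tube_chart_inv[OF c x]
    show "x \<in> ?L"
      by (rule image_eqI[where x = "tube A N \<tau> \<mu> (tube_chart_inv c x)"])
        (use i in \<open>auto simp: mem_cotangent_chart\<close>)
  qed
qed

lemma openin_tube:
  "openin (manifold_topology (cotangent_atlas A)) (tube A N \<tau> \<mu> ` tube_source \<mu> N S)"
proof -
  have "tube A N \<tau> \<mu> ` tube_source \<mu> N S \<subseteq> carrier_of A \<times> UNIV"
  proof
    fix y assume "y \<in> tube A N \<tau> \<mu> ` tube_source \<mu> N S"
    then obtain x where x: "x \<in> tube_source \<mu> N S" "y = tube A N \<tau> \<mu> x" by blast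
    obtain c where c: "c \<in> A" "\<tau> (tube_base \<mu> x) \<in> fst c" using base_chart[OF x(1)] .
    then show "y \<in> carrier_of A \<times> UNIV"
      using carrier_ofI[OF A c] by (simp add: x(2) mem_Times_iff tube_fst[OF x(1)])
  qed
  moreover have "open (snd cc ` (tube A N \<tau> \<mu> ` tube_source \<mu> N S \<inter> fst cc))"
    if "cc \<in> cotangent_atlas A" for cc
    using that by (auto simp: cotangent_atlas_def tube_chart_image open_tube_chart_ran)
  ultimately show ?thesis
    by (intro openin_manifold_topology[THEN iffD2, OF cotangent_atlas_inj])
      (auto simp: carrier_cotangent_atlas)
qed

text \<open>The source is not open, so smoothness is established on an open set around it where the
  explicit formulas still make sense.\<close>

lemma smooth_tube_base:
  defines "T \<equiv> (UNIV :: (real^3^3) set) \<times> tube_dom \<mu> \<times> (UNIV :: ('e \<times> 'e) set)"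
  shows "open T" "smooth_on T (tube_base \<mu>)" "smooth_on T (tube_mom \<mu>)"
    "tube_source \<mu> N S \<subseteq> T"
proof -
  show T: "open T"
    unfolding T_def by (intro open_Times open_UNIV open_tube_dom[OF \<mu>])
  have "smooth_on T (\<lambda>x. tube_map \<mu> (fst x, fst (fst (snd x)), snd (fst (snd x))))"
    by (rule smooth_on_compose[OF smooth_on_tube_map[OF \<mu>] open_Times[OF open_UNIV open_tube_dom[OF \<mu>]] T])
      (intro smooth_on_Pair smooth_on_fst smooth_on_snd smooth_on_ident T, auto simp: T_def)
  then show "smooth_on T (tube_base \<mu>)" "smooth_on T (tube_mom \<mu>)"
    unfolding tube_base_def tube_mom_def split_def
    by (intro smooth_on_Pair smooth_on_fst smooth_on_snd smooth_on_ident T; simp)+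
  show "tube_source \<mu> N S \<subseteq> T"
    by (auto simp: tube_source_def T_def tube_U_iff[OF \<mu>])
qed

lemma smooth_into_tube: "smooth_into (tube_source \<mu> N S) (cotangent_atlas A) (tube A N \<tau> \<mu>)"
proof -
  have "\<exists>Y k. open Y \<and> x \<in> Y \<and> smooth_on Y k \<and>
      (\<forall>y\<in>tube_source \<mu> N S \<inter> Y. tube A N \<tau> \<mu> y \<in> fst (cotangent_chart A c) \<and>
        snd (cotangent_chart A c) (tube A N \<tau> \<mu> y) = k y)"
    if x: "x \<in> tube_source \<mu> N S" and c: "c \<in> A"
      and "tube A N \<tau> \<mu> x \<in> fst (cotangent_chart A c)" for x c
  proof -
    have xc: "\<tau> (tube_base \<mu> x) \<in> fst c"
      using that(3) tube_fst[OF x] by (simp add: mem_cotangent_chart)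
    obtain Y k where ext: "open Y" "tube_base \<mu> x \<in> Y" "smooth_on Y k"
      "\<And>y. y \<in> SO3 \<times> S \<Longrightarrow> y \<in> Y \<Longrightarrow> \<tau> y \<in> fst c \<and> snd c (\<tau> y) = k y"
      using chart_ext[OF c tube_base_in(1)[OF x] xc] by blast
    let ?T = "(UNIV :: (real^3^3) set) \<times> tube_dom \<mu> \<times> (UNIV :: ('e \<times> 'e) set)"
    \<comment> \<open>The part of \<open>Y\<close> that \<open>k\<close> sends into
      \<open>slice_dom c\<close>. Away from \<open>SO3 \<times> S\<close> the values of the
      extension are arbitrary and could leave the set on which \<open>covector\<close> is
      smooth.\<close>
    define Y1 where "Y1 = Y \<inter> k -` slice_dom c"
    have Y1: "open Y1"
      unfolding Y1_def
      by (rule continuous_open_preimage[OF smooth_on_imp_continuous_on[OF ext(3)] ext(1) open_slice_dom[OF c]])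
    define Y' where "Y' = ?T \<inter> tube_base \<mu> -` Y1"
    have Y': "open Y'"
      unfolding Y'_def
      by (rule continuous_open_preimage[OF smooth_on_imp_continuous_on[OF smooth_tube_base(2)]
            smooth_tube_base(1) Y1])
    have base: "smooth_on Y' (tube_base \<mu>)" and mom: "smooth_on Y' (tube_mom \<mu>)"
      by (rule smooth_on_subset[OF smooth_tube_base(2)] smooth_on_subset[OF smooth_tube_base(3)];
          simp add: Y'_def)+
    have k: "smooth_on Y' (\<lambda>x. k (tube_base \<mu> x))"
      by (rule smooth_on_compose[OF ext(3,1) Y' base]) (simp add: Y'_def Y1_def)
    have K: "smooth_on Y' (\<lambda>x. (k (tube_base \<mu> x), covector c (k (tube_base \<mu> x)) (tube_mom \<mu> x)))"
      by (intro smooth_on_Pair Y' k smooth_covector[OF c Y' k mom]) (simp add: Y'_def Y1_def)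
    have "x \<in> Y'"
      using ext(2) smooth_tube_base(4) x ext(4)[OF tube_base_in(1)[OF x] ext(2)]
        slice_dom(1)[OF c tube_base_in(1)[OF x] xc]
      by (auto simp: Y'_def Y1_def)
    moreover have "tube A N \<tau> \<mu> y \<in> fst (cotangent_chart A c) \<and> snd (cotangent_chart A c) (tube A N \<tau> \<mu> y)
        = (k (tube_base \<mu> y), covector c (k (tube_base \<mu> y)) (tube_mom \<mu> y))"
      if "y \<in> tube_source \<mu> N S \<inter> Y'" for y
    proof -
      have y: "y \<in> tube_source \<mu> N S" "tube_base \<mu> y \<in> Y" using that by (auto simp: Y'_def Y1_def)
      note e = ext(4)[OF tube_base_in(1)[OF y(1)] y(2)]
      show ?thesis
        using tube_chart[OF c y(1)] e
        by (simp add: mem_cotangent_chart tube_fst[OF y(1)])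
    qed
    ultimately show ?thesis using Y' K by blast
  qed
  then have "\<exists>Y k. open Y \<and> x \<in> Y \<and> smooth_on Y k \<and>
      (\<forall>y\<in>tube_source \<mu> N S \<inter> Y. tube A N \<tau> \<mu> y \<in> fst cc \<and> snd cc (tube A N \<tau> \<mu> y) = k y)"
    if "x \<in> tube_source \<mu> N S" "cc \<in> cotangent_atlas A" "tube A N \<tau> \<mu> x \<in> fst cc" for x cc
    using that unfolding cotangent_atlas_def by (elim imageE) (simp only:)
  moreover have "tube A N \<tau> \<mu> ` tube_source \<mu> N S \<subseteq> carrier_of (cotangent_atlas A)"
    by (rule openin_manifold_topology[THEN iffD1, OF cotangent_atlas_inj openin_tube, THEN conjunct1])
  ultimately show ?thesis
    unfolding smooth_into_def split_def by (intro conjI ballI impI)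
qed

lemma smooth_tube_chart_inv:
  assumes c: "c \<in> A"
  shows "smooth_on (tube_chart_ran c) (tube_chart_inv c)"
proof -
  let ?T = "tube_chart_ran c"
  note T = open_tube_chart_ran[OF c]
  have z: "smooth_on ?T (\<lambda>x. slice_coord c (fst x))"
    by (rule smooth_on_compose[OF smooth_slice_coord[OF c] open_slice_dom[OF c] T
          smooth_on_fst[OF T smooth_on_ident]]) (auto simp: tube_chart_ran_def)
  have a: "smooth_on ?T (\<lambda>x. slice_covector c (fst x) (snd x))"
    by (rule smooth_on_subset[OF smooth_slice_covector[OF c]]) (auto simp: tube_chart_ran_def)
  have t: "smooth_on ?T (\<lambda>x. tube_inv \<mu> (fst (slice_coord c (fst x)), fst (slice_covector c (fst x) (snd x))))"
    by (rule smooth_on_compose[OF smooth_on_tube_inv[OF \<mu>] open_Times[OF open_UNIV open_tube_ran[OF \<mu>]] T])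
      (intro smooth_on_Pair smooth_on_fst T z a, auto simp: tube_chart_ran_def)
  show ?thesis
    unfolding tube_chart_inv_def tube_back_def Let_def
    by (intro smooth_on_Pair smooth_on_fst smooth_on_snd T z a t)
qed

lemma smooth_from_tube:
  "smooth_from (cotangent_atlas A) (tube A N \<tau> \<mu> ` tube_source \<mu> N S)
    (inv_into (tube_source \<mu> N S) (tube A N \<tau> \<mu>))"
proof -
  have *: "smooth_on (snd (cotangent_chart A c) `
      (fst (cotangent_chart A c) \<inter> tube A N \<tau> \<mu> ` tube_source \<mu> N S))
    (inv_into (tube_source \<mu> N S) (tube A N \<tau> \<mu>) \<circ>
      inv_into (fst (cotangent_chart A c)) (snd (cotangent_chart A c)))" if c: "c \<in> A" for c
    unfolding Int_commute[of "fst (cotangent_chart A c)"] tube_chart_image[OF c]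
  proof (rule smooth_on_cong[OF open_tube_chart_ran[OF c] smooth_tube_chart_inv[OF c]])
    fix x assume x: "x \<in> tube_chart_ran c"
    note i = tube_chart_inv[OF c x]
    have "inv_into (fst (cotangent_chart A c)) (snd (cotangent_chart A c)) x
        = tube A N \<tau> \<mu> (tube_chart_inv c x)"
      using inv_into_f_f[OF cotangent_chart_inj[OF A c], of "tube A N \<tau> \<mu> (tube_chart_inv c x)"] i
      by (simp add: mem_cotangent_chart)
    then show "tube_chart_inv c x = (inv_into (tube_source \<mu> N S) (tube A N \<tau> \<mu>) \<circ>
        inv_into (fst (cotangent_chart A c)) (snd (cotangent_chart A c))) x"
      using inv_into_f_f[OF inj_tube i(1)] by simp
  qed
  show ?thesis
    unfolding smooth_from_def split_def
  proof
    fix cc assume "cc \<in> cotangent_atlas A"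
    then obtain c where "c \<in> A" "cc = cotangent_chart A c"
      by (auto simp: cotangent_atlas_def)
    then show "smooth_on (snd cc ` (fst cc \<inter> tube A N \<tau> \<mu> ` tube_source \<mu> N S))
        (inv_into (tube_source \<mu> N S) (tube A N \<tau> \<mu>) \<circ> inv_into (fst cc) (snd cc))"
      using * by (simp only:)
  qed
qed

section \<open>The tangent map of the tube\<close>

lemma tube_source_line:
  assumes x: "x \<in> tube_source \<mu> N S" and v: "v \<in> tube_source_tangent \<mu> N"
  shows "\<forall>\<^sub>F t in nhds 0. lt_curve x v t \<in> tube_source \<mu> N S"
proof -
  obtain g \<nu> \<rho> s \<sigma> where x: "x = (g, (\<nu>, \<rho>), (s, \<sigma>))" "g \<in> SO3" "(\<nu>, \<rho>) \<in> tube_U \<mu>" "s \<in> S" "\<sigma> \<in> N"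
    using x by (auto simp: tube_source_def)
  obtain \<xi> \<nu>' \<rho>' s' \<sigma>' where v: "v = (\<xi>, (\<nu>', \<rho>'), (s', \<sigma>'))" "\<nu>' \<in> isotropy_dual \<mu>"
    "\<rho>' \<in> orbit_tangent \<mu>" "s' \<in> N" "\<sigma>' \<in> N"
    using v by (auto simp: tube_source_tangent_def)
  obtain r where r: "r > -1" "\<nu> = r *\<^sub>R \<mu>" and dom: "(\<nu>, \<rho>) \<in> tube_dom \<mu>" and \<rho>: "\<rho> \<bullet> \<mu> = 0"
    using x(3) tube_U_iff[OF \<mu>] by auto
  obtain r' where r': "\<nu>' = r' *\<^sub>R \<mu>" using v(2) isotropy_dual_iff[OF \<mu>] by auto
  have \<rho>': "\<rho>' \<bullet> \<mu> = 0" using v(3) orbit_tangent_iff[OF \<mu>] by auto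
  have "isCont (\<lambda>t. (\<nu> + t *\<^sub>R \<nu>', \<rho> + t *\<^sub>R \<rho>')) 0" by (intro continuous_intros)
  from isCont_eventually_in[OF this open_tube_dom[OF \<mu>]]
  have "\<forall>\<^sub>F t in nhds 0. (\<nu> + t *\<^sub>R \<nu>', \<rho> + t *\<^sub>R \<rho>') \<in> tube_dom \<mu>" using dom by simp
  moreover have "isCont (\<lambda>t. r + t * r') 0" by (intro continuous_intros)
  from isCont_eventually_in[OF this open_greaterThan[of "-1"]]
  have "\<forall>\<^sub>F t in nhds 0. r + t * r' > -1" using r by simp
  moreover have "\<forall>\<^sub>F t in nhds 0. s + t *\<^sub>R s' \<in> S"
    by (rule openin_subspace_line[OF N S x(4) v(4)])
  ultimately show ?thesis
  proof eventually_elim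
    case (elim t)
    have "\<nu> + t *\<^sub>R \<nu>' = (r + t * r') *\<^sub>R \<mu>" by (simp add: r r' algebra_simps)
    then have "(\<nu> + t *\<^sub>R \<nu>', \<rho> + t *\<^sub>R \<rho>') \<in> tube_U \<mu>"
      unfolding tube_U_iff[OF \<mu>] using elim \<rho> \<rho>' by (auto simp: inner_add_left)
    moreover have "\<sigma> + t *\<^sub>R \<sigma>' \<in> N"
      using x(5) v(5) N by (simp add: subspace_add subspace_scale)
    ultimately show ?case
      using elim x(2) by (simp add: x(1) v(1) lt_curve_def tube_source_def SO3_mult mat_exp_SO3)
  qed
qed

lemma tube_curve_derivative:
  fixes \<rho>' \<xi> :: "real^3" and s \<sigma> s' \<sigma>' :: 'e
  assumes "g \<in> SO3" "(\<nu>, \<rho>) \<in> tube_U \<mu>" "\<nu>' \<in> isotropy_dual \<mu>"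
  defines "F \<equiv> tube_rot \<mu> \<nu> \<rho>" and "\<beta> \<equiv> tube_beta \<mu> (\<nu>, \<rho>) (\<nu>', \<rho>')"
    and "\<Gamma> \<equiv> lt_curve (g, (\<nu>, \<rho>), (s, \<sigma>)) (\<xi>, (\<nu>', \<rho>'), (s', \<sigma>'))"
  shows "((\<lambda>t. tube_base \<mu> (\<Gamma> t)) has_vector_derivative
      (fst (tube_base \<mu> (g, (\<nu>, \<rho>), (s, \<sigma>))) ** hat (F *v (\<xi> - \<beta>)), s')) (at 0)"
    and "((\<lambda>t. tube_mom \<mu> (\<Gamma> t)) has_vector_derivative
      (F *v (\<nu>' + cross3 \<beta> (\<mu> + \<nu>)), \<sigma>')) (at 0)"
proof -
  have line: "((\<lambda>t. a + t *\<^sub>R b) has_vector_derivative b) (at 0)" for a b :: 'e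
    by (auto intro!: derivative_eq_intros)
  note d = tube_map_has_vector_derivative(1)[OF \<mu> assms(2,3), where g = g and \<xi> = \<xi> and \<rho>' = \<rho>']
    tube_map_has_vector_derivative(2)[OF \<mu> assms(2,3), where \<rho>' = \<rho>']
  show "((\<lambda>t. tube_base \<mu> (\<Gamma> t)) has_vector_derivative
      (fst (tube_base \<mu> (g, (\<nu>, \<rho>), (s, \<sigma>))) ** hat (F *v (\<xi> - \<beta>)), s')) (at 0)"
    using has_vector_derivative_Pair[OF d(1) line[of s s']]
    by (simp add: tube_base_def \<Gamma>_def lt_curve_def tube_map_def F_def \<beta>_def)
  show "((\<lambda>t. tube_mom \<mu> (\<Gamma> t)) has_vector_derivative
      (F *v (\<nu>' + cross3 \<beta> (\<mu> + \<nu>)), \<sigma>')) (at 0)"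
    using has_vector_derivative_Pair[OF d(2) line[of \<sigma> \<sigma>']]
    by (simp add: tube_mom_def \<Gamma>_def lt_curve_def tube_map_def F_def \<beta>_def)
qed

text \<open>The velocity is taken in the preferred chart of the cotangent atlas; as \<open>c\<close>
  induces that chart, no change of chart is involved. The derivative exists by
  \<open>smooth_into_tube\<close>, and its position part is found from the base curve. The momentum
  part \<open>P\<close> stays implicit, which is all that \<open>canonical_form_covector\<close>
  asks for.\<close>

lemma tube_velocity:
  assumes x: "x \<in> tube_source \<mu> N S" and v: "v \<in> tube_source_tangent \<mu> N"
    and c: "c \<in> A" "cotangent_chart A c = chart_at (cotangent_atlas A) (tube A N \<tau> \<mu> x)"
      "\<tau> (tube_base \<mu> x) \<in> fst c"
    and base: "((\<lambda>t. tube_base \<mu> (lt_curve x v t)) has_vector_derivative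
      (fst (tube_base \<mu> x) ** hat (fst u), snd u)) (at 0)" "snd u \<in> N"
  obtains P where "lt_tangent_map (cotangent_atlas A) (tube A N \<tau> \<mu>) x v = (of_slice c (tube_base \<mu> x) u, P)"
    "((\<lambda>t. covector c (snd c (\<tau> (tube_base \<mu> (lt_curve x v t)))) (tube_mom \<mu> (lt_curve x v t)))
      has_vector_derivative P) (at 0)"
    "\<forall>\<^sub>F t in nhds 0. tube_base \<mu> (lt_curve x v t) \<in> SO3 \<times> S"
proof -
  let ?G = "lt_curve x v" and ?cc = "cotangent_chart A c" and ?f = "tube A N \<tau> \<mu>"
  have ev: "\<forall>\<^sub>F t in nhds 0. ?G t \<in> tube_source \<mu> N S" by (rule tube_source_line[OF x v])
  have cc: "?cc \<in> cotangent_atlas A" "?f (?G 0) \<in> fst ?cc"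
    using c(1,3) tube_fst[OF x] by (auto simp: cotangent_atlas_def mem_cotangent_chart)
  obtain d where d: "((\<lambda>t. snd ?cc (?f (?G t))) has_vector_derivative d) (at 0)"
    "\<forall>\<^sub>F t in nhds 0. ?f (?G t) \<in> fst ?cc"
    using smooth_into_curve[OF smooth_into_tube cc ev lt_curve_has_vector_derivative] .
  have evX: "\<forall>\<^sub>F t in nhds 0. tube_base \<mu> (?G t) \<in> SO3 \<times> S"
    using ev by (rule eventually_mono) (rule tube_base_in(1))
  have eq: "\<forall>\<^sub>F t in nhds 0. snd ?cc (?f (?G t)) = (snd c (\<tau> (tube_base \<mu> (?G t))),
      covector c (snd c (\<tau> (tube_base \<mu> (?G t)))) (tube_mom \<mu> (?G t)))"
    using ev d(2)
  proof eventually_elim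
    case (elim t)
    then show ?case
      using tube_chart[OF c(1) elim(1)] tube_fst[OF elim(1)]
      by (auto simp: mem_cotangent_chart)
  qed
  note d' = has_vector_derivative_eventually[OF d(1) eq]
  have "((\<lambda>t. snd c (\<tau> (tube_base \<mu> (?G t)))) has_vector_derivative fst d) (at 0)"
    using bounded_linear.has_vector_derivative[OF bounded_linear_fst d'] by simp
  moreover have "((\<lambda>t. snd c (\<tau> (tube_base \<mu> (?G t)))) has_vector_derivative
      of_slice c (tube_base \<mu> x) u) (at 0)"
    by (rule of_slice_curve(1)[OF c(1) tube_base_in(1)[OF x] c(3) base(1) evX _ base(2)]) simp
  ultimately have "fst d = of_slice c (tube_base \<mu> x) u" by (rule vector_derivative_unique_at)
  moreover have "lt_tangent_map (cotangent_atlas A) ?f x v = d"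
    using vector_derivative_at[OF d(1)]
    by (simp add: lt_tangent_map_def velocity_def coord_at_def o_def flip: c(2))
  ultimately have "lt_tangent_map (cotangent_atlas A) ?f x v = (of_slice c (tube_base \<mu> x) u, snd d)"
    by (metis prod.collapse)
  moreover have "((\<lambda>t. covector c (snd c (\<tau> (tube_base \<mu> (?G t)))) (tube_mom \<mu> (?G t)))
      has_vector_derivative snd d) (at 0)"
    using bounded_linear.has_vector_derivative[OF bounded_linear_snd d'] by simp
  ultimately show ?thesis using evX by (rule that)
qed

lemma tube_symplectic:
  assumes x: "x \<in> tube_source \<mu> N S"
    and v1: "v1 \<in> tube_source_tangent \<mu> N" and v2: "v2 \<in> tube_source_tangent \<mu> N"
  shows "canonical_form (lt_tangent_map (cotangent_atlas A) (tube A N \<tau> \<mu>) x v1)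
      (lt_tangent_map (cotangent_atlas A) (tube A N \<tau> \<mu>) x v2) = tube_source_form \<mu> x v1 v2"
proof -
  let ?f = "tube A N \<tau> \<mu>"
  obtain c0 where c0: "c0 \<in> A" "\<tau> (tube_base \<mu> x) \<in> fst c0" using base_chart[OF x] .
  have "?f x \<in> carrier_of (cotangent_atlas A)"
    using carrier_ofI[OF A c0] tube_fst[OF x] by (simp add: carrier_cotangent_atlas mem_Times_iff)
  \<comment> \<open>Preferred charts are chosen independently in the two atlases: this
    \<open>c\<close> need not be \<open>chart_at A\<close> of the base point.\<close>
  from chart_at_in[OF this] obtain c where c: "c \<in> A"
    "cotangent_chart A c = chart_at (cotangent_atlas A) (?f x)" "?f x \<in> fst (cotangent_chart A c)"
    by (auto simp: cotangent_atlas_def)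
  have xc: "\<tau> (tube_base \<mu> x) \<in> fst c"
    using c(3) tube_fst[OF x] by (simp add: mem_cotangent_chart)
  obtain g \<nu> \<rho> s \<sigma> where x': "x = (g, (\<nu>, \<rho>), (s, \<sigma>))" "g \<in> SO3" "(\<nu>, \<rho>) \<in> tube_U \<mu>"
    using x by (auto simp: tube_source_def)
  obtain \<xi>1 \<nu>1 \<rho>1 s1 \<sigma>1 where v1': "v1 = (\<xi>1, (\<nu>1, \<rho>1), (s1, \<sigma>1))" "\<nu>1 \<in> isotropy_dual \<mu>"
    "\<rho>1 \<in> orbit_tangent \<mu>" "s1 \<in> N"
    using v1 by (auto simp: tube_source_tangent_def)
  obtain \<xi>2 \<nu>2 \<rho>2 s2 \<sigma>2 where v2': "v2 = (\<xi>2, (\<nu>2, \<rho>2), (s2, \<sigma>2))" "\<nu>2 \<in> isotropy_dual \<mu>"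
    "\<rho>2 \<in> orbit_tangent \<mu>" "s2 \<in> N"
    using v2 by (auto simp: tube_source_tangent_def)
  let ?F = "tube_rot \<mu> \<nu> \<rho>"
  let ?\<beta>1 = "tube_beta \<mu> (\<nu>, \<rho>) (\<nu>1, \<rho>1)" and ?\<beta>2 = "tube_beta \<mu> (\<nu>, \<rho>) (\<nu>2, \<rho>2)"
  let ?u1 = "(?F *v (\<xi>1 - ?\<beta>1), s1)" and ?u2 = "(?F *v (\<xi>2 - ?\<beta>2), s2)"
  note d1 = tube_curve_derivative[OF x'(2,3) v1'(2),
      where s = s and \<sigma> = \<sigma> and \<xi> = \<xi>1 and \<rho>' = \<rho>1 and s' = s1 and \<sigma>' = \<sigma>1,
      folded x'(1) v1'(1)]
  note d2 = tube_curve_derivative[OF x'(2,3) v2'(2),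
      where s = s and \<sigma> = \<sigma> and \<xi> = \<xi>2 and \<rho>' = \<rho>2 and s' = s2 and \<sigma>' = \<sigma>2,
      folded x'(1) v2'(1)]
  have b1: "((\<lambda>t. tube_base \<mu> (lt_curve x v1 t)) has_vector_derivative
      (fst (tube_base \<mu> x) ** hat (fst ?u1), snd ?u1)) (at 0)" "snd ?u1 \<in> N"
    using d1(1) v1'(4) by simp_all
  have b2: "((\<lambda>t. tube_base \<mu> (lt_curve x v2 t)) has_vector_derivative
      (fst (tube_base \<mu> x) ** hat (fst ?u2), snd ?u2)) (at 0)" "snd ?u2 \<in> N"
    using d2(1) v2'(4) by simp_all
  obtain P1 where P1: "lt_tangent_map (cotangent_atlas A) ?f x v1 = (of_slice c (tube_base \<mu> x) ?u1, P1)"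
    "((\<lambda>t. covector c (snd c (\<tau> (tube_base \<mu> (lt_curve x v1 t)))) (tube_mom \<mu> (lt_curve x v1 t)))
      has_vector_derivative P1) (at 0)"
    "\<forall>\<^sub>F t in nhds 0. tube_base \<mu> (lt_curve x v1 t) \<in> SO3 \<times> S"
    using tube_velocity[OF x v1 c(1,2) xc b1] .
  obtain P2 where P2: "lt_tangent_map (cotangent_atlas A) ?f x v2 = (of_slice c (tube_base \<mu> x) ?u2, P2)"
    "((\<lambda>t. covector c (snd c (\<tau> (tube_base \<mu> (lt_curve x v2 t)))) (tube_mom \<mu> (lt_curve x v2 t)))
      has_vector_derivative P2) (at 0)"
    "\<forall>\<^sub>F t in nhds 0. tube_base \<mu> (lt_curve x v2 t) \<in> SO3 \<times> S"
    using tube_velocity[OF x v2 c(1,2) xc b2] .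
  have "canonical_form (lt_tangent_map (cotangent_atlas A) ?f x v1) (lt_tangent_map (cotangent_atlas A) ?f x v2)
      = fst (tube_mom \<mu> x) \<bullet> cross3 (fst ?u1) (fst ?u2)
        + (?F *v (\<nu>2 + cross3 ?\<beta>2 (\<mu> + \<nu>)), \<sigma>2) \<bullet> ?u1 - (?F *v (\<nu>1 + cross3 ?\<beta>1 (\<mu> + \<nu>)), \<sigma>1) \<bullet> ?u2"
    unfolding P1(1) P2(1)
    by (rule canonical_form_covector[OF c(1) tube_base_in(1)[OF x] xc
          b1(1) P1(3) _ b1(2) d1(2) _ P1(2) b2(1) P2(3) _ b2(2) d2(2) _ P2(2)]) simp_all
  also have "fst (tube_mom \<mu> x) = ?F *v (\<mu> + \<nu>)"
    by (simp add: x'(1) tube_mom_def tube_map_def)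
  finally show ?thesis
    using tube_map_symplectic[OF \<mu> x'(3) v1'(2) v2'(2) v1'(3) v2'(3), of \<xi>1 \<xi>2 g]
    by (simp add: tube_source_form_def x'(1) v1'(1) v2'(1) canonical_form_def inner_prod_def)
qed

theorem tube_symplectomorphism:
  "symplectomorphism_onto_image (tube_source \<mu> N S) (tube_source_tangent \<mu> N)
    (tube_source_form \<mu>) A (tube A N \<tau> \<mu>)"
  unfolding symplectomorphism_onto_image_def diffeo_onto_open_def
  using inj_tube openin_tube smooth_into_tube smooth_from_tube tube_symplectic by blast

end

subsection \<open>Uniqueness of geodesics\<close>

text \<open>The mean value inequality on a convex ball. Compactness bounds the values of the
  derivative on \<open>Basis\<close>, and the sum of their norms bounds the operator norm.\<close>

lemma smooth_on_locally_lipschitz: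
  fixes f :: "'a::euclidean_space \<Rightarrow> 'b::real_normed_vector"
  assumes U: "open U" "smooth_on U f" "p \<in> U"
  obtains r L where "r > 0" "L \<ge> 0" "cball p r \<subseteq> U"
    "\<And>x y. x \<in> cball p r \<Longrightarrow> y \<in> cball p r \<Longrightarrow> norm (f x - f y) \<le> L * norm (x - y)"
proof -
  obtain r where r: "r > 0" "cball p r \<subseteq> U"
    using U(1,3) open_contains_cball by blast
  let ?D = "\<lambda>x. frechet_derivative f (at x)"
  let ?N = "\<lambda>x. \<Sum>b\<in>Basis. norm (?D x b)"
  have "continuous_on (cball p r) ?N"
    by (intro continuous_on_sum continuous_on_norm continuous_on_subset[OF _ r(2)]
        smooth_on_imp_continuous_on smooth_on_frechet U(2))
  then have "compact (?N ` cball p r)"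
    by (rule compact_continuous_image) (rule compact_cball)
  then have "bounded (?N ` cball p r)" by (rule compact_imp_bounded)
  then obtain B where "\<forall>y\<in>?N ` cball p r. \<bar>y\<bar> \<le> B"
    unfolding bounded_real by blast
  then have B: "\<bar>?N x\<bar> \<le> B" if "x \<in> cball p r" for x
    using that by blast
  have der: "(f has_derivative ?D x) (at x)" if "x \<in> cball p r" for x
    using smooth_on_has_derivative[OF U(2)] r(2) that by blast
  have onorm: "onorm (?D x) \<le> \<bar>B\<bar>" if x: "x \<in> cball p r" for x
  proof (rule onorm_bound)
    fix w
    have "norm (?D x w) = norm (\<Sum>b\<in>Basis. (w \<bullet> b) *\<^sub>R ?D x b)"
      by (simp only: linear_euclidean_expand[OF has_derivative_linear[OF der[OF x]], of w])
    also have "\<dots> \<le> (\<Sum>b\<in>Basis. norm ((w \<bullet> b) *\<^sub>R ?D x b))"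
      by (rule norm_sum)
    also have "\<dots> \<le> (\<Sum>b\<in>Basis. norm w * norm (?D x b))"
      by (intro sum_mono) (simp add: Basis_le_norm mult_right_mono)
    also have "\<dots> = ?N x * norm w" by (simp add: sum_distrib_left mult.commute)
    also have "\<dots> \<le> \<bar>B\<bar> * norm w"
      using B[OF x] by (intro mult_right_mono) auto
    finally show "norm (?D x w) \<le> \<bar>B\<bar> * norm w" .
  qed simp
  have "norm (f x - f y) \<le> \<bar>B\<bar> * norm (x - y)" if "x \<in> cball p r" "y \<in> cball p r" for x y
    by (rule differentiable_bound[OF convex_cball has_derivative_at_withinI[OF der] onorm that(1,2)])
  then show ?thesis using that[of r "\<bar>B\<bar>"] r by auto
qed

text \<open>Gronwall's argument: the squared norm of \<open>z t\<close> times exp (- 2 C t) does not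
  increase, and it starts at 0.\<close>

lemma linear_growth_zero:
  fixes z :: "real \<Rightarrow> 'a::real_inner"
  assumes z: "\<And>t. a \<le> t \<Longrightarrow> t \<le> b \<Longrightarrow> (z has_vector_derivative z' t) (at t)"
    and bound: "\<And>t. a \<le> t \<Longrightarrow> t \<le> b \<Longrightarrow> norm (z' t) \<le> C * norm (z t)"
    and "z a = 0" "a \<le> b"
  shows "z b = 0"
proof -
  let ?E = "\<lambda>t. (z t \<bullet> z t) * exp (- (2 * C) * t)"
  have "\<exists>y. DERIV ?E t :> y \<and> y \<le> 0" if t: "a \<le> t" "t \<le> b" for t
  proof -
    have "((\<lambda>t. z t \<bullet> z t) has_vector_derivative (z t \<bullet> z' t + z' t \<bullet> z t)) (at t)"
      by (rule bounded_bilinear.has_vector_derivative[OF bounded_bilinear_inner z[OF t] z[OF t]])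
    then have "DERIV (\<lambda>t. z t \<bullet> z t) t :> 2 * (z t \<bullet> z' t)"
      by (simp add: has_real_derivative_iff_has_vector_derivative inner_commute)
    moreover have "DERIV (\<lambda>t. exp (- (2 * C) * t)) t :> - (2 * C) * exp (- (2 * C) * t)"
      by (auto intro!: derivative_eq_intros)
    ultimately have E: "DERIV ?E t :> 2 * (z t \<bullet> z' t) * exp (- (2 * C) * t)
        + (- (2 * C) * exp (- (2 * C) * t)) * (z t \<bullet> z t)"
      by (rule DERIV_mult)
    have "2 * (z t \<bullet> z' t) * exp (- (2 * C) * t)
        + (- (2 * C) * exp (- (2 * C) * t)) * (z t \<bullet> z t)
        = (2 * exp (- (2 * C) * t)) * (z t \<bullet> z' t - C * (z t \<bullet> z t))"
      by (simp add: algebra_simps)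
    moreover have "z t \<bullet> z' t \<le> C * (z t \<bullet> z t)"
    proof -
      have "z t \<bullet> z' t \<le> norm (z t) * norm (z' t)" by (rule norm_cauchy_schwarz)
      also have "\<dots> \<le> norm (z t) * (C * norm (z t))"
        by (rule mult_left_mono[OF bound[OF t] norm_ge_zero])
      also have "\<dots> = C * (z t \<bullet> z t)"
        by (simp add: power2_norm_eq_inner[symmetric] power2_eq_square)
      finally show ?thesis .
    qed
    then have "(2 * exp (- (2 * C) * t)) * (z t \<bullet> z' t - C * (z t \<bullet> z t)) \<le> 0"
      by (intro mult_nonneg_nonpos) auto
    ultimately show ?thesis
      using E by (intro exI conjI) (assumption, simp only:)
  qed
  then have "?E b \<le> ?E a"
    by (rule DERIV_nonpos_imp_nonincreasing[OF \<open>a \<le> b\<close>])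
  then have "z b \<bullet> z b \<le> 0"
    using \<open>z a = 0\<close> by (simp add: mult_le_0_iff)
  then show ?thesis by (metis inner_eq_zero_iff inner_ge_zero order_antisym)
qed

section \<open>The geodesic equation in one chart\<close>

locale metric_on =
  fixes \<Omega> :: "'e::euclidean_space set" and G :: "'e \<Rightarrow> 'e \<Rightarrow> 'e \<Rightarrow> real"
  assumes open_\<Omega>: "open \<Omega>" and smooth_G: "\<And>u v. smooth_on \<Omega> (\<lambda>y. G y u v)"
    and bilinear_G: "\<And>y. y \<in> \<Omega> \<Longrightarrow> bilinear (G y)"
    and pos_G: "\<And>y v. y \<in> \<Omega> \<Longrightarrow> v \<noteq> 0 \<Longrightarrow> G y v v > 0"
begin

text \<open>\<open>christoffel\<close> with its two velocity arguments equal, as in the geodesic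
  equation; the repeated summand keeps it a literal instance.\<close>

definition Chr :: "'e \<Rightarrow> 'e \<Rightarrow> 'e \<Rightarrow> real" where
  "Chr y u w = (let D = (\<lambda>a b. frechet_derivative (\<lambda>z. G z a b) (at y))
     in (D u w u + D u w u - D u u w) / 2)"

lemma G_expand: "y \<in> \<Omega> \<Longrightarrow> G y u v = (\<Sum>i\<in>Basis. (u \<bullet> i) *\<^sub>R G y i v)"
  by (rule linear_euclidean_expand) (use bilinear_G in \<open>auto simp: bilinear_def\<close>)

lemma G_expand2: "y \<in> \<Omega> \<Longrightarrow> G y u v = (\<Sum>i\<in>Basis. (v \<bullet> i) *\<^sub>R G y u i)"
  by (rule linear_euclidean_expand) (use bilinear_G in \<open>auto simp: bilinear_def\<close>)

lemma deriv_G_sum: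
  assumes y: "y \<in> \<Omega>" and eq: "\<And>z. z \<in> \<Omega> \<Longrightarrow> G z u v = (\<Sum>i\<in>I. c i *\<^sub>R G z (a i) (b i))"
  shows "frechet_derivative (\<lambda>z. G z u v) (at y) r
    = (\<Sum>i\<in>I. c i *\<^sub>R frechet_derivative (\<lambda>z. G z (a i) (b i)) (at y) r)"
proof -
  have "((\<lambda>z. \<Sum>i\<in>I. c i *\<^sub>R G z (a i) (b i)) has_derivative
      (\<lambda>r. \<Sum>i\<in>I. c i *\<^sub>R frechet_derivative (\<lambda>z. G z (a i) (b i)) (at y) r)) (at y)"
    by (intro has_derivative_sum has_derivative_scaleR_right smooth_on_has_derivative[OF smooth_G y])
  then have "((\<lambda>z. G z u v) has_derivative
      (\<lambda>r. \<Sum>i\<in>I. c i *\<^sub>R frechet_derivative (\<lambda>z. G z (a i) (b i)) (at y) r)) (at y)"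
    by (rule has_derivative_transform_within_open[OF _ open_\<Omega> y]) (simp add: eq)
  then show ?thesis
    by (rule fun_cong[OF frechet_derivative_at[symmetric]])
qed

text \<open>The left-hand side of the geodesic equation at position \<open>y\<close>, velocity \<open>u\<close> and
  acceleration \<open>a\<close>, as a vector.\<close>

definition spray :: "'e \<times> 'e \<times> 'e \<Rightarrow> 'e" where
  "spray = (\<lambda>(y, u, a). \<Sum>e\<in>Basis. (G y a e + Chr y u e) *\<^sub>R e)"

text \<open>Smoothness of \<open>G\<close> is given for constant vectors only, so velocity and
  acceleration are expanded in \<open>Basis\<close> and \<open>G\<close> is left with basis
  vectors.\<close>

lemma smooth_spray: "smooth_on (\<Omega> \<times> UNIV) spray"
proof -
  let ?T = "\<Omega> \<times> UNIV :: ('e \<times> 'e \<times> 'e) set"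
  have T: "open ?T" by (intro open_Times open_\<Omega> open_UNIV)
  have y: "smooth_on ?T fst" and u: "smooth_on ?T (\<lambda>x. fst (snd x))" and a: "smooth_on ?T (\<lambda>x. snd (snd x))"
    by (intro smooth_on_fst smooth_on_snd smooth_on_ident T)+
  have G: "smooth_on ?T (\<lambda>x. G (fst x) v w)" for v w
    by (rule smooth_on_compose[OF smooth_G open_\<Omega> T y]) auto
  have D: "smooth_on ?T (\<lambda>x. frechet_derivative (\<lambda>z. G z v w) (at (fst x)) (r x))"
    if "smooth_on ?T r" for v w and r :: "'e \<times> 'e \<times> 'e \<Rightarrow> 'e"
    by (rule smooth_on_frechet_compose[OF smooth_G open_\<Omega> T y _ that]) auto
  let ?S = "\<lambda>x. \<Sum>e\<in>Basis. ((\<Sum>i\<in>Basis. (snd (snd x) \<bullet> i) *\<^sub>R G (fst x) i e)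
      + ((\<Sum>i\<in>Basis. (fst (snd x) \<bullet> i) *\<^sub>R frechet_derivative (\<lambda>z. G z i e) (at (fst x)) (fst (snd x)))
        - (\<Sum>i\<in>Basis. (fst (snd x) \<bullet> i) *\<^sub>R (\<Sum>j\<in>Basis. (fst (snd x) \<bullet> j) *\<^sub>R
            frechet_derivative (\<lambda>z. G z i j) (at (fst x)) e)) / 2)) *\<^sub>R e"
  have "smooth_on ?T ?S"
    by (intro smooth_on_sum smooth_on_scaleR smooth_on_add smooth_on_diff smooth_on_divide
        smooth_on_inner smooth_on_const D G T y u a) simp
  then show ?thesis
  proof (rule smooth_on_cong[OF T])
    fix x assume "x \<in> ?T"
    then obtain p v a where x: "x = (p, v, a)" "p \<in> \<Omega>" by (cases x) auto
    have 1: "frechet_derivative (\<lambda>z. G z v e) (at p) r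
        = (\<Sum>i\<in>Basis. (v \<bullet> i) *\<^sub>R frechet_derivative (\<lambda>z. G z i e) (at p) r)" for e r
      by (rule deriv_G_sum[OF x(2) G_expand])
    have 2: "frechet_derivative (\<lambda>z. G z i v) (at p) r
        = (\<Sum>j\<in>Basis. (v \<bullet> j) *\<^sub>R frechet_derivative (\<lambda>z. G z i j) (at p) r)" for i r
      by (rule deriv_G_sum[OF x(2) G_expand2])
    have "Chr p v e = (\<Sum>i\<in>Basis. (v \<bullet> i) *\<^sub>R frechet_derivative (\<lambda>z. G z i e) (at p) v)
        - (\<Sum>i\<in>Basis. (v \<bullet> i) *\<^sub>R (\<Sum>j\<in>Basis. (v \<bullet> j) *\<^sub>R
            frechet_derivative (\<lambda>z. G z i j) (at p) e)) / 2" for e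
      unfolding Chr_def Let_def 2[symmetric] 1[symmetric] by (simp add: field_simps)
    then show "?S x = spray x"
      by (simp add: spray_def x(1) G_expand[OF x(2), of a])
  qed
qed

text \<open>\<open>spray\<close> is affine in the acceleration, with linear part
  \<open>G y\<close>.\<close>

lemma spray_diff_inner:
  assumes "y \<in> \<Omega>"
  shows "(spray (y, u, a) - spray (y, u, a')) \<bullet> (a - a') = G y (a - a') (a - a')"
proof -
  have "spray (y, u, a) - spray (y, u, a') = (\<Sum>e\<in>Basis. G y (a - a') e *\<^sub>R e)"
    using bilinear_lsub[OF bilinear_G[OF assms], of a a']
    by (simp add: spray_def sum_subtractf[symmetric] scaleR_diff_left[symmetric])
  moreover have "(\<Sum>e\<in>Basis. G y (a - a') e *\<^sub>R e) \<bullet> (a - a')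
      = (\<Sum>e\<in>Basis. ((a - a') \<bullet> e) *\<^sub>R G y (a - a') e)"
    unfolding inner_sum_left inner_scaleR_left real_scaleR_def
    by (intro sum.cong refl) (simp only: inner_commute mult.commute)
  ultimately show ?thesis
    using G_expand2[OF assms, of "a - a'" "a - a'"] by simp
qed

text \<open>The quadratic form attains a positive minimum on a compact ball times the unit sphere;
  other vectors follow by scaling.\<close>

lemma G_coercive:
  assumes "p \<in> \<Omega>"
  obtains r m where "r > 0" "m > 0" "\<And>y d. y \<in> cball p r \<Longrightarrow> m * (norm d)\<^sup>2 \<le> G y d d"
proof -
  obtain r where r: "r > 0" "cball p r \<subseteq> \<Omega>"
    using open_\<Omega> assms open_contains_cball by blast
  let ?K = "cball p r \<times> sphere (0::'e) 1"
  \<comment> \<open>Joint continuity in point and vector is available for this expansion, in which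
    \<open>G\<close> is applied to basis vectors.\<close>
  let ?S = "\<lambda>x. \<Sum>i\<in>Basis. (snd x \<bullet> i) *\<^sub>R (\<Sum>j\<in>Basis. (snd x \<bullet> j) *\<^sub>R G (fst x) i j)"
  have S: "?S x = G (fst x) (snd x) (snd x)" if "fst x \<in> \<Omega>" for x
    by (simp only: G_expand2[OF that, symmetric] G_expand[OF that, symmetric])
  have "continuous_on ?K (\<lambda>x. G (fst x) i j)" for i j
    by (rule continuous_on_compose2[OF smooth_on_imp_continuous_on[OF smooth_G]])
      (use r in \<open>auto intro!: continuous_intros\<close>)
  then have cont: "continuous_on ?K ?S"
    by (intro continuous_intros)
  have comp: "compact ?K" by (intro compact_Times compact_cball compact_sphere)
  obtain b :: 'e where "b \<in> Basis" using nonempty_Basis by blast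
  then have ne: "?K \<noteq> {}" using r(1) by (auto intro!: exI[of _ p] exI[of _ b])
  obtain x where x: "x \<in> ?K" and min0: "\<forall>y\<in>?K. ?S x \<le> ?S y"
    using continuous_attains_inf[OF comp ne cont] by (rule bexE)
  have min: "?S x \<le> ?S y" if "y \<in> ?K" for y by (rule bspec[OF min0 that])
  have x\<Omega>: "fst x \<in> \<Omega>" "snd x \<noteq> 0" using x r(2) by auto
  have pos: "?S x > 0" unfolding S[OF x\<Omega>(1)] by (rule pos_G[OF x\<Omega>])
  have "?S x * (norm d)\<^sup>2 \<le> G y d d" if y: "y \<in> cball p r" for y d
  proof (cases "d = 0")
    case True
    then show ?thesis using bilinear_lzero[OF bilinear_G] y r(2) by auto
  next
    case False
    have y\<Omega>: "y \<in> \<Omega>" using y r(2) by blast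
    have "?S x \<le> ?S (y, d /\<^sub>R norm d)"
      using False y by (intro min) simp
    also have "\<dots> = G y (d /\<^sub>R norm d) (d /\<^sub>R norm d)"
      using S[of "(y, d /\<^sub>R norm d)"] y\<Omega> by simp
    also have "\<dots> = G y d d / (norm d)\<^sup>2"
      by (simp only: bilinear_lmul[OF bilinear_G[OF y\<Omega>]] bilinear_rmul[OF bilinear_G[OF y\<Omega>]])
        (simp add: divide_inverse power2_eq_square)
    finally show ?thesis
      using False by (simp add: pos_le_divide_eq)
  qed
  then show ?thesis using that[OF r(1) pos] by blast
qed

text \<open>The geodesic equation gives the acceleration only implicitly. Instead of inverting the
  metric, coercivity bounds \<open>a1 - a2\<close>: \<open>spray\<close> vanishes along both
  solutions, so inserting \<open>a2\<close> into the first one leaves an error that the Lipschitz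
  bound controls by the differences of positions and velocities. Gronwall's argument then applies to
  these differences.\<close>

lemma local_uniqueness:
  assumes I: "open I" "T \<in> I"
    and x1: "\<And>t. t \<in> I \<Longrightarrow> (x1 has_vector_derivative v1 t) (at t)"
      "\<And>t. t \<in> I \<Longrightarrow> (v1 has_vector_derivative a1 t) (at t)" "\<And>t. t \<in> I \<Longrightarrow> x1 t \<in> \<Omega>"
      "\<And>t w. t \<in> I \<Longrightarrow> G (x1 t) (a1 t) w + Chr (x1 t) (v1 t) w = 0"
    and x2: "\<And>t. t \<in> I \<Longrightarrow> (x2 has_vector_derivative v2 t) (at t)"
      "\<And>t. t \<in> I \<Longrightarrow> (v2 has_vector_derivative a2 t) (at t)" "\<And>t. t \<in> I \<Longrightarrow> x2 t \<in> \<Omega>"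
      "\<And>t w. t \<in> I \<Longrightarrow> G (x2 t) (a2 t) w + Chr (x2 t) (v2 t) w = 0"
    and a2: "continuous_on I a2" and init: "x1 T = x2 T" "v1 T = v2 T"
  obtains \<delta> where "\<delta> > 0" "\<And>t. T \<le> t \<Longrightarrow> t < T + \<delta> \<Longrightarrow> x1 t = x2 t"
proof -
  \<comment> \<open>\<open>spray\<close> will be compared at the common acceleration
    \<open>a2 t\<close>, hence \<open>a2 T\<close> in the centre of the ball.\<close>
  let ?p = "(x1 T, v1 T, a2 T)"
  have p: "?p \<in> \<Omega> \<times> UNIV" using x1(3)[OF I(2)] by simp
  obtain r L where rL: "r > 0" "L \<ge> 0" "cball ?p r \<subseteq> \<Omega> \<times> UNIV"
    "\<And>x y. x \<in> cball ?p r \<Longrightarrow> y \<in> cball ?p r \<Longrightarrow> norm (spray x - spray y) \<le> L * norm (x - y)"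
    using smooth_on_locally_lipschitz[OF open_Times[OF open_\<Omega> open_UNIV] smooth_spray p] by blast
  obtain r' m where rm: "r' > 0" "m > 0" "\<And>y d. y \<in> cball (x1 T) r' \<Longrightarrow> m * (norm d)\<^sup>2 \<le> G y d d"
    using G_coercive[OF x1(3)[OF I(2)]] by blast
  have cont: "isCont x1 T" "isCont v1 T" "isCont x2 T" "isCont v2 T" "isCont a2 T"
    using has_vector_derivative_continuous[OF x1(1)[OF I(2)]]
      has_vector_derivative_continuous[OF x1(2)[OF I(2)]]
      has_vector_derivative_continuous[OF x2(1)[OF I(2)]]
      has_vector_derivative_continuous[OF x2(2)[OF I(2)]] I a2
    by (simp_all add: continuous_on_eq_continuous_at)
  have c: "isCont (\<lambda>t. (x1 t, v1 t, a2 t)) T" "isCont (\<lambda>t. (x2 t, v2 t, a2 t)) T"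
    by (intro continuous_Pair cont)+
  have "\<forall>\<^sub>F t in nhds T. (x1 t, v1 t, a2 t) \<in> ball ?p r"
    by (rule isCont_eventually_in[OF c(1) open_ball]) (use rL(1) in simp)
  moreover have "\<forall>\<^sub>F t in nhds T. (x2 t, v2 t, a2 t) \<in> ball ?p r"
    by (rule isCont_eventually_in[OF c(2) open_ball]) (use rL(1) init in simp)
  moreover have "\<forall>\<^sub>F t in nhds T. x1 t \<in> ball (x1 T) r'"
    by (rule isCont_eventually_in[OF cont(1)]) (use rm(1) in simp_all)
  moreover have "\<forall>\<^sub>F t in nhds T. t \<in> I"
    using I eventually_nhds by blast
  ultimately have "\<forall>\<^sub>F t in nhds T. t \<in> I \<and> (x1 t, v1 t, a2 t) \<in> cball ?p r
      \<and> (x2 t, v2 t, a2 t) \<in> cball ?p r \<and> x1 t \<in> cball (x1 T) r'"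
    by eventually_elim (auto intro: less_imp_le)
  then obtain \<delta> where \<delta>: "\<delta> > 0" "\<And>t. dist t T < \<delta> \<Longrightarrow> t \<in> I \<and> (x1 t, v1 t, a2 t) \<in> cball ?p r
      \<and> (x2 t, v2 t, a2 t) \<in> cball ?p r \<and> x1 t \<in> cball (x1 T) r'"
    unfolding eventually_nhds_metric by blast
  let ?z = "\<lambda>t. (x1 t - x2 t, v1 t - v2 t)"
  let ?z' = "\<lambda>t. (v1 t - v2 t, a1 t - a2 t)"
  have spray0: "spray (x1 t, v1 t, a1 t) = 0" "spray (x2 t, v2 t, a2 t) = 0" if "t \<in> I" for t
    using x1(4)[OF that] x2(4)[OF that] by (simp_all add: spray_def)
  have acc: "norm (a1 t - a2 t) \<le> L / m * norm (?z t)" if t: "dist t T < \<delta>" for t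
  proof -
    note h = \<delta>(2)[OF t]
    let ?d = "a1 t - a2 t" and ?q = "(x1 t, v1 t, a2 t)" and ?q' = "(x2 t, v2 t, a2 t)"
    have "m * (norm ?d)\<^sup>2 \<le> G (x1 t) ?d ?d" using rm(3) h by blast
    also have "\<dots> = (spray (x1 t, v1 t, a1 t) - spray ?q) \<bullet> ?d"
      using spray_diff_inner[OF x1(3)] h by simp
    also have "\<dots> = (spray ?q' - spray ?q) \<bullet> ?d"
      using spray0 h by simp
    also have "\<dots> \<le> norm (spray ?q' - spray ?q) * norm ?d"
      by (rule norm_cauchy_schwarz)
    also have "\<dots> \<le> (L * norm (?q' - ?q)) * norm ?d"
      by (rule mult_right_mono[OF rL(4) norm_ge_zero]) (use h in blast)+
    also have "norm (?q' - ?q) = norm (?z t)"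
      by (simp add: norm_Pair norm_minus_commute)
    finally have "m * norm ?d * norm ?d \<le> L * norm (?z t) * norm ?d"
      by (simp add: power2_eq_square mult.assoc)
    then have "m * norm ?d \<le> L * norm (?z t)"
      using rL(2) by (cases "norm ?d = 0") (auto dest: mult_right_le_imp_le)
    then show ?thesis
      using rm(2) by (simp add: pos_le_divide_eq mult.commute)
  qed
  have "x1 t = x2 t" if t: "T \<le> t" "t < T + \<delta>" for t
  proof -
    have "?z t = 0"
    proof (rule linear_growth_zero[OF _ _ _ t(1)])
      fix s assume s: "T \<le> s" "s \<le> t"
      then have d: "dist s T < \<delta>" using t by (simp add: dist_real_def)
      then have sI: "s \<in> I" using \<delta>(2) by blast
      show "(?z has_vector_derivative ?z' s) (at s)"
        by (intro has_vector_derivative_Pair has_vector_derivative_diff x1 x2 sI)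
      have "norm (?z' s) \<le> norm (v1 s - v2 s) + norm (a1 s - a2 s)"
        using norm_Pair_le by blast
      also have "\<dots> \<le> norm (?z s) + L / m * norm (?z s)"
        by (intro add_mono acc[OF d]) (metis norm_snd_le snd_conv)
      finally show "norm (?z' s) \<le> (1 + L / m) * norm (?z s)"
        by (simp add: distrib_right)
    qed (simp add: init zero_prod_def)
    then show ?thesis by (simp add: zero_prod_def)
  qed
  then show ?thesis using that[OF \<delta>(1)] by blast
qed

end

section \<open>Geodesics on the manifold\<close>

context
  fixes A :: "('q, 'e::euclidean_space) chart set" and W :: "'q set" and h :: "'q \<Rightarrow> 'e \<Rightarrow> 'e \<Rightarrow> real"
  assumes A: "smooth_manifold A" and W: "openin (manifold_topology A) W"
    and h: "riemannian_metric A W h"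
begin

lemma metric_on_chart:
  assumes c: "c \<in> A"
  shows "metric_on (snd c ` (fst c \<inter> W)) (metric_coord A h c)"
proof
  show "open (snd c ` (fst c \<inter> W))"
    using W c openin_manifold_topology[of A, OF chart_inj[OF A]] by (auto simp: Int_commute)
  show "smooth_on (snd c ` (fst c \<inter> W)) (\<lambda>y. metric_coord A h c y u v)" for u v
    using h c unfolding riemannian_metric_def by blast
  fix y assume "y \<in> snd c ` (fst c \<inter> W)"
  then obtain q where q: "q \<in> fst c" "q \<in> W" "y = snd c q" by blast
  have c': "chart_at A q \<in> A" "q \<in> fst (chart_at A q)"
    using chart_at_in[OF carrier_ofI[OF A c q(1)]] by auto
  have G: "metric_coord A h c y u v = h q (from_chart A c q u) (from_chart A c q v)" for u v
    by (simp add: metric_coord_def q(3) chart_inv[OF A c q(1)])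
  have lin: "linear (from_chart A c q)"
    unfolding from_chart_eq by (rule linear_transition_deriv[OF A c c'(1) q(1) c'(2)])
  have hq: "bilinear (h q)" "\<And>v. v \<noteq> 0 \<Longrightarrow> h q v v > 0"
    using h q(2) unfolding riemannian_metric_def by blast+
  show "bilinear (metric_coord A h c y)"
    using hq(1) unfolding bilinear_def G
    by (auto simp: linear_iff linear_add[OF lin] linear_scale[OF lin])
  show "metric_coord A h c y v v > 0" if "v \<noteq> 0" for v
  proof -
    have "from_chart A c q v \<noteq> 0"
    proof
      assume "from_chart A c q v = 0"
      then have "v = transition_deriv (chart_at A q) c q 0"
        using transition_deriv_inverse[OF A c c'(1) q(1) c'(2), of v] by (simp add: from_chart_eq)
      then show False
        using that linear_0[OF linear_transition_deriv[OF A c'(1) c c'(2) q(1)]] by simp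
    qed
    then show ?thesis unfolding G by (rule hq(2))
  qed
qed

text \<open>\<open>geodesic\<close> speaks of iterated \<open>vector_derivative\<close>, which is a
  description. A smooth extension of the curve in the chart supplies genuine velocity and
  acceleration functions, continuous near \<open>t0\<close>.\<close>

lemma geodesic_chart:
  assumes \<gamma>: "geodesic A W h J \<gamma>" and J: "open J" "t0 \<in> J" and c: "c \<in> A" "\<gamma> t0 \<in> fst c"
  obtains I v a where "open I" "t0 \<in> I" "I \<subseteq> J" "continuous_on I a" "continuous_on I v"
    "\<And>t. t \<in> I \<Longrightarrow> \<gamma> t \<in> fst c \<inter> W"
    "\<And>t. t \<in> I \<Longrightarrow> ((\<lambda>t. snd c (\<gamma> t)) has_vector_derivative v t) (at t)"
    "\<And>t. t \<in> I \<Longrightarrow> (v has_vector_derivative a t) (at t)"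
    "\<And>t w. t \<in> I \<Longrightarrow> metric_coord A h c (snd c (\<gamma> t)) (a t) w
      + christoffel A h c (snd c (\<gamma> t)) (v t) (v t) w = 0"
proof -
  have smooth: "smooth_into J A \<gamma>" and JW: "\<gamma> ` J \<subseteq> W"
    and eq: "\<And>t w. t \<in> J \<Longrightarrow> \<gamma> t \<in> fst c \<Longrightarrow> metric_coord A h c ((snd c \<circ> \<gamma>) t)
        (vector_derivative (\<lambda>r. vector_derivative (snd c \<circ> \<gamma>) (at r)) (at t)) w
      + christoffel A h c ((snd c \<circ> \<gamma>) t) (vector_derivative (snd c \<circ> \<gamma>) (at t))
        (vector_derivative (snd c \<circ> \<gamma>) (at t)) w = 0"
    using \<gamma> c(1) unfolding geodesic_def Let_def by blast+
  obtain Y k where k: "open Y" "t0 \<in> Y" "smooth_on Y k" "\<And>t. t \<in> J \<Longrightarrow> t \<in> Y \<Longrightarrow> \<gamma> t \<in> fst c"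
    "\<And>t. t \<in> J \<Longrightarrow> t \<in> Y \<Longrightarrow> snd c (\<gamma> t) = k t"
    using smooth_intoD[OF smooth J(2) c] by blast
  define v where "v t = frechet_derivative k (at t) 1" for t
  define a where "a t = frechet_derivative v (at t) 1" for t
  have v: "smooth_on Y v" unfolding v_def by (rule smooth_on_frechet[OF k(3)])
  have a: "smooth_on Y a" unfolding a_def by (rule smooth_on_frechet[OF v])
  have vd: "(f has_vector_derivative frechet_derivative f (at t) 1) (at t)"
    if "smooth_on Y f" "t \<in> Y" for f :: "real \<Rightarrow> 'e" and t
  proof -
    note d = smooth_on_has_derivative[OF that]
    have "x *\<^sub>R frechet_derivative f (at t) 1 = frechet_derivative f (at t) x" for x
      using linear_scale[OF has_derivative_linear[OF d], of x 1] by simp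
    then show ?thesis
      using d by (simp only: has_vector_derivative_def)
  qed
  let ?I = "J \<inter> Y"
  have I: "open ?I" using J k by auto
  have d: "((\<lambda>t. snd c (\<gamma> t)) has_vector_derivative v t) (at t)" if "t \<in> ?I" for t
    by (rule has_vector_derivative_transform_within_open[OF vd[OF k(3)] I that, folded v_def])
      (use that k(5) in auto)
  have d': "(v has_vector_derivative a t) (at t)" if "t \<in> ?I" for t
    unfolding a_def using vd[OF v] that by blast
  have v_eq: "vector_derivative (snd c \<circ> \<gamma>) (at t) = v t" if "t \<in> ?I" for t
    using vector_derivative_at[OF d[OF that]] by (simp add: o_def)
  have "((\<lambda>r. vector_derivative (snd c \<circ> \<gamma>) (at r)) has_vector_derivative a t) (at t)" if "t \<in> ?I" for t
    by (rule has_vector_derivative_transform_within_open[OF d'[OF that] I that]) (simp add: v_eq)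
  then have a_eq: "vector_derivative (\<lambda>r. vector_derivative (snd c \<circ> \<gamma>) (at r)) (at t) = a t"
    if "t \<in> ?I" for t
    using that by (intro vector_derivative_at) auto
  show ?thesis
  proof (rule that[OF I _ _ _ _ _ d d'])
    show "t0 \<in> ?I" "?I \<subseteq> J" using J k by auto
    show "continuous_on ?I a" "continuous_on ?I v"
      using smooth_on_imp_continuous_on[OF a] smooth_on_imp_continuous_on[OF v]
      by (auto intro: continuous_on_subset)
    show "\<gamma> t \<in> fst c \<inter> W" if "t \<in> ?I" for t using that k(4) JW by auto
    show "metric_coord A h c (snd c (\<gamma> t)) (a t) w
        + christoffel A h c (snd c (\<gamma> t)) (v t) (v t) w = 0" if "t \<in> ?I" for t w
      using eq[of t w] that k(4) by (simp only: v_eq[OF that] a_eq[OF that]) simp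
  qed
qed

lemma geodesic_continuous:
  assumes \<gamma>: "geodesic A W h J \<gamma>" and J: "open J" "t0 \<in> J"
    and U: "openin (manifold_topology A) U" "\<gamma> t0 \<in> U"
  shows "\<forall>\<^sub>F t in nhds t0. \<gamma> t \<in> U"
proof -
  have "\<gamma> t0 \<in> carrier_of A"
    using U openin_manifold_topology[of A, OF chart_inj[OF A]] by blast
  then obtain c where c: "c \<in> A" "\<gamma> t0 \<in> fst c" by (auto simp: carrier_of_def)
  obtain I v a where I: "open I" "t0 \<in> I" "\<And>t. t \<in> I \<Longrightarrow> \<gamma> t \<in> fst c \<inter> W"
    "\<And>t. t \<in> I \<Longrightarrow> ((\<lambda>t. snd c (\<gamma> t)) has_vector_derivative v t) (at t)"
    using geodesic_chart[OF \<gamma> J c] by metis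
  have "open (snd c ` (U \<inter> fst c))"
    using U(1) c(1) openin_manifold_topology[of A, OF chart_inj[OF A]] by blast
  then have "\<forall>\<^sub>F t in nhds t0. snd c (\<gamma> t) \<in> snd c ` (U \<inter> fst c)"
    using c U(2) by (intro isCont_eventually_in[OF has_vector_derivative_continuous[OF I(4)[OF I(2)]]]) auto
  moreover have "\<forall>\<^sub>F t in nhds t0. t \<in> I" using I(1,2) eventually_nhds by blast
  ultimately show ?thesis
  proof eventually_elim
    case (elim t)
    then show ?case
      using I(3) inj_onD[OF chart_inj[OF A c(1)]] by auto
  qed
qed

text \<open>Continuation past the infimum \<open>T\<close> of the times of disagreement: the curves
  still agree at \<open>T\<close>, have the same velocity there, and so coincide a little
  longer.\<close>

lemma geodesic_unique:
  assumes \<gamma>1: "geodesic A W h {-\<epsilon>1<..<1 + \<epsilon>1} \<gamma>1" "\<epsilon>1 > 0"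
    and \<gamma>2: "geodesic A W h {-\<epsilon>2<..<1 + \<epsilon>2} \<gamma>2" "\<epsilon>2 > 0"
    and init: "\<gamma>1 0 = \<gamma>2 0" "velocity A \<gamma>1 = velocity A \<gamma>2"
  shows "\<gamma>1 1 = \<gamma>2 1"
proof (rule ccontr)
  assume neq: "\<gamma>1 1 \<noteq> \<gamma>2 1"
  define B where "B = {t. 0 \<le> t \<and> t \<le> 1 \<and> \<gamma>1 t \<noteq> \<gamma>2 t}"
  define T where "T = Inf B"
  have B: "1 \<in> B" "bdd_below B" using neq by (auto simp: B_def intro!: bdd_belowI[of _ 0])
  have T: "0 \<le> T" "T \<le> 1"
  proof -
    have "B \<noteq> {}" using B(1) by blast
    then show "0 \<le> T" unfolding T_def by (rule cInf_greatest) (simp add: B_def)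
    show "T \<le> 1" unfolding T_def by (rule cInf_lower[OF B])
  qed
  have agree: "\<gamma>1 t = \<gamma>2 t" if "0 \<le> t" "t < T" for t
  proof (rule ccontr)
    assume "\<gamma>1 t \<noteq> \<gamma>2 t"
    then have "t \<in> B" using that T by (simp add: B_def)
    then have "T \<le> t" unfolding T_def by (rule cInf_lower[OF _ B(2)])
    then show False using that by simp
  qed
  let ?J1 = "{-\<epsilon>1<..<1 + \<epsilon>1}" and ?J2 = "{-\<epsilon>2<..<1 + \<epsilon>2}"
  have J: "open ?J1" "T \<in> ?J1" "open ?J2" "T \<in> ?J2" using T \<gamma>1(2) \<gamma>2(2) by auto
  have inW: "\<gamma>1 T \<in> W" "\<gamma>2 T \<in> W"
    using \<gamma>1(1) \<gamma>2(1) J unfolding geodesic_def by blast+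
  \<comment> \<open>Otherwise disjoint neighbourhoods would separate the curves near
    \<open>T\<close>, also at earlier times, when they agree.\<close>
  have eqT: "\<gamma>1 T = \<gamma>2 T"
  proof (rule ccontr)
    assume neqT: "\<gamma>1 T \<noteq> \<gamma>2 T"
    then have "T > 0" using init(1) T by (cases "T = 0") auto
    have "Hausdorff_space (manifold_topology A)" using A by (simp add: smooth_manifold_def)
    moreover have "\<gamma>1 T \<in> topspace (manifold_topology A)" "\<gamma>2 T \<in> topspace (manifold_topology A)"
      using inW openin_subset[OF W] by auto
    ultimately obtain U1 U2 where U: "openin (manifold_topology A) U1" "openin (manifold_topology A) U2"
      "\<gamma>1 T \<in> U1" "\<gamma>2 T \<in> U2" "disjnt U1 U2"
      using neqT unfolding Hausdorff_space_def by metis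
    have "\<forall>\<^sub>F t in nhds T. \<gamma>1 t \<in> U1 \<and> \<gamma>2 t \<in> U2"
      by (intro eventually_conj geodesic_continuous[OF \<gamma>1(1) J(1,2) U(1,3)]
          geodesic_continuous[OF \<gamma>2(1) J(3,4) U(2,4)])
    then obtain d where d: "d > 0" "\<And>t. dist t T < d \<Longrightarrow> \<gamma>1 t \<in> U1 \<and> \<gamma>2 t \<in> U2"
      unfolding eventually_nhds_metric by blast
    define t where "t = max 0 (T - d / 2)"
    have "0 \<le> t" "t < T" "dist t T < d" using d(1) \<open>T > 0\<close> by (auto simp: t_def dist_real_def)
    then show False
      using agree[of t] d(2)[of t] U(5) by (auto simp: disjnt_def)
  qed
  have "\<gamma>1 T \<in> carrier_of A"
    using inW W openin_manifold_topology[of A, OF chart_inj[OF A]] by blast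
  note ch = chart_at_in[OF this]
  \<comment> \<open>The preferred chart at the common point, so that for \<open>T = 0\<close> the
    given velocities are literally \<open>v1 T\<close> and \<open>v2 T\<close>.\<close>
  define c where "c = chart_at A (\<gamma>1 T)"
  have c: "c \<in> A" "\<gamma>1 T \<in> fst c" "\<gamma>2 T \<in> fst c"
    using ch unfolding c_def[symmetric] eqT[symmetric] by blast+
  obtain I1 v1 a1 where 1: "open I1" "T \<in> I1" "continuous_on I1 v1"
    "\<And>t. t \<in> I1 \<Longrightarrow> \<gamma>1 t \<in> fst c \<inter> W"
    "\<And>t. t \<in> I1 \<Longrightarrow> ((\<lambda>t. snd c (\<gamma>1 t)) has_vector_derivative v1 t) (at t)"
    "\<And>t. t \<in> I1 \<Longrightarrow> (v1 has_vector_derivative a1 t) (at t)"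
    "\<And>t w. t \<in> I1 \<Longrightarrow> metric_coord A h c (snd c (\<gamma>1 t)) (a1 t) w
      + christoffel A h c (snd c (\<gamma>1 t)) (v1 t) (v1 t) w = 0"
    using geodesic_chart[OF \<gamma>1(1) J(1,2) c(1,2)] by metis
  obtain I2 v2 a2 where 2: "open I2" "T \<in> I2" "continuous_on I2 v2" "continuous_on I2 a2"
    "\<And>t. t \<in> I2 \<Longrightarrow> \<gamma>2 t \<in> fst c \<inter> W"
    "\<And>t. t \<in> I2 \<Longrightarrow> ((\<lambda>t. snd c (\<gamma>2 t)) has_vector_derivative v2 t) (at t)"
    "\<And>t. t \<in> I2 \<Longrightarrow> (v2 has_vector_derivative a2 t) (at t)"
    "\<And>t w. t \<in> I2 \<Longrightarrow> metric_coord A h c (snd c (\<gamma>2 t)) (a2 t) w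
      + christoffel A h c (snd c (\<gamma>2 t)) (v2 t) (v2 t) w = 0"
    using geodesic_chart[OF \<gamma>2(1) J(3,4) c(1,3)] by metis
  have agree': "\<gamma>1 t = \<gamma>2 t" if "0 \<le> t" "t \<le> T" for t
    using agree[OF that(1)] eqT that(2) by (cases "t = T") simp_all
  have eqv: "v1 T = v2 T"
  proof (cases "T = 0")
    case True
    have "velocity A \<gamma>1 = v1 T" "velocity A \<gamma>2 = v2 T"
      using vector_derivative_at[OF 1(5)[OF 1(2)]] vector_derivative_at[OF 2(6)[OF 2(2)]] init(1)
      by (simp_all add: velocity_def coord_at_def o_def c_def True)
    then show ?thesis using init(2) by simp
  next
    case False
    \<comment> \<open>The difference vanishes on [0, T], and the derivative at \<open>T\<close> is
      already determined from the left.\<close>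
    have "((\<lambda>t. snd c (\<gamma>1 t) - snd c (\<gamma>2 t)) has_vector_derivative v1 T - v2 T) (at T)"
      by (intro has_vector_derivative_diff 1 2)
    then have "((\<lambda>t. snd c (\<gamma>1 t) - snd c (\<gamma>2 t)) has_vector_derivative v1 T - v2 T) (at T within {0..T})"
      by (rule has_vector_derivative_at_within)
    moreover have "((\<lambda>t. snd c (\<gamma>1 t) - snd c (\<gamma>2 t)) has_vector_derivative 0) (at T within {0..T})"
      by (rule has_vector_derivative_transform[OF _ _ has_vector_derivative_const[of 0]])
        (use T agree' in simp_all)
    ultimately have "v1 T - v2 T = 0"
      using T False by (intro vector_derivative_unique_within_closed_interval[of 0 T]) auto
    then show ?thesis by simp
  qed
  interpret metric_on "snd c ` (fst c \<inter> W)" "metric_coord A h c"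
    by (rule metric_on_chart[OF c(1)])
  have Chr: "christoffel A h c y u u w = Chr y u w" for y u w
    by (simp add: christoffel_def Chr_def)
  let ?I = "I1 \<inter> I2"
  have I: "open ?I" "T \<in> ?I" using 1 2 by auto
  have x0: "snd c (\<gamma>1 T) = snd c (\<gamma>2 T)" by (simp add: eqT)
  obtain \<delta> where \<delta>: "\<delta> > 0" "\<And>t. T \<le> t \<Longrightarrow> t < T + \<delta> \<Longrightarrow> snd c (\<gamma>1 t) = snd c (\<gamma>2 t)"
    by (rule local_uniqueness[OF I, of "\<lambda>t. snd c (\<gamma>1 t)" v1 a1 "\<lambda>t. snd c (\<gamma>2 t)" v2 a2])
      (use 1 2 eqv x0 in \<open>auto simp: Chr intro: continuous_on_subset\<close>)
  obtain d where d: "d > 0" "ball T d \<subseteq> ?I" using I open_contains_ball by blast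
  have "\<gamma>1 t = \<gamma>2 t" if "T \<le> t" "t < T + min \<delta> d" for t
  proof -
    have "t \<in> ?I" using d(2) that by (auto simp: dist_real_def)
    then show ?thesis
      using \<delta>(2)[of t] that inj_onD[OF chart_inj[OF A c(1)]] 1(4) 2(5) by auto
  qed
  \<comment> \<open>No time of disagreement precedes this bound, contrary to \<open>T\<close> being
    the infimum.\<close>
  then have "T + min \<delta> d \<le> t" if "t \<in> B" for t
    using that agree[of t] by (cases "t < T") (auto simp: B_def not_less intro: leI)
  then have "T + min \<delta> d \<le> T"
    unfolding T_def using B(1) by (intro cInf_greatest) auto
  then show False using \<delta>(1) d(1) by simp
qed

text \<open>Uniqueness of geodesics makes the description well-defined; the endpoint is in
  \<open>W\<close> because geodesics stay in it by definition.\<close>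

lemma riem_exp_in:
  assumes "s \<in> riem_exp_domain A W h q0"
  shows "riem_exp A W h q0 s \<in> W"
proof -
  obtain q where q: "geodesic_endpoint A W h q0 s q"
    using assms by (auto simp: riem_exp_domain_def)
  have "riem_exp A W h q0 s = q"
    unfolding riem_exp_def
  proof (rule the_equality)
    show "geodesic_endpoint A W h q0 s q" by (rule q)
    show "q' = q" if "geodesic_endpoint A W h q0 s q'" for q'
      using that q geodesic_unique unfolding geodesic_endpoint_def by metis
  qed
  moreover obtain \<gamma> \<epsilon> where "\<epsilon> > 0" "geodesic A W h {-\<epsilon><..<1 + \<epsilon>} \<gamma>" "\<gamma> 1 = q"
    using q unfolding geodesic_endpoint_def by blast
  then have "q \<in> W" unfolding geodesic_def by force
  ultimately show ?thesis by simp
qed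

end

subsection \<open>Equivariance\<close>

context slice_tube
begin

lemma lt_tangent_map_chart_at:
  assumes z: "z \<in> SO3 \<times> S" "snd u \<in> N"
  shows "((\<lambda>t. coord_at A (\<tau> z) (\<tau> (lt_curve z u t))) has_vector_derivative
      lt_tangent_map A \<tau> z u) (at 0)"
    and "\<forall>\<^sub>F t in nhds 0. \<tau> (lt_curve z u t) \<in> fst (chart_at A (\<tau> z))"
proof -
  let ?c = "chart_at A (\<tau> z)"
  have "\<tau> z \<in> carrier_of A"
    using smooth_\<tau>[unfolded smooth_into_def, THEN conjunct1] z(1) by auto
  from chart_at_in[OF this] have c: "?c \<in> A" "\<tau> z \<in> fst ?c" by blast+
  have L: "lt_tangent_map A \<tau> z u = of_slice ?c z u"
    unfolding lt_tangent_map_eq[OF c(1) z(1) c(2) z(2)] from_chart_eq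
    by (rule transition_deriv_refl[OF A c])
  show "((\<lambda>t. coord_at A (\<tau> z) (\<tau> (lt_curve z u t))) has_vector_derivative
      lt_tangent_map A \<tau> z u) (at 0)"
    "\<forall>\<^sub>F t in nhds 0. \<tau> (lt_curve z u t) \<in> fst (chart_at A (\<tau> z))"
    unfolding L coord_at_def
    using of_slice_curve[OF c(1) z(1) c(2) lt_curve_has_vector_derivative lt_curve_in[OF z]
        lt_curve_0 z(2)] by auto
qed

text \<open>\<open>frechet_derivative\<close> has its meaning only where a derivative exists; joint
  smoothness of the action, with \<open>R\<close> held fixed, provides one.\<close>

lemma self_tangent_map_has_derivative:
  assumes act: "smooth_action A act" and R: "R \<in> SO3" and q: "q \<in> carrier_of A"
  shows "(coord_at A (act R q) \<circ> act R \<circ> param_at A q has_derivative self_tangent_map A (act R) q)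
    (at (coord_at A q q))"
proof -
  let ?c = "chart_at A q" and ?c' = "chart_at A (act R q)"
  have c: "?c \<in> A" "q \<in> fst ?c" using chart_at_in[OF q] by auto
  have "act R q \<in> carrier_of A" using act R q unfolding smooth_action_def by blast
  from chart_at_in[OF this] have c': "?c' \<in> A" "act R q \<in> fst ?c'" by blast+
  let ?X = "SO3 \<times> snd ?c ` fst ?c" and ?f = "\<lambda>(R, y). act R (inv_into (fst ?c) (snd ?c) y)"
  have "smooth_into ?X A ?f"
    using act c(1) unfolding smooth_action_def by (auto simp: split_def)
  moreover have "(R, snd ?c q) \<in> ?X" using R c by auto
  moreover have "?f (R, snd ?c q) \<in> fst ?c'" using c' by (simp add: chart_inv[OF A c])
  ultimately obtain Y k where k: "open Y" "(R, snd ?c q) \<in> Y" "smooth_on Y k"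
    "\<And>y. y \<in> ?X \<Longrightarrow> y \<in> Y \<Longrightarrow> snd ?c' (?f y) = k y"
    using smooth_intoD[of ?X A ?f "(R, snd ?c q)" ?c'] c'(1) by metis
  have Y: "open ((\<lambda>y. (R, y)) -` Y)"
    by (intro open_vimage k continuous_intros)
  have D: "open (snd ?c ` fst ?c \<inter> (\<lambda>y. (R, y)) -` Y)"
    by (intro open_Int Y chart_open[OF A c(1)])
  have "((\<lambda>y. (R, y)) has_derivative (\<lambda>v. (0, v))) (at (snd ?c q))"
    by (intro has_derivative_Pair has_derivative_const has_derivative_ident)
  from has_derivative_compose[OF this smooth_on_has_derivative[OF k(3,2)]]
  have "((\<lambda>y. k (R, y)) has_derivative (\<lambda>v. frechet_derivative k (at (R, snd ?c q)) (0, v)))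
      (at (snd ?c q))" .
  then have "(snd ?c' \<circ> act R \<circ> inv_into (fst ?c) (snd ?c) has_derivative
      (\<lambda>v. frechet_derivative k (at (R, snd ?c q)) (0, v))) (at (snd ?c q))"
  proof (rule has_derivative_transform_within_open[OF _ D])
    show "snd ?c q \<in> snd ?c ` fst ?c \<inter> (\<lambda>y. (R, y)) -` Y" using c k(2) by auto
    show "k (R, y) = (snd ?c' \<circ> act R \<circ> inv_into (fst ?c) (snd ?c)) y"
      if "y \<in> snd ?c ` fst ?c \<inter> (\<lambda>y. (R, y)) -` Y" for y
      using k(4)[of "(R, y)"] that R by auto
  qed
  then have "snd ?c' \<circ> act R \<circ> inv_into (fst ?c) (snd ?c) differentiable (at (snd ?c q))"
    by (auto simp: differentiable_def)
  then show ?thesis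
    unfolding self_tangent_map_def coord_at_def param_at_def frechet_derivative_works .
qed

text \<open>Left multiplication moves the base point and leaves the left-trivialised momentum alone.
  The inverse of \<open>R\<close> carries the image under \<tau> of one left-trivialised curve to
  that of the other, so its tangent map takes \<open>?L' u\<close> to \<open>?L u\<close>, and both
  covectors pair to \<open>\<alpha> \<bullet> u\<close>.\<close>

lemma tube_equivariant:
  assumes act: "smooth_action A act"
    and \<tau>: "\<And>R R' s. \<lbrakk>R \<in> SO3; R' \<in> SO3; s \<in> S\<rbrakk> \<Longrightarrow> \<tau> (R ** R', s) = act R (\<tau> (R', s))"
    and R: "R \<in> SO3" and gx: "(g, x) \<in> tube_source \<mu> N S"
  shows "tube A N \<tau> \<mu> (R ** g, x) = cotangent_lift A act R (tube A N \<tau> \<mu> (g, x))"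
proof -
  obtain \<nu> \<rho> s \<sigma> where x: "x = ((\<nu>, \<rho>), (s, \<sigma>))" by (metis surj_pair)
  have gx': "(R ** g, x) \<in> tube_source \<mu> N S"
    using gx R by (auto simp: tube_source_def SO3_mult)
  define z where "z = tube_base \<mu> (g, x)"
  define \<alpha> where "\<alpha> = tube_mom \<mu> (g, x)"
  define z' where "z' = tube_base \<mu> (R ** g, x)"
  have z'_eq: "z' = (R ** fst z, snd z)" and \<alpha>': "tube_mom \<mu> (R ** g, x) = \<alpha>"
    by (simp_all add: z_def z'_def \<alpha>_def x tube_base_def tube_mom_def tube_map_def matrix_mul_assoc)
  have z: "z \<in> SO3 \<times> S" and z': "z' \<in> SO3 \<times> S"
    unfolding z_def z'_def by (intro tube_base_in(1) gx gx')+
  define q where "q = \<tau> z"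
  have q': "\<tau> z' = act R q"
    using \<tau>[OF R, of "fst z" "snd z"] z by (auto simp: z'_eq q_def)
  obtain c where c: "c \<in> A" "\<tau> z \<in> fst c" using base_chart[OF gx] unfolding z_def .
  obtain c' where c': "c' \<in> A" "\<tau> z' \<in> fst c'" using base_chart[OF gx'] unfolding z'_def .
  let ?L = "lt_tangent_map A \<tau> z" and ?L' = "lt_tangent_map A \<tau> z'"
  obtain p where p: "cotangent_lift_inverse A N \<tau> (z, \<alpha>) = (q, p)"
    "\<And>w. p \<bullet> w = \<alpha> \<bullet> inv_into (UNIV \<times> N) ?L w"
    "\<And>u. snd u \<in> N \<Longrightarrow> inv_into (UNIV \<times> N) ?L (?L u) = u"
    unfolding q_def by (rule cotangent_lift_inverse_eq[OF c(1) z c(2), of \<alpha>]) blast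
  obtain p' where p': "cotangent_lift_inverse A N \<tau> (z', \<alpha>) = (act R q, p')"
    "\<And>w. p' \<bullet> w = \<alpha> \<bullet> inv_into (UNIV \<times> N) ?L' w"
    "\<And>u. snd u \<in> N \<Longrightarrow> inv_into (UNIV \<times> N) ?L' (?L' u) = u"
    "\<And>w. \<exists>u\<in>UNIV \<times> N. ?L' u = w"
    unfolding q'[symmetric] by (rule cotangent_lift_inverse_eq[OF c'(1) z' c'(2), of \<alpha>]) blast
  have q: "q \<in> carrier_of A" unfolding q_def by (rule carrier_ofI[OF A c])
  have Rq: "act R q \<in> carrier_of A" unfolding q'[symmetric] by (rule carrier_ofI[OF A c'])
  let ?R' = "matrix_inv R"
  have R': "?R' \<in> SO3" "?R' ** R = mat 1"
    using R by (simp_all add: SO3_matrix_inv SO3_transpose SO3_transpose_mult)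
  have undo: "act ?R' (act R y) = y" if "y \<in> carrier_of A" for y
  proof -
    have "act (?R' ** R) y = act ?R' (act R y)" "act (mat 1) y = y"
      using act R R'(1) that unfolding smooth_action_def by blast+
    then show ?thesis by (simp add: R'(2))
  qed
  let ?D = "self_tangent_map A (act ?R') (act R q)"
  have D: "(coord_at A q \<circ> act ?R' \<circ> param_at A (act R q) has_derivative ?D)
      (at (coord_at A (act R q) (act R q)))"
    using self_tangent_map_has_derivative[OF act R'(1) Rq] by (simp add: undo[OF q])
  have DL: "?D (?L' u) = ?L u" if u: "snd u \<in> N" for u
  proof -
    note d = lt_tangent_map_chart_at[OF z u] and d' = lt_tangent_map_chart_at[OF z' u]
    have "((\<lambda>t. (coord_at A q \<circ> act ?R' \<circ> param_at A (act R q))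
        (coord_at A (act R q) (\<tau> (lt_curve z' u t)))) has_vector_derivative ?D (?L' u)) (at 0)"
      by (rule has_vector_derivative_compose[OF d'(1)[unfolded q']]) (simp only: lt_curve_0 q' D)
    moreover have "\<forall>\<^sub>F t in nhds 0. (coord_at A q \<circ> act ?R' \<circ> param_at A (act R q))
        (coord_at A (act R q) (\<tau> (lt_curve z' u t))) = coord_at A q (\<tau> (lt_curve z u t))"
      using d'(2) lt_curve_in[OF z u]
    proof eventually_elim
      case (elim t)
      have "lt_curve z' u t = (R ** fst (lt_curve z u t), snd (lt_curve z u t))"
        by (simp add: lt_curve_def z'_eq split_def matrix_mul_assoc)
      then have \<tau>': "\<tau> (lt_curve z' u t) = act R (\<tau> (lt_curve z u t))"
        using \<tau>[OF R, of "fst (lt_curve z u t)" "snd (lt_curve z u t)"] elim(2) by auto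
      have "\<tau> (lt_curve z u t) \<in> carrier_of A"
        using smooth_\<tau>[unfolded smooth_into_def, THEN conjunct1] elim(2) by auto
      then show ?case
        using elim(1) chart_inv[OF A] chart_at_in[OF Rq] undo
        by (simp add: coord_at_def param_at_def q' \<tau>')
    qed
    ultimately have "((\<lambda>t. coord_at A q (\<tau> (lt_curve z u t))) has_vector_derivative ?D (?L' u)) (at 0)"
      by (rule has_vector_derivative_eventually)
    then show ?thesis
      using d(1)[folded q_def] by (rule vector_derivative_unique_at)
  qed
  have "adjoint ?D p \<bullet> w = p' \<bullet> w" for w
  proof -
    obtain u where u: "snd u \<in> N" "w = ?L' u" using p'(4)[of w] by auto
    have "adjoint ?D p \<bullet> w = p \<bullet> ?D w"
      by (rule adjoint_clauses(2)[OF has_derivative_linear[OF D]])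
    also have "\<dots> = \<alpha> \<bullet> u" unfolding u(2) DL[OF u(1)] p(2) p(3)[OF u(1)] ..
    also have "\<dots> = p' \<bullet> w" unfolding u(2) p'(2) p'(3)[OF u(1)] ..
    finally show ?thesis .
  qed
  then have "adjoint ?D p = p'" by (metis vector_eq_rdot)
  then show ?thesis
    unfolding tube_eq[OF gx] tube_eq[OF gx'] \<alpha>' z_def[symmetric] z'_def[symmetric] \<alpha>_def[symmetric] p(1) p'(1)
    by (simp add: cotangent_lift_def)
qed

end

theorem proposition2:
  fixes A :: "('q, 'e::euclidean_space) chart set"
    and act :: "real^3^3 \<Rightarrow> 'q \<Rightarrow> 'q"
    and q0 :: 'q
    and W :: "'q set"
    and h :: "'q \<Rightarrow> 'e \<Rightarrow> 'e \<Rightarrow> real"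
    and N S :: "'e set"
    and \<tau> :: "(real^3^3) \<times> 'e \<Rightarrow> 'q"
    and \<mu> :: "real^3"
  assumes "smooth_manifold A"
    and "smooth_action A act"
    and "free_action A act"
    and "q0 \<in> carrier_of A"
    and "openin (manifold_topology A) W" "q0 \<in> W" "riemannian_metric A W h"
    and "N = {v. \<forall>u\<in>group_orbit_tangent A act q0. h q0 u v = 0}"
    and "openin (top_of_set N) S" "0 \<in> S" "S \<subseteq> riem_exp_domain A W h q0"
    and "\<tau> = (\<lambda>(R, s). act R (riem_exp A W h q0 s))"
    and "diffeo_onto_open (SO3 \<times> S) A \<tau>"
    and "\<mu> \<noteq> 0"
  shows "(\<forall>R\<in>SO3. \<forall>g x. (g, x) \<in> tube_source \<mu> N S \<longrightarrow>
            tube A N \<tau> \<mu> (R ** g, x) = cotangent_lift A act R (tube A N \<tau> \<mu> (g, x)))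
       \<and> symplectomorphism_onto_image (tube_source \<mu> N S) (tube_source_tangent \<mu> N)
            (tube_source_form \<mu>) A (tube A N \<tau> \<mu>)"
proof -
  have "bilinear (h q0)"
    using assms(6,7) unfolding riemannian_metric_def by blast
  then have N: "subspace N"
    unfolding assms(8)
    by (auto intro!: subspaceI simp: bilinear_rzero bilinear_radd bilinear_rmul)
  interpret slice_tube A N S \<tau> \<mu>
    by unfold_locales (fact assms N)+
  \<comment> \<open>The action law is available on the carrier only, so the exponential must be
    known to land there before \<tau> can be seen to be equivariant.\<close>
  have "riem_exp A W h q0 s \<in> carrier_of A" if "s \<in> S" for s
    using riem_exp_in[OF assms(1,5,7), of s q0] assms(5,11) that
      openin_manifold_topology[of A W, OF chart_inj[OF assms(1)]] by blast
  then have "\<tau> (R ** R', s) = act R (\<tau> (R', s))" if "R \<in> SO3" "R' \<in> SO3" "s \<in> S" for R R' s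
    using assms(2) that unfolding smooth_action_def assms(12) by simp
  from tube_equivariant[OF assms(2) this] tube_symplectomorphism
  show ?thesis by blast
qed

end
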